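(* Let $1<p<5$ and $\omega>0$. Then there exists a ground state $Q_\omega\in X$, $Q_\omega\neq 0$, of the equation $$-\partial_{xx}Q+|D_y|Q+\omega Q-|Q|^{p-1}Q=0\quad\text{in }\mathbb{R}^2,$$ which attains the constrained minimization problem $$m_\omega=\inf\{\mathcal{S}_\omega(u)\mid u\in X\setminus\{0\},\ \mathcal{N}_\omega(u)=0\},$$ i.e. $\mathcal{N}_\omega(Q_\omega)=0$ and $\mathcal{S}_\omega(Q_\omega)=m_\omega$.
   Context: Functions are complex-valued on $\mathbb{R}^2$ with variables $(x,y)$. $|D_y|=\sqrt{-\partial_{yy}}$ is the Fourier multiplier in $y$ with symbol $|\eta|$, and $|D_y|^{1/2}$ the one with symbol $|\eta|^{1/2}$. The energy space is $X=H^1_xL^2_y(\mathbb{R}^2)\cap L^2_xH^{1/2}_y(\mathbb{R}^2)$ with norm $\|u\|_X=(\|\partial_xu\|_{L^2}^2+\||D_y|^{1/2}u\|_{L^2}^2+\|u\|_{L^2}^2)^{1/2}$. Define on $X$ $$\mathcal{S}_\omega(u)=\tfrac12\|\partial_xu\|_{L^2}^2+\tfrac12\||D_y|^{1/2}u\|_{L^2}^2+\tfrac{\omega}{2}\|u\|_{L^2}^2-\tfrac1{p+1}\|u\|_{L^{p+1}}^{p+1},$$ $$\mathcal{N}_\omega(u)=\|\partial_xu\|_{L^2}^2+\||D_y|^{1/2}u\|_{L^2}^2+\omega\|u\|_{L^2}^2-\|u\|_{L^{p+1}}^{p+1}.$$ A function $Q\in X$ is a solution of the equation if and only if it is a critical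 point of $\mathcal{S}_\omega$ on $X$. A ground state is a non-trivial solution $Q\in X$ of the equation which minimizes $\mathcal{S}_\omega$ among all non-trivial solutions in $X$. *)

theory Defs
  imports "HOL-Analysis.Analysis"
begin

text \<open>
  Functions on the plane are represented by Borel measurable representatives; elements of the
  function spaces are understood modulo equality almost everywhere. In particular "nonzero" means
  "not almost everywhere zero".
\<close>

type_synonym plane_fun = "real \<times> real \<Rightarrow> complex"

definition L2 :: "plane_fun set" where
  "L2 = {u. u \<in> borel_measurable lborel \<and> integrable lborel (\<lambda>z. (cmod (u z))\<^sup>2)}"

definition L2_norm :: "plane_fun \<Rightarrow> real" where
  "L2_norm u = sqrt (LINT z|lborel. (cmod (u z))\<^sup>2)"

definition nonzero :: "plane_fun \<Rightarrow> bool" where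
  "nonzero u \<longleftrightarrow> \<not> (AE z in lborel. u z = 0)"


subsection \<open>The weak derivative in \<open>x\<close>\<close>

fun Ck :: "nat \<Rightarrow> plane_fun \<Rightarrow> bool" where
  "Ck 0 \<phi> \<longleftrightarrow> continuous_on UNIV \<phi>"
| "Ck (Suc k) \<phi> \<longleftrightarrow> continuous_on UNIV \<phi> \<and>
     (\<exists>\<phi>x \<phi>y. Ck k \<phi>x \<and> Ck k \<phi>y \<and>
       (\<forall>x y. ((\<lambda>s. \<phi> (s, y)) has_vector_derivative \<phi>x (x, y)) (at x) \<and>
              ((\<lambda>t. \<phi> (x, t)) has_vector_derivative \<phi>y (x, y)) (at y)))"

definition test_functions :: "plane_fun set" where
  "test_functions = {\<phi>. (\<forall>k. Ck k \<phi>) \<and> compact (closure {z. \<phi> z \<noteq> 0})}"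

definition classical_dx :: "plane_fun \<Rightarrow> plane_fun" where
  "classical_dx \<phi> z = vector_derivative (\<lambda>s. \<phi> (s, snd z)) (at (fst z))"

definition has_weak_dx :: "plane_fun \<Rightarrow> plane_fun \<Rightarrow> bool" where
  "has_weak_dx u v \<longleftrightarrow> u \<in> L2 \<and> v \<in> L2 \<and>
     (\<forall>\<phi>\<in>test_functions.
        (LINT z|lborel. u z * classical_dx \<phi> z) = - (LINT z|lborel. v z * \<phi> z))"

text \<open>Both this choice and the one in \<open>Dy_half\<close> below are unique up to null sets whenever they
  exist, which is the case on the energy space.\<close>

definition Dx :: "plane_fun \<Rightarrow> plane_fun" where
  "Dx u = (SOME v. has_weak_dx u v)"


subsection \<open>Fourier multipliers on \<open>L\<^sup>2\<close>\<close>

definition fourier_integral :: "plane_fun \<Rightarrow> plane_fun" where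
  "fourier_integral f \<zeta> = (LINT z|lborel. cis (- (z \<bullet> \<zeta>)) * f z) / (2 * pi)"

text \<open>The graph of the Fourier--Plancherel transform: the closure in \<open>L\<^sup>2 \<times> L\<^sup>2\<close> of the graph of
  the Fourier integral on \<open>L\<^sup>1 \<inter> L\<^sup>2\<close>. The limits are stated with nonnegative integrals, so that
  no integrability of the differences is presupposed.\<close>

definition has_fourier :: "plane_fun \<Rightarrow> plane_fun \<Rightarrow> bool" where
  "has_fourier u w \<longleftrightarrow> u \<in> L2 \<and> w \<in> L2 \<and>
     (\<exists>f :: nat \<Rightarrow> plane_fun.
        (\<forall>n. f n \<in> L2 \<and> integrable lborel (f n)) \<and>
        (\<lambda>n. \<integral>\<^sup>+z. ennreal ((cmod (f n z - u z))\<^sup>2) \<partial>lborel) \<longlonglongrightarrow> 0 \<and>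
        (\<lambda>n. \<integral>\<^sup>+\<zeta>. ennreal ((cmod (fourier_integral (f n) \<zeta> - w \<zeta>))\<^sup>2) \<partial>lborel) \<longlonglongrightarrow> 0)"

definition has_multiplier :: "(real \<times> real \<Rightarrow> real) \<Rightarrow> plane_fun \<Rightarrow> plane_fun \<Rightarrow> bool" where
  "has_multiplier \<sigma> u v \<longleftrightarrow>
     (\<exists>w. has_fourier u w \<and> has_fourier v (\<lambda>\<zeta>. complex_of_real (\<sigma> \<zeta>) * w \<zeta>))"

abbreviation has_Dy_half :: "plane_fun \<Rightarrow> plane_fun \<Rightarrow> bool" where
  "has_Dy_half \<equiv> has_multiplier (\<lambda>(\<xi>, \<eta>). sqrt \<bar>\<eta>\<bar>)"

definition Dy_half :: "plane_fun \<Rightarrow> plane_fun" where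
  "Dy_half u = (SOME v. has_Dy_half u v)"


subsection \<open>The energy space and the functionals\<close>

definition X :: "plane_fun set" where
  "X = {u \<in> L2. (\<exists>v. has_weak_dx u v) \<and> (\<exists>v. has_Dy_half u v)}"

definition X_norm :: "plane_fun \<Rightarrow> real" where
  "X_norm u = sqrt ((L2_norm (Dx u))\<^sup>2 + (L2_norm (Dy_half u))\<^sup>2 + (L2_norm u)\<^sup>2)"

text \<open>The term \<open>\<parallel>u\<parallel>\<close> in \<open>L\<^sup>q\<close> to the power \<open>q = p + 1\<close>; the integrand is integrable for \<open>u \<in> X\<close>
  and \<open>1 < p < 5\<close> by the anisotropic Sobolev embedding.\<close>

definition Lq_norm_pow :: "real \<Rightarrow> plane_fun \<Rightarrow> real" where
  "Lq_norm_pow q u = (LINT z|lborel. cmod (u z) powr q)"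

definition action :: "real \<Rightarrow> real \<Rightarrow> plane_fun \<Rightarrow> real" where
  "action p \<omega> u = 1/2 * (L2_norm (Dx u))\<^sup>2 + 1/2 * (L2_norm (Dy_half u))\<^sup>2
     + \<omega>/2 * (L2_norm u)\<^sup>2 - 1 / (p + 1) * Lq_norm_pow (p + 1) u"

definition nehari :: "real \<Rightarrow> real \<Rightarrow> plane_fun \<Rightarrow> real" where
  "nehari p \<omega> u = (L2_norm (Dx u))\<^sup>2 + (L2_norm (Dy_half u))\<^sup>2
     + \<omega> * (L2_norm u)\<^sup>2 - Lq_norm_pow (p + 1) u"


subsection \<open>Solutions and ground states\<close>

text \<open>\<open>J\<close> is Frechet differentiable at \<open>Q\<close> with respect to the norm of \<open>X\<close> (a real Hilbert space),
  with derivative zero.\<close>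

definition critical_point :: "(plane_fun \<Rightarrow> real) \<Rightarrow> plane_fun \<Rightarrow> bool" where
  "critical_point J Q \<longleftrightarrow> Q \<in> X \<and>
     (\<forall>\<epsilon>>0. \<exists>\<delta>>0. \<forall>h\<in>X. X_norm h < \<delta> \<longrightarrow>
        \<bar>J (\<lambda>z. Q z + h z) - J Q\<bar> \<le> \<epsilon> * X_norm h)"

definition solution :: "real \<Rightarrow> real \<Rightarrow> plane_fun \<Rightarrow> bool" where
  "solution p \<omega> Q \<longleftrightarrow> critical_point (action p \<omega>) Q"

text \<open>The equation \<open>- \<partial>\<^sub>x\<^sub>x Q + |D\<^sub>y| Q + \<omega> Q - |Q|\<^sup>p\<^sup>-\<^sup>1 Q = 0\<close>, read in the dual of \<open>X\<close>: both
  \<open>- \<partial>\<^sub>x\<^sub>x\<close> and \<open>|D\<^sub>y|\<close> are split symmetrically between \<open>Q\<close> and the test element.\<close>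

definition equation_holds :: "real \<Rightarrow> real \<Rightarrow> plane_fun \<Rightarrow> bool" where
  "equation_holds p \<omega> Q \<longleftrightarrow> Q \<in> X \<and>
     (\<forall>v\<in>X. (LINT z|lborel. Dx Q z * cnj (Dx v z) + Dy_half Q z * cnj (Dy_half v z)
         + complex_of_real \<omega> * Q z * cnj (v z)
         - complex_of_real (cmod (Q z) powr (p - 1)) * Q z * cnj (v z)) = 0)"

definition ground_state :: "real \<Rightarrow> real \<Rightarrow> plane_fun \<Rightarrow> bool" where
  "ground_state p \<omega> Q \<longleftrightarrow> Q \<in> X \<and> nonzero Q \<and> solution p \<omega> Q \<and>
     (\<forall>u\<in>X. nonzero u \<and> solution p \<omega> u \<longrightarrow> action p \<omega> Q \<le> action p \<omega> u)"

text \<open>For \<open>p > 1\<close> the set below is bounded below by \<open>0\<close>, since on it the action equals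
  \<open>(1/2 - 1/(p+1))\<close> times \<open>Lq_norm_pow (p + 1) u\<close>; so the real infimum is the intended one as soon
  as the set is nonempty.\<close>

definition min_level :: "real \<Rightarrow> real \<Rightarrow> real" where
  "min_level p \<omega> = Inf {action p \<omega> u | u. u \<in> X \<and> nonzero u \<and> nehari p \<omega> u = 0}"

end

theory Submission
  imports Defs "HOL-Probability.Characteristic_Functions" "HOL-Complex_Analysis.Great_Picard"
    "HOL-Computational_Algebra.Polynomial"
begin

text \<open>
Put \<open>q = p + 1\<close>, so that \<open>2 < q < 6\<close>, and write \<open>B u\<close> for the integral of \<open>|u|\<^sup>q\<close> and
\<open>E u\<close> for the quadratic part of the functionals. By Plancherel, \<open>E u\<close> is the squared
\<open>L\<^sup>2\<close> norm of \<open>\<surd>(\<xi>\<^sup>2 + |\<eta>| + \<omega>)\<close> times the Fourier transform of \<open>u\<close>. The ground state is a multiple of a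
function that maximizes \<open>B\<close> on the ball \<open>E \<le> 1\<close>.

\<^bold>\<open>A maximizer gives a ground state.\<close> Let \<open>I\<close> be the supremum of \<open>B\<close> on the ball. By homogeneity
\<open>B u \<le> I (E u)\<^sup>q\<^sup>/\<^sup>2\<close>. On the Nehari set \<open>B = E\<close>, hence the action there is
\<open>(1/2 - 1/q) E\<close>, and every nonzero \<open>u\<close> on it satisfies \<open>1 \<le> I (E u)\<^sup>q\<^sup>/\<^sup>2\<^sup>-\<^sup>1\<close>. A maximizer,
multiplied by the constant that turns its Euler--Lagrange equation into the given equation, lies on
the Nehari set and has equality in the last bound, so that it minimizes the action there. All
solutions lie on the Nehari set, as differentiating the action at \<open>u\<close> in the direction \<open>u\<close> shows;
therefore the minimizer also has least action among the nontrivial solutions.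

\<^bold>\<open>A maximizer exists.\<close> All the analysis of the embedding rests on one estimate. Let \<open>A\<^sub>k u\<close> be
the average of \<open>u\<close> over the dyadic boxes of size \<open>2\<^sup>-\<^sup>k\<close> by \<open>4\<^sup>-\<^sup>k\<close>, which are adapted
to the anisotropy of the symbol \<open>\<xi>\<^sup>2 + |\<eta>|\<close>. If \<open>E u \<le> 1\<close>, translating \<open>u\<close> by a vector \<open>h\<close> of such a
box moves it in \<open>L\<^sup>2\<close> by at most \<open>2\<^sup>1\<^sup>-\<^sup>k\<close>, because \<open>|cis (h \<bullet> \<zeta>) - 1| \<le> 2\<^sup>1\<^sup>-\<^sup>k \<surd>(\<xi>\<^sup>2 + |\<eta>| + \<omega>)\<close>
(\<open>cis_translation_symbol_bound\<close>); by a Poincare inequality \<open>u - A\<^sub>k u\<close> is at most twice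
as large. The boxes have measure \<open>8\<^sup>-\<^sup>k\<close>, so that the plane behaves like a space of
dimension 3 with critical exponent 6, and one obtains in turn the embedding into \<open>L\<^sup>q\<close>
(\<open>dyadic_class_Sobolev\<close>), the fact that a function with \<open>B u\<close> bounded below has a large average over
some box of a fixed size (\<open>dyadic_class_nonvanishing\<close>), and the almost everywhere convergence of a
subsequence of any sequence in the ball (\<open>dyadic_class_compact\<close>).

A maximizing sequence can be translated so that the large average sits at the origin; its weak
limit \<open>v\<close> is then not zero. Mass could still escape to infinity. This is excluded by passing to the
limit in the Euler--Lagrange equation instead of in \<open>B\<close>: members of a maximizing sequence satisfy
that equation approximately, and both sides are continuous along the sequence once the test function
is fixed (\<open>Euler_Lagrange_limit\<close>). Tested with \<open>v\<close> itself, the limit equation says \<open>B v = I E v\<close>.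
Since \<open>E v \<le> 1\<close> and \<open>B v \<le> I (E v)\<^sup>q\<^sup>/\<^sup>2\<close> with \<open>q/2 > 1\<close>, this forces \<open>E v = 1\<close>.

\<^bold>\<open>The Fourier side.\<close> The Plancherel theorem is obtained by Gaussian regularization
(\<open>gauss_weighted_Plancherel\<close>). The weak derivative in \<open>x\<close> corresponds to multiplication by \<open>\<i>\<xi>\<close>
(\<open>has_weak_dx_fourier\<close> and its converse), which is proved through translations in \<open>x\<close>.
\<close>

section \<open>The Hilbert space of square integrable functions\<close>

definition ip :: "plane_fun \<Rightarrow> plane_fun \<Rightarrow> complex" where
  "ip u v = (LINT z|lborel. u z * cnj (v z))"

definition tau :: "real \<times> real \<Rightarrow> plane_fun \<Rightarrow> plane_fun" where
  "tau h u = (\<lambda>z. u (z + h))"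

lemma borel_measurable_cnj [measurable]: "cnj \<in> borel_measurable borel"
  by (intro borel_measurable_continuous_onI continuous_intros)

lemma L2_measurable [measurable_dest]: "u \<in> L2 \<Longrightarrow> u \<in> borel_measurable borel"
  by (simp add: L2_def)

lemma L2_square_integrable: "u \<in> L2 \<Longrightarrow> integrable lborel (\<lambda>z. (cmod (u z))\<^sup>2)"
  by (simp add: L2_def)

lemma L2_norm_nonneg [simp]: "0 \<le> L2_norm u"
  by (simp add: L2_norm_def)

lemma L2_norm_sq: "(L2_norm u)\<^sup>2 = (LINT z|lborel. (cmod (u z))\<^sup>2)"
  by (simp add: L2_norm_def)

lemma L2_nn_integral:
  "u \<in> L2 \<Longrightarrow> (\<integral>\<^sup>+z. ennreal ((cmod (u z))\<^sup>2) \<partial>lborel) = ennreal ((L2_norm u)\<^sup>2)"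
  unfolding L2_norm_sq by (rule nn_integral_eq_integral) (auto simp: L2_square_integrable)

lemma L2I_nn_integral:
  assumes "u \<in> borel_measurable borel" "(\<integral>\<^sup>+z. ennreal ((cmod (u z))\<^sup>2) \<partial>lborel) \<le> ennreal (c\<^sup>2)"
  shows "u \<in> L2" "0 \<le> c \<Longrightarrow> L2_norm u \<le> c"
proof -
  have "integrable lborel (\<lambda>z. (cmod (u z))\<^sup>2)"
    using assms by (intro integrableI_bounded) (auto intro: le_less_trans)
  then show *: "u \<in> L2" using assms by (simp add: L2_def)
  show "L2_norm u \<le> c" if "0 \<le> c"
  proof (rule power2_le_imp_le[OF _ that])
    show "(L2_norm u)\<^sup>2 \<le> c\<^sup>2"
      using assms(2) unfolding L2_nn_integral[OF *] by (subst (asm) ennreal_le_iff) auto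
  qed
qed

lemma L2I_bound:
  assumes "u \<in> borel_measurable borel" "integrable lborel w" "AE z in lborel. (cmod (u z))\<^sup>2 \<le> w z"
  shows "u \<in> L2"
  unfolding L2_def using assms
  by (auto intro!: Bochner_Integration.integrable_bound[OF assms(2)] elim!: AE_mp)

lemma L2_bound:
  assumes "v \<in> L2" "u \<in> borel_measurable borel" "\<And>z. cmod (u z) \<le> c * cmod (v z)"
  shows "u \<in> L2"
proof (rule L2I_bound[where w="\<lambda>z. c\<^sup>2 * (cmod (v z))\<^sup>2"])
  have "(cmod (u z))\<^sup>2 \<le> (c * cmod (v z))\<^sup>2" for z
    by (rule power_mono[OF assms(3)]) simp
  then show "AE z in lborel. (cmod (u z))\<^sup>2 \<le> c\<^sup>2 * (cmod (v z))\<^sup>2"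
    by (simp add: power_mult_distrib)
qed (use assms in \<open>auto intro: L2_square_integrable\<close>)

lemma L2_zero [simp]: "(\<lambda>z. 0) \<in> L2"
  by (simp add: L2_def)

lemma sum_square_le: "(a + b)\<^sup>2 \<le> 2 * a\<^sup>2 + 2 * (b\<^sup>2 :: real)"
  using sum_squares_bound[of a b] by (simp add: power2_sum)

lemma L2_add [intro]: assumes "u \<in> L2" "v \<in> L2" shows "(\<lambda>z. u z + v z) \<in> L2"
proof (rule L2I_bound[where w="\<lambda>z. 2 * (cmod (u z))\<^sup>2 + 2 * (cmod (v z))\<^sup>2"])
  have "(cmod (u z + v z))\<^sup>2 \<le> (cmod (u z) + cmod (v z))\<^sup>2" for z
    by (rule power_mono) (auto intro: norm_triangle_ineq)
  then show "AE z in lborel. (cmod (u z + v z))\<^sup>2 \<le> 2 * (cmod (u z))\<^sup>2 + 2 * (cmod (v z))\<^sup>2"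
    by (intro AE_I2) (rule order_trans[OF _ sum_square_le], blast)
qed (use assms in \<open>auto intro!: L2_square_integrable\<close>)

lemma L2_cmult [intro]: "u \<in> L2 \<Longrightarrow> (\<lambda>z. c * u z) \<in> L2"
  by (rule L2_bound[where v=u and c="cmod c"]) (auto simp: norm_mult)

lemma L2_uminus [intro]: "u \<in> L2 \<Longrightarrow> (\<lambda>z. - u z) \<in> L2"
  using L2_cmult[of u "-1"] by simp

lemma L2_diff [intro]: "u \<in> L2 \<Longrightarrow> v \<in> L2 \<Longrightarrow> (\<lambda>z. u z - v z) \<in> L2"
  using L2_add[OF _ L2_uminus, of u v] by simp

lemma L2_cnj [intro]: "u \<in> L2 \<Longrightarrow> (\<lambda>z. cnj (u z)) \<in> L2"
  by (rule L2_bound[where v=u and c=1]) (auto intro: measurable_compose[OF L2_measurable])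

lemma L2_cong_AE:
  assumes "u \<in> L2" "v \<in> borel_measurable borel" "AE z in lborel. u z = v z"
  shows "v \<in> L2"
  by (rule L2I_bound[OF assms(2) L2_square_integrable[OF assms(1)]]) (use assms(3) in auto)

lemma L2_norm_cong_AE:
  assumes "u \<in> borel_measurable borel" "v \<in> borel_measurable borel" "AE z in lborel. u z = v z"
  shows "L2_norm u = L2_norm v"
  unfolding L2_norm_def using assms by (auto intro!: arg_cong[where f=sqrt] integral_cong_AE)

lemma integrable_L2_mult: assumes "u \<in> L2" "v \<in> L2" shows "integrable lborel (\<lambda>z. u z * v z)"
proof (rule Bochner_Integration.integrable_bound)
  show "integrable lborel (\<lambda>z. (cmod (u z))\<^sup>2 + (cmod (v z))\<^sup>2)"
    using assms by (auto intro: L2_square_integrable)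
  have "cmod (u z * v z) \<le> (cmod (u z))\<^sup>2 + (cmod (v z))\<^sup>2" for z
  proof -
    have "0 \<le> cmod (u z) * cmod (v z)" by simp
    then show ?thesis
      using sum_squares_bound[of "cmod (u z)" "cmod (v z)"] unfolding norm_mult by linarith
  qed
  then show "AE z in lborel. norm (u z * v z) \<le> norm ((cmod (u z))\<^sup>2 + (cmod (v z))\<^sup>2)"
    by (auto intro!: AE_I2)
  show "(\<lambda>z. u z * v z) \<in> borel_measurable lborel"
    using L2_measurable[OF assms(1)] L2_measurable[OF assms(2)] by simp
qed

lemma integrable_ip: "u \<in> L2 \<Longrightarrow> v \<in> L2 \<Longrightarrow> integrable lborel (\<lambda>z. u z * cnj (v z))"
  by (intro integrable_L2_mult L2_cnj)

lemma ip_self: "ip u u = complex_of_real ((L2_norm u)\<^sup>2)"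
  unfolding ip_def L2_norm_sq
  by (subst integral_complex_of_real[symmetric]) (simp only: complex_norm_square)

lemma ip_cnj: "cnj (ip u v) = ip v u"
proof -
  have "(\<lambda>z. v z * cnj (u z)) = (\<lambda>z. cnj (u z * cnj (v z)))"
    by (simp add: fun_eq_iff mult.commute)
  then show ?thesis unfolding ip_def by (simp only: Bochner_Integration.integral_cnj)
qed

lemma ip_add_left: "u \<in> L2 \<Longrightarrow> u' \<in> L2 \<Longrightarrow> v \<in> L2 \<Longrightarrow> ip (\<lambda>z. u z + u' z) v = ip u v + ip u' v"
  unfolding ip_def by (simp add: distrib_right integrable_ip)

lemma ip_diff_left: "u \<in> L2 \<Longrightarrow> u' \<in> L2 \<Longrightarrow> v \<in> L2 \<Longrightarrow> ip (\<lambda>z. u z - u' z) v = ip u v - ip u' v"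
  unfolding ip_def by (simp add: left_diff_distrib integrable_ip)

lemma ip_cmult_left: "ip (\<lambda>z. c * u z) v = c * ip u v"
  unfolding ip_def by (simp add: mult.assoc)

lemma ip_add_right: "u \<in> L2 \<Longrightarrow> v \<in> L2 \<Longrightarrow> v' \<in> L2 \<Longrightarrow> ip u (\<lambda>z. v z + v' z) = ip u v + ip u v'"
  unfolding ip_def by (simp add: distrib_left integrable_ip)

lemma ip_diff_right: "u \<in> L2 \<Longrightarrow> v \<in> L2 \<Longrightarrow> v' \<in> L2 \<Longrightarrow> ip u (\<lambda>z. v z - v' z) = ip u v - ip u v'"
  unfolding ip_def by (simp add: right_diff_distrib integrable_ip)

lemma ip_cmult_right: "ip u (\<lambda>z. c * v z) = cnj c * ip u v"
proof -
  have "(\<lambda>z. u z * cnj (c * v z)) = (\<lambda>z. cnj c * (u z * cnj (v z)))"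
    by (simp add: fun_eq_iff)
  then show ?thesis unfolding ip_def by simp
qed

lemma ip_cong_AE:
  assumes "u \<in> borel_measurable borel" "v \<in> borel_measurable borel"
    "u' \<in> borel_measurable borel" "v' \<in> borel_measurable borel"
    "AE z in lborel. u z = u' z" "AE z in lborel. v z = v' z"
  shows "ip u v = ip u' v'"
  unfolding ip_def using assms by (auto intro!: integral_cong_AE)

lemma L2_Cauchy_Schwarz_abs:
  assumes "u \<in> L2" "v \<in> L2"
  shows "(LINT z|lborel. cmod (u z) * cmod (v z)) \<le> L2_norm u * L2_norm v"
proof -
  have [measurable]: "u \<in> borel_measurable borel" "v \<in> borel_measurable borel"
    using assms by auto
  have i: "integrable lborel (\<lambda>z. cmod (u z) * cmod (v z))"
    using integrable_norm[OF integrable_L2_mult[OF assms]] by (simp add: norm_mult)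
  let ?I = "LINT z|lborel. cmod (u z) * cmod (v z)"
  have nn: "0 \<le> ?I" by simp
  have "ennreal (?I\<^sup>2) = (\<integral>\<^sup>+z. ennreal (cmod (u z)) * ennreal (cmod (v z)) \<partial>lborel)\<^sup>2"
    using nn_integral_eq_integral[OF i] nn
    by (simp add: ennreal_mult flip: ennreal_power)
  also have "\<dots> \<le> (\<integral>\<^sup>+z. ennreal (cmod (u z))^2 \<partial>lborel) * (\<integral>\<^sup>+z. ennreal (cmod (v z))^2 \<partial>lborel)"
    by (rule Cauchy_Schwarz_nn_integral) measurable
  also have "\<dots> = ennreal ((L2_norm u)\<^sup>2) * ennreal ((L2_norm v)\<^sup>2)"
    using L2_nn_integral[OF assms(1)] L2_nn_integral[OF assms(2)] by (simp add: ennreal_power)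
  also have "\<dots> = ennreal ((L2_norm u * L2_norm v)\<^sup>2)"
    by (simp add: power_mult_distrib ennreal_mult)
  finally have "?I\<^sup>2 \<le> (L2_norm u * L2_norm v)\<^sup>2" by simp
  then show ?thesis by (rule power2_le_imp_le) simp
qed

lemma ip_Cauchy_Schwarz:
  assumes "u \<in> L2" "v \<in> L2" shows "cmod (ip u v) \<le> L2_norm u * L2_norm v"
proof -
  have "cmod (ip u v) \<le> (LINT z|lborel. cmod (u z * cnj (v z)))"
    unfolding ip_def by (rule integral_norm_bound)
  then show ?thesis using L2_Cauchy_Schwarz_abs[OF assms] by (simp add: norm_mult)
qed

lemma L2_norm_add_sq:
  assumes "u \<in> L2" "v \<in> L2"
  shows "(L2_norm (\<lambda>z. u z + v z))\<^sup>2 = (L2_norm u)\<^sup>2 + 2 * Re (ip u v) + (L2_norm v)\<^sup>2"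
proof -
  have "ip (\<lambda>z. u z + v z) (\<lambda>z. u z + v z) = ip u u + ip u v + cnj (ip u v) + ip v v"
    using assms by (simp add: ip_add_left ip_add_right L2_add ip_cnj)
  then have "Re (ip (\<lambda>z. u z + v z) (\<lambda>z. u z + v z)) = Re (ip u u) + 2 * Re (ip u v) + Re (ip v v)"
    by simp
  then show ?thesis by (simp only: ip_self Re_complex_of_real)
qed

lemma L2_norm_cmult: "L2_norm (\<lambda>z. c * u z) = cmod c * L2_norm u"
  by (simp add: L2_norm_def norm_mult power_mult_distrib real_sqrt_mult)

lemma L2_norm_uminus: "L2_norm (\<lambda>z. - u z) = L2_norm u"
  by (simp add: L2_norm_def)

lemma L2_norm_cnj: "L2_norm (\<lambda>z. cnj (u z)) = L2_norm u"
  by (simp add: L2_norm_def)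

lemma L2_norm_minus_commute: "L2_norm (\<lambda>z. u z - v z) = L2_norm (\<lambda>z. v z - u z)"
  by (simp add: L2_norm_def norm_minus_commute)

lemma L2_norm_triangle:
  assumes "u \<in> L2" "v \<in> L2"
  shows "L2_norm (\<lambda>z. u z + v z) \<le> L2_norm u + L2_norm v"
proof (rule power2_le_imp_le)
  have "Re (ip u v) \<le> L2_norm u * L2_norm v"
    using ip_Cauchy_Schwarz[OF assms] complex_Re_le_cmod[of "ip u v"] by linarith
  then show "(L2_norm (\<lambda>z. u z + v z))\<^sup>2 \<le> (L2_norm u + L2_norm v)\<^sup>2"
    unfolding L2_norm_add_sq[OF assms] by (simp add: power2_sum)
qed simp

lemma L2_norm_diff_triangle:
  assumes "u \<in> L2" "v \<in> L2" "w \<in> L2"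
  shows "L2_norm (\<lambda>z. u z - w z) \<le> L2_norm (\<lambda>z. u z - v z) + L2_norm (\<lambda>z. v z - w z)"
  using L2_norm_triangle[OF L2_diff[OF assms(1,2)] L2_diff[OF assms(2,3)]] by simp

lemma L2_norm_diff_le:
  assumes "u \<in> L2" "v \<in> L2"
  shows "L2_norm (\<lambda>z. u z - v z) \<le> L2_norm u + L2_norm v"
  using L2_norm_triangle[OF assms(1) L2_uminus[OF assms(2)]] by (simp add: L2_norm_uminus)

lemma L2_norm_reverse_triangle:
  assumes "u \<in> L2" "v \<in> L2"
  shows "\<bar>L2_norm u - L2_norm v\<bar> \<le> L2_norm (\<lambda>z. u z - v z)"
  using L2_norm_triangle[OF L2_diff[OF assms] assms(2)]
    L2_norm_triangle[OF L2_diff[OF assms(2,1)] assms(1)] L2_norm_minus_commute[of u v] by simp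

lemma L2_norm_zero_iff:
  assumes "u \<in> L2" shows "L2_norm u = 0 \<longleftrightarrow> (AE z in lborel. u z = 0)"
proof -
  have "L2_norm u = 0 \<longleftrightarrow> (LINT z|lborel. (cmod (u z))\<^sup>2) = 0" by (simp add: L2_norm_def)
  also have "\<dots> \<longleftrightarrow> (AE z in lborel. (cmod (u z))\<^sup>2 = 0)"
    by (rule integral_nonneg_eq_0_iff_AE) (use assms in \<open>auto intro: L2_square_integrable\<close>)
  finally show ?thesis by simp
qed

lemma L2_tendsto_norm:
  assumes "\<And>n. f n \<in> L2" "g \<in> L2" "(\<lambda>n. L2_norm (\<lambda>z. f n z - g z)) \<longlonglongrightarrow> 0"
  shows "(\<lambda>n. L2_norm (f n)) \<longlonglongrightarrow> L2_norm g"
proof (rule Lim_transform2[OF tendsto_const])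
  show "(\<lambda>n. L2_norm g - L2_norm (f n)) \<longlonglongrightarrow> 0"
    by (rule Lim_null_comparison[OF _ assms(3)])
      (use L2_norm_reverse_triangle[OF assms(1,2)] in \<open>auto simp: abs_minus_commute\<close>)
qed

lemma L2_tendsto_ip:
  assumes "\<And>n. f n \<in> L2" "g \<in> L2" "(\<lambda>n. L2_norm (\<lambda>z. f n z - g z)) \<longlonglongrightarrow> 0"
    and "\<And>n. f' n \<in> L2" "g' \<in> L2" "(\<lambda>n. L2_norm (\<lambda>z. f' n z - g' z)) \<longlonglongrightarrow> 0"
  shows "(\<lambda>n. ip (f n) (f' n)) \<longlonglongrightarrow> ip g g'"
proof (rule Lim_transform2[OF tendsto_const])
  have eq: "ip g g' - ip (f n) (f' n) = - (ip (\<lambda>z. f n z - g z) (f' n) + ip g (\<lambda>z. f' n z - g' z))" for n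
    using assms by (simp add: ip_diff_left ip_diff_right)
  have b: "norm (ip g g' - ip (f n) (f' n)) \<le>
     L2_norm (\<lambda>z. f n z - g z) * L2_norm (f' n) + L2_norm g * L2_norm (\<lambda>z. f' n z - g' z)" for n
    unfolding eq norm_minus_cancel
    by (rule norm_triangle_mono; rule ip_Cauchy_Schwarz; intro L2_diff assms(1,2,4,5))
  have "(\<lambda>n. L2_norm (\<lambda>z. f n z - g z) * L2_norm (f' n) + L2_norm g * L2_norm (\<lambda>z. f' n z - g' z))
     \<longlonglongrightarrow> 0 * L2_norm g' + L2_norm g * 0"
    by (intro tendsto_add tendsto_mult tendsto_const L2_tendsto_norm assms)
  then have lim: "(\<lambda>n. L2_norm (\<lambda>z. f n z - g z) * L2_norm (f' n) + L2_norm g * L2_norm (\<lambda>z. f' n z - g' z))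
     \<longlonglongrightarrow> 0" by simp
  show "(\<lambda>n. ip g g' - ip (f n) (f' n)) \<longlonglongrightarrow> 0"
    by (rule Lim_null_comparison[OF always_eventually[OF allI] lim]) (rule b)
qed

lemma L2_Fatou:
  assumes "\<And>n. f n \<in> L2" "\<And>n. L2_norm (f n) \<le> c" "g \<in> borel_measurable borel"
    and "AE z in lborel. (\<lambda>n. f n z) \<longlonglongrightarrow> g z"
  shows "g \<in> L2" "L2_norm g \<le> c"
proof -
  have c: "0 \<le> c" using assms(2)[of 0] L2_norm_nonneg[of "f 0"] by linarith
  have [measurable]: "f n \<in> borel_measurable borel" for n using assms(1) by auto
  have "(\<integral>\<^sup>+z. ennreal ((cmod (g z))\<^sup>2) \<partial>lborel)
     = (\<integral>\<^sup>+z. liminf (\<lambda>n. ennreal ((cmod (f n z))\<^sup>2)) \<partial>lborel)"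
  proof (rule nn_integral_cong_AE)
    show "AE z in lborel. ennreal ((cmod (g z))\<^sup>2) = liminf (\<lambda>n. ennreal ((cmod (f n z))\<^sup>2))"
      using assms(4)
    proof eventually_elim
      case (elim z)
      then have "(\<lambda>n. ennreal ((cmod (f n z))\<^sup>2)) \<longlonglongrightarrow> ennreal ((cmod (g z))\<^sup>2)"
        by (intro tendsto_ennrealI tendsto_intros)
      then show ?case by (rule lim_imp_Liminf[OF trivial_limit_sequentially, symmetric])
    qed
  qed
  also have "\<dots> \<le> liminf (\<lambda>n. \<integral>\<^sup>+z. ennreal ((cmod (f n z))\<^sup>2) \<partial>lborel)"
    by (rule nn_integral_liminf) measurable
  also have "\<dots> \<le> liminf (\<lambda>n. ennreal (c\<^sup>2))"
    using assms(1,2) by (intro Liminf_mono always_eventually) (auto simp: L2_nn_integral power_mono)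
  also have "\<dots> = ennreal (c\<^sup>2)" by (simp add: Liminf_const)
  finally have *: "(\<integral>\<^sup>+z. ennreal ((cmod (g z))\<^sup>2) \<partial>lborel) \<le> ennreal (c\<^sup>2)" .
  show "g \<in> L2" "L2_norm g \<le> c" using L2I_nn_integral[OF assms(3) *] c by auto
qed

text \<open>Along a subsequence with consecutive differences \<open>d\<^sub>k\<close> whose norms are at most \<open>2\<^sup>-\<^sup>k\<close>, the sum of
\<open>2\<^sup>k |d\<^sub>k|\<^sup>2\<close> is integrable, hence finite almost everywhere; there \<open>d\<^sub>k z\<close> decays geometrically and the
subsequence converges. Fatou's lemma turns this into convergence in norm of the whole sequence.\<close>
lemma L2_complete:
  assumes f: "\<And>n. f n \<in> L2"
    and cauchy: "\<And>e. 0 < e \<Longrightarrow> \<exists>N. \<forall>m\<ge>N. \<forall>n\<ge>N. L2_norm (\<lambda>z. f m z - f n z) < e"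
  obtains g r where "g \<in> L2" "(\<lambda>n. L2_norm (\<lambda>z. f n z - g z)) \<longlonglongrightarrow> 0"
    "strict_mono (r :: nat \<Rightarrow> nat)" "AE z in lborel. (\<lambda>n. f (r n) z) \<longlonglongrightarrow> g z"
proof -
  have [measurable]: "f n \<in> borel_measurable borel" for n using f by auto
  have "\<forall>k. \<exists>N. \<forall>m\<ge>N. \<forall>n\<ge>N. L2_norm (\<lambda>z. f m z - f n z) < (1/2)^k"
    using cauchy by simp
  then obtain N where N: "\<And>k m n. N k \<le> m \<Longrightarrow> N k \<le> n \<Longrightarrow> L2_norm (\<lambda>z. f m z - f n z) < (1/2)^k"
    by metis
  define r where "r k = k + (\<Sum>i\<le>k. N i)" for k
  have r: "strict_mono r" by (auto simp: strict_mono_Suc_iff r_def)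
  have rN: "N k \<le> r k" for k unfolding r_def by (simp add: trans_le_add2 member_le_sum)
  have rN': "N k \<le> r (Suc k)" for k using rN[of k] strict_monoD[OF r, of k "Suc k"] by simp
  define d where "d k z = f (r (Suc k)) z - f (r k) z" for k z
  have d: "d k \<in> L2" "L2_norm (d k) \<le> (1/2)^k" for k
    unfolding d_def using f N[OF rN' rN, of k] by (auto simp: less_imp_le)
  have [measurable]: "d k \<in> borel_measurable borel" for k using d by auto
  have "(\<integral>\<^sup>+z. (\<Sum>k. ennreal (2^k * (cmod (d k z))\<^sup>2)) \<partial>lborel) =
    (\<Sum>k. \<integral>\<^sup>+z. ennreal (2^k * (cmod (d k z))\<^sup>2) \<partial>lborel)"
    by (rule nn_integral_suminf) measurable
  also have "\<dots> = (\<Sum>k. ennreal (2^k * (L2_norm (d k))\<^sup>2))"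
    by (simp add: ennreal_mult nn_integral_cmult L2_nn_integral d)
  also have "\<dots> \<le> (\<Sum>k. ennreal ((1/2)^k))"
  proof (rule suminf_le)
    fix k
    have "2^k * (L2_norm (d k))\<^sup>2 \<le> 2^k * ((1/2)^k)\<^sup>2"
      using d(2)[of k] by (intro mult_left_mono power_mono) auto
    also have "\<dots> = (1/2)^k" by (simp add: power2_eq_square power_divide)
    finally show "ennreal (2^k * (L2_norm (d k))\<^sup>2) \<le> ennreal ((1/2)^k)"
      by (rule ennreal_leI)
  qed auto
  also have "\<dots> < top"
    by (subst suminf_ennreal2) (auto intro: summable_geometric)
  finally have "(\<integral>\<^sup>+z. (\<Sum>k. ennreal (2^k * (cmod (d k z))\<^sup>2)) \<partial>lborel) \<noteq> \<infinity>"
    by (metis infinity_ennreal_def less_irrefl)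
  then have "AE z in lborel. (\<Sum>k. ennreal (2^k * (cmod (d k z))\<^sup>2)) \<noteq> \<infinity>"
    by (rule nn_integral_noteq_infinite[rotated]) measurable
  then have conv: "AE z in lborel. convergent (\<lambda>k. f (r k) z)"
  proof eventually_elim
    case (elim z)
    then have sm: "summable (\<lambda>k. 2^k * (cmod (d k z))\<^sup>2)"
      by (intro summable_suminf_not_top) auto
    then have "(\<lambda>k. 2^k * (cmod (d k z))\<^sup>2) \<longlonglongrightarrow> 0" by (rule summable_LIMSEQ_zero)
    then have "Bseq (\<lambda>k. 2^k * (cmod (d k z))\<^sup>2)" by (simp add: convergent_imp_Bseq convergentI)
    then obtain C where C: "C > 0" "\<And>k. norm (2^k * (cmod (d k z))\<^sup>2) \<le> C" by (auto elim: BseqE)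
    (* the terms of a convergent series are bounded, so d decays like the powers of sqrt (1/2) *)
    define q :: real where "q = sqrt (1/2)"
    have q: "0 \<le> q" "q\<^sup>2 = 1/2" unfolding q_def by (simp_all only: real_sqrt_ge_zero real_sqrt_pow2)
    have "q < 1" by (rule power2_less_imp_less) (auto simp: q)
    have bd: "cmod (d k z) \<le> sqrt C * q^k" for k
    proof (rule power2_le_imp_le)
      have e: "(q^k)\<^sup>2 = (1/2)^k"
        unfolding q(2)[symmetric] power_mult[symmetric] by (simp only: mult.commute)
      have "(cmod (d k z))\<^sup>2 = 2^k * (cmod (d k z))\<^sup>2 * (1/2)^k" by (simp add: power_divide)
      also have "\<dots> \<le> C * (1/2)^k" using C(2)[of k] by (intro mult_right_mono) auto
      finally show "(cmod (d k z))\<^sup>2 \<le> (sqrt C * q^k)\<^sup>2"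
        using C(1) by (simp add: power_mult_distrib e)
    qed (use C q in auto)
    have "summable (\<lambda>k. sqrt C * q^k)"
      using q \<open>q < 1\<close> by (intro summable_mult summable_geometric) auto
    then have "summable (\<lambda>k. d k z)"
      using bd by (rule summable_comparison_test'[where N=0])
    then have "convergent (\<lambda>n. \<Sum>k<n. d k z)" by (simp add: summable_iff_convergent)
    moreover have "(\<Sum>k<n. d k z) = f (r n) z - f (r 0) z" for n
      unfolding d_def by (rule sum_lessThan_telescope)
    ultimately have "convergent (\<lambda>n. f (r n) z - f (r 0) z)" by simp
    then show ?case using convergent_add[of "\<lambda>n. f (r n) z - f (r 0) z" "\<lambda>n. f (r 0) z"]
      by (simp add: convergent_const)
  qed
  define g where "g z = lim (\<lambda>k. f (r k) z)" for z
  have [measurable]: "g \<in> borel_measurable borel"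
    unfolding g_def by measurable
  have lim: "AE z in lborel. (\<lambda>k. f (r k) z) \<longlonglongrightarrow> g z"
    using conv by eventually_elim (simp add: g_def convergent_LIMSEQ_iff)
  have le: "(\<lambda>z. f n z - g z) \<in> L2 \<and> L2_norm (\<lambda>z. f n z - g z) \<le> (1/2)^k" if "N k \<le> n" for n k
  proof -
    have 1: "(\<lambda>z. f n z - f (r (k + j)) z) \<in> L2" for j using f by auto
    have "N k \<le> r (k + j)" for j
      using rN[of k] strict_mono_mono[OF r] by (meson le_add1 monoD order_trans)
    then have 2: "L2_norm (\<lambda>z. f n z - f (r (k + j)) z) \<le> (1/2)^k" for j
      using N[OF that] by (simp add: less_imp_le)
    have 3: "AE z in lborel. (\<lambda>j. f n z - f (r (k + j)) z) \<longlonglongrightarrow> f n z - g z"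
      using lim
    proof eventually_elim
      case (elim z)
      from LIMSEQ_ignore_initial_segment[OF this, of k]
      show ?case by (intro tendsto_intros) (simp add: add.commute)
    qed
    have m: "(\<lambda>z. f n z - g z) \<in> borel_measurable borel" by measurable
    show ?thesis using L2_Fatou[OF 1 2 m 3] by blast
  qed
  have "(\<lambda>z. f (N 0) z - (f (N 0) z - g z)) \<in> L2"
    using L2_diff[OF f conjunct1[OF le[OF order_refl]]] .
  then have "g \<in> L2" by simp
  moreover have "(\<lambda>n. L2_norm (\<lambda>z. f n z - g z)) \<longlonglongrightarrow> 0"
  proof (rule LIMSEQ_I)
    fix e :: real assume "0 < e"
    then obtain k where k: "(1/2)^k < e" using real_arch_pow_inv[of e "1/2"] by auto
    show "\<exists>no. \<forall>n\<ge>no. norm (L2_norm (\<lambda>z. f n z - g z) - 0) < e"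
      using le[of k] k by (intro exI[of _ "N k"]) (auto intro: le_less_trans)
  qed
  ultimately show ?thesis using that r lim by blast
qed

lemma L2_dominated:
  assumes f: "\<And>n. f n \<in> borel_measurable borel" and g: "g \<in> borel_measurable borel"
    and w: "integrable lborel (\<lambda>z. (w z)\<^sup>2 :: real)" "\<And>n z. cmod (f n z) \<le> w z"
    and lim: "AE z in lborel. (\<lambda>n. f n z) \<longlonglongrightarrow> g z"
  shows "\<And>n. f n \<in> L2" "g \<in> L2" "(\<lambda>n. L2_norm (\<lambda>z. f n z - g z)) \<longlonglongrightarrow> 0"
proof -
  have [measurable]: "f n \<in> borel_measurable borel" "g \<in> borel_measurable borel" for n
    using f g by auto
  have wb: "AE z in lborel. (cmod (f n z))\<^sup>2 \<le> (w z)\<^sup>2" for n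
    using w(2) by (auto intro!: AE_I2 power_mono)
  show "f n \<in> L2" for n by (rule L2I_bound[OF f w(1) wb])
  have gb: "AE z in lborel. cmod (g z) \<le> w z"
    using lim by eventually_elim (use w(2) in \<open>auto intro!: LIMSEQ_le_const2[OF tendsto_norm]\<close>)
  show "g \<in> L2" by (rule L2I_bound[OF g w(1)]) (use gb in \<open>eventually_elim, auto intro!: power_mono\<close>)
  have "(\<lambda>n. LINT z|lborel. (cmod (f n z - g z))\<^sup>2) \<longlonglongrightarrow> (LINT z|(lborel :: (real \<times> real) measure). 0 :: real)"
  proof (rule integral_dominated_convergence[where w="\<lambda>z. 4 * (w z)\<^sup>2"])
    show "AE z in lborel. (\<lambda>n. (cmod (f n z - g z))\<^sup>2) \<longlonglongrightarrow> 0"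
      using lim
    proof eventually_elim
      case (elim z)
      then have "(\<lambda>n. (cmod (f n z - g z))\<^sup>2) \<longlonglongrightarrow> (cmod (g z - g z))\<^sup>2" by (intro tendsto_intros)
      then show ?case by simp
    qed
    show "AE z in lborel. norm ((cmod (f n z - g z))\<^sup>2) \<le> 4 * (w z)\<^sup>2" for n
      using gb
    proof eventually_elim
      case (elim z)
      have "cmod (f n z - g z) \<le> 2 * w z"
        using norm_triangle_ineq4[of "f n z" "g z"] elim w(2)[of n z] by linarith
      then have "(cmod (f n z - g z))\<^sup>2 \<le> (2 * w z)\<^sup>2" by (rule power_mono) simp
      then show ?case by (simp add: power_mult_distrib)
    qed
  qed (use w in auto)
  then show "(\<lambda>n. L2_norm (\<lambda>z. f n z - g z)) \<longlonglongrightarrow> 0"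
    unfolding L2_norm_def using tendsto_real_sqrt by fastforce
qed

section \<open>Translations\<close>

lemma nn_integral_shift:
  fixes f :: "'a::euclidean_space \<Rightarrow> ennreal"
  assumes [measurable]: "f \<in> borel_measurable borel"
  shows "(\<integral>\<^sup>+z. f (z + h) \<partial>lborel) = (\<integral>\<^sup>+z. f z \<partial>lborel)"
proof -
  have "(\<integral>\<^sup>+z. f z \<partial>lborel) = (\<integral>\<^sup>+z. f z \<partial>distr lborel borel ((+) h))"
    by (simp only: lborel_distr_plus)
  also have "\<dots> = (\<integral>\<^sup>+z. f (h + z) \<partial>lborel)"
    by (rule nn_integral_distr) measurable
  finally show ?thesis by (simp add: add.commute)
qed

lemma integral_shift:
  fixes f :: "'a::euclidean_space \<Rightarrow> 'b::{banach, second_countable_topology}"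
  assumes [measurable]: "f \<in> borel_measurable borel"
  shows "(LINT z|lborel. f (z + h)) = (LINT z|lborel. f z)"
proof -
  have "(LINT z|lborel. f z) = (LINT z|distr lborel borel ((+) h). f z)"
    by (simp only: lborel_distr_plus)
  also have "\<dots> = (LINT z|lborel. f (h + z))"
    by (rule integral_distr) measurable
  finally show ?thesis by (simp add: add.commute)
qed

lemma integrable_shift:
  fixes f :: "'a::euclidean_space \<Rightarrow> 'b::{banach, second_countable_topology}"
  assumes "integrable lborel f"
  shows "integrable lborel (\<lambda>z. f (z + h))"
proof -
  have [measurable]: "f \<in> borel_measurable borel"
    using borel_measurable_integrable[OF assms] by simp
  have "integrable (distr lborel borel ((+) h)) f"
    using assms by (simp only: lborel_distr_plus)
  then have "integrable lborel (\<lambda>z. f (h + z))"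
    by (subst (asm) integrable_distr_eq) auto
  then show ?thesis by (simp add: add.commute)
qed

lemma tau_L2 [intro]: assumes "u \<in> L2" shows "tau h u \<in> L2"
proof -
  have [measurable]: "u \<in> borel_measurable borel" using assms by auto
  have "integrable lborel (\<lambda>z. (cmod (u (z + h)))\<^sup>2)"
    by (rule integrable_shift[OF L2_square_integrable[OF assms]])
  moreover have "tau h u \<in> borel_measurable lborel" unfolding tau_def by measurable
  ultimately show ?thesis by (simp add: L2_def tau_def)
qed

lemma ip_tau: assumes "u \<in> L2" "v \<in> L2" shows "ip (tau h u) (tau h v) = ip u v"
proof -
  have [measurable]: "u \<in> borel_measurable borel" "v \<in> borel_measurable borel" using assms by auto
  show ?thesis unfolding ip_def tau_def
    by (rule integral_shift[of "\<lambda>z. u z * cnj (v z)"]) measurable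
qed

lemma tau_tau: "tau h (tau k u) = tau (h + k) u"
  by (simp add: tau_def fun_eq_iff add.assoc)

lemma tau_0 [simp]: "tau 0 u = u"
  by (simp add: tau_def)

lemma ip_tau_left: assumes "u \<in> L2" "v \<in> L2" shows "ip (tau h u) v = ip u (tau (-h) v)"
  using ip_tau[OF assms(1) tau_L2[OF assms(2)], of h "-h"] by (simp add: tau_tau)

lemma L2_norm_tau: assumes "u \<in> L2" shows "L2_norm (tau h u) = L2_norm u"
proof -
  have "complex_of_real ((L2_norm (tau h u))\<^sup>2) = complex_of_real ((L2_norm u)\<^sup>2)"
    using ip_tau[OF assms assms, of h] by (simp only: ip_self)
  then have "(L2_norm (tau h u))\<^sup>2 = (L2_norm u)\<^sup>2" by (simp only: of_real_eq_iff)
  then show ?thesis by (rule power2_eq_imp_eq) auto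
qed

lemma integrable_indicator_ball: "integrable lborel (indicator (cball 0 r) :: 'a::euclidean_space \<Rightarrow> real)"
  using emeasure_bounded_finite[OF bounded_cball, of "0::'a" r] by (simp add: integrable_indicator_iff)

text \<open>A measurable function is almost everywhere a limit of continuous ones. Truncating the values and the
support of both makes the convergence dominated.\<close>
lemma L2_approx_continuous:
  assumes f: "f \<in> L2" and e: "0 < e"
  obtains g R where "continuous_on UNIV g" "\<And>z. R < norm z \<Longrightarrow> g z = 0" "g \<in> L2"
    "L2_norm (\<lambda>z. f z - g z) < e"
proof -
  have [measurable]: "f \<in> borel_measurable borel" using f by auto
  have "f \<in> borel_measurable lebesgue" by (simp add: measurable_completion)
  then have "f measurable_on UNIV" by (rule lebesgue_measurable_imp_measurable_on) simp
  then obtain N g where N: "negligible N" and g: "\<And>n. continuous_on UNIV (g n)"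
    "\<And>z. z \<notin> N \<Longrightarrow> (\<lambda>n. g n z) \<longlonglongrightarrow> f z"
    unfolding measurable_on_def by auto
  have glim: "AE z in lborel. (\<lambda>n. g n z) \<longlonglongrightarrow> f z"
  proof -
    have "AE z in lebesgue. z \<notin> N" using N by (intro AE_not_in) (simp add: negligible_iff_null_sets)
    then have "AE z in lborel. z \<notin> N" by (simp only: AE_completion_iff)
    then show ?thesis by eventually_elim (use g in auto)
  qed
  have [measurable]: "g n \<in> borel_measurable borel" for n
    using g(1) by (rule borel_measurable_continuous_onI)
  (* T is the radial retraction onto the disc of radius R,
     cut a continuous cut-off that is 1 on the ball of radius R *)
  define T :: "real \<Rightarrow> complex \<Rightarrow> complex" where "T R w = complex_of_real (R / max R (cmod w)) * w" for R w
  define cut :: "real \<Rightarrow> real \<times> real \<Rightarrow> complex" where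
    "cut R z = complex_of_real (max 0 (min 1 (R + 1 - norm z)))" for R z
  have T_le: "cmod (T R w) \<le> R" "cmod (T R w) \<le> cmod w" if "0 < R" for R w
    using that unfolding T_def norm_mult norm_of_real by (auto simp: max_def field_simps)
  have T_eq: "T R w = w" if "cmod w \<le> R" "0 < R" for R w
    using that by (simp add: T_def max_def)
  have T_cont: "continuous_on UNIV (T R)" if "0 < R" for R
    unfolding T_def using that by (intro continuous_intros) (auto simp: max_def)
  have cut_le: "cmod (cut R z) \<le> 1" for R z by (auto simp: cut_def)
  have cut_eq: "cut R z = 1" if "norm z \<le> R" for R z using that by (simp add: cut_def)
  have cut_0: "cut R z = 0" if "R + 1 \<le> norm z" for R z using that by (simp add: cut_def)
  have cut_cont: "continuous_on UNIV (cut R)" for R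
    unfolding cut_def by (intro continuous_intros)
  have [measurable]: "T R \<in> borel_measurable borel" if "0 < R" for R
    using T_cont[OF that] by (rule borel_measurable_continuous_onI)
  have [measurable]: "cut R \<in> borel_measurable borel" for R
    using cut_cont by (rule borel_measurable_continuous_onI)
  have mult_le: "cmod (T R w * cut R z) \<le> cmod (T R w)" for R w z
    unfolding norm_mult using cut_le[of R z] by (simp add: mult_left_le)
  define h where "h n z = T (real (Suc n)) (f z) * cut (real (Suc n)) z" for n z
  have hm [measurable]: "h n \<in> borel_measurable borel" for n
    unfolding h_def by measurable
  have h_le: "cmod (h n z) \<le> cmod (f z)" for n z
    unfolding h_def by (rule order_trans[OF mult_le]) (rule T_le, simp)
  have hlim: "(\<lambda>n. h n z) \<longlonglongrightarrow> f z" for z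
  proof (rule tendsto_eventually)
    obtain n0 :: nat where n0: "max (cmod (f z)) (norm z) \<le> real n0" using real_arch_simple by blast
    show "\<forall>\<^sub>F n in sequentially. h n z = f z"
      using eventually_ge_at_top[of n0]
    proof eventually_elim
      case (elim n)
      then have "cmod (f z) \<le> real (Suc n)" "norm z \<le> real (Suc n)" using n0 by auto
      then show ?case unfolding h_def by (simp only: T_eq[OF _ of_nat_0_less_iff[THEN iffD2, OF zero_less_Suc]] cut_eq mult_1_right)
    qed
  qed
  have hL: "h n \<in> L2" for n
    by (rule L2_bound[OF f hm, where c=1]) (simp add: h_le)
  have "(\<lambda>n. L2_norm (\<lambda>z. h n z - f z)) \<longlonglongrightarrow> 0"
    by (rule L2_dominated(3)[where w="\<lambda>z. cmod (f z)"])
      (use hlim h_le in \<open>auto intro: L2_square_integrable[OF f]\<close>)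
  then have "eventually (\<lambda>n. L2_norm (\<lambda>z. h n z - f z) < e/2) sequentially"
    using e by (intro order_tendstoD) auto
  then obtain n where n: "L2_norm (\<lambda>z. h n z - f z) < e/2"
    by (auto simp: eventually_sequentially)
  define R where "R = real (Suc n)"
  have R: "0 < R" by (simp add: R_def)
  define k where "k m z = T R (g m z) * cut R z" for m z
  have k_cont: "continuous_on UNIV (k m)" for m
    unfolding k_def by (intro continuous_intros continuous_on_compose2[OF T_cont[OF R]] cut_cont g) auto
  have km [measurable]: "k m \<in> borel_measurable borel" for m
    using k_cont by (rule borel_measurable_continuous_onI)
  have k0: "k m z = 0" if "R + 1 < norm z" for m z
    using that by (simp add: k_def cut_0)
  have kb: "cmod (k m z) \<le> R * indicator (cball 0 (R + 1)) z" for m z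
  proof (cases "norm z \<le> R + 1")
    case True
    then show ?thesis
      unfolding k_def using order_trans[OF mult_le T_le(1)[OF R]] by (simp add: indicator_def)
  next
    case False then show ?thesis using k0[of z m] by (simp add: indicator_def)
  qed
  have wi: "integrable lborel (\<lambda>z::real\<times>real. (R * indicator (cball 0 (R + 1)) z)\<^sup>2)"
  proof -
    have "(\<lambda>z::real\<times>real. (R * indicator (cball 0 (R + 1)) z)\<^sup>2) = (\<lambda>z. R\<^sup>2 * indicator (cball 0 (R + 1)) z)"
      by (auto simp: fun_eq_iff indicator_def)
    then show ?thesis by (simp add: integrable_indicator_ball)
  qed
  have klim: "AE z in lborel. (\<lambda>m. k m z) \<longlonglongrightarrow> h n z"
    using glim
  proof eventually_elim
    case (elim z)
    have "isCont (T R) (f z)" using T_cont[OF R] by (simp add: continuous_on_eq_continuous_at)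
    then have "(\<lambda>m. T R (g m z)) \<longlonglongrightarrow> T R (f z)"
      using elim by (rule isCont_tendsto_compose)
    then show ?case unfolding k_def h_def R_def[symmetric] by (intro tendsto_intros)
  qed
  have kd: "\<And>m. k m \<in> L2" "(\<lambda>m. L2_norm (\<lambda>z. k m z - h n z)) \<longlonglongrightarrow> 0"
    using L2_dominated[OF km hm wi kb klim] by auto
  then have "eventually (\<lambda>m. L2_norm (\<lambda>z. k m z - h n z) < e/2) sequentially"
    using e by (intro order_tendstoD) auto
  then obtain m where m: "L2_norm (\<lambda>z. k m z - h n z) < e/2"
    by (auto simp: eventually_sequentially)
  have "L2_norm (\<lambda>z. f z - k m z) < e"
    using L2_norm_diff_triangle[OF f hL[of n] kd(1)[of m]] n m
      L2_norm_minus_commute[of f "h n"] L2_norm_minus_commute[of "h n" "k m"] by linarith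
  then show ?thesis using that[OF k_cont k0 kd(1)] by blast
qed

text \<open>For continuous functions of compact support this is dominated convergence; translation being
isometric, the claim extends to their closure.\<close>
lemma tau_continuous:
  assumes f: "f \<in> L2" and h: "h \<longlonglongrightarrow> 0"
  shows "(\<lambda>n. L2_norm (\<lambda>z. tau (h n) f z - f z)) \<longlonglongrightarrow> 0"
proof (rule LIMSEQ_I)
  fix e :: real assume e: "0 < e"
  obtain g R where g: "continuous_on UNIV g" "\<And>z. R < norm z \<Longrightarrow> g z = 0" "g \<in> L2"
    "L2_norm (\<lambda>z. f z - g z) < e/3"
    using L2_approx_continuous[OF f, of "e/3"] e by auto
  have [measurable]: "g \<in> borel_measurable borel" using g by auto
  have "Bseq h" using h by (simp add: convergentI convergent_imp_Bseq del: Bseq_eq_bounded)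
  then obtain B where B: "\<And>n. norm (h n) \<le> B" by (metis BseqE)
  have "compact (g ` cball 0 R)"
    by (intro compact_continuous_image continuous_on_subset[OF g(1)]) auto
  then obtain M where M: "\<And>z. z \<in> cball 0 R \<Longrightarrow> cmod (g z) \<le> M"
    using compact_imp_bounded bounded_iff by (metis imageI)
  have gb: "cmod (g z) \<le> max M 0" for z
    using M[of z] g(2)[of z] by (cases "norm z \<le> R") auto
  have wi: "integrable lborel (\<lambda>z::real\<times>real. (max M 0 * indicator (cball 0 (R + B)) z)\<^sup>2)"
  proof -
    have "(\<lambda>z::real\<times>real. (max M 0 * indicator (cball 0 (R + B)) z)\<^sup>2) = (\<lambda>z. (max M 0)\<^sup>2 * indicator (cball 0 (R + B)) z)"
      by (auto simp: fun_eq_iff indicator_def)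
    then show ?thesis by (simp add: integrable_indicator_ball)
  qed
  have "(\<lambda>n. L2_norm (\<lambda>z. tau (h n) g z - g z)) \<longlonglongrightarrow> 0"
  proof (rule L2_dominated(3)[OF _ _ wi])
    show "tau (h n) g \<in> borel_measurable borel" for n using tau_L2[OF g(3)] by auto
    show "cmod (tau (h n) g z) \<le> max M 0 * indicator (cball 0 (R + B)) z" for n z
    proof (cases "norm z \<le> R + B")
      case True then show ?thesis using gb by (simp add: tau_def indicator_def)
    next
      case False
      have "norm z \<le> norm (z + h n) + norm (h n)"
        using norm_triangle_ineq4[of "z + h n" "h n"] by simp
      then have "R < norm (z + h n)" using False B[of n] by linarith
      then show ?thesis by (simp add: tau_def g(2))
    qed
    show "AE z in lborel. (\<lambda>n. tau (h n) g z) \<longlonglongrightarrow> g z"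
    proof (rule AE_I2)
      fix z
      have "isCont g z" using g(1) by (rule continuous_on_interior) simp
      moreover have "(\<lambda>n. z + h n) \<longlonglongrightarrow> z" using tendsto_add[OF tendsto_const h, of z] by simp
      ultimately show "(\<lambda>n. tau (h n) g z) \<longlonglongrightarrow> g z"
        unfolding tau_def by (rule isCont_tendsto_compose)
    qed
  qed measurable
  then have "eventually (\<lambda>n. L2_norm (\<lambda>z. tau (h n) g z - g z) < e/3) sequentially"
    using e by (intro order_tendstoD) auto
  then obtain n0 where n0: "\<And>n. n0 \<le> n \<Longrightarrow> L2_norm (\<lambda>z. tau (h n) g z - g z) < e/3"
    by (auto simp: eventually_sequentially)
  have "L2_norm (\<lambda>z. tau (h n) f z - f z) < e" if "n0 \<le> n" for n
  proof -
    have t: "L2_norm (\<lambda>z. tau (h n) f z - tau (h n) g z) < e/3"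
      using L2_norm_tau[OF L2_diff[OF f g(3)], of "h n"] g(4) by (simp add: tau_def)
    have 1: "L2_norm (\<lambda>z. tau (h n) f z - g z) \<le>
      L2_norm (\<lambda>z. tau (h n) f z - tau (h n) g z) + L2_norm (\<lambda>z. tau (h n) g z - g z)"
      by (rule L2_norm_diff_triangle[OF tau_L2[OF f] tau_L2[OF g(3)] g(3)])
    have 2: "L2_norm (\<lambda>z. tau (h n) f z - f z) \<le>
      L2_norm (\<lambda>z. tau (h n) f z - g z) + L2_norm (\<lambda>z. g z - f z)"
      by (rule L2_norm_diff_triangle[OF tau_L2[OF f] g(3) f])
    show ?thesis using 1 2 t n0[OF that] g(4) L2_norm_minus_commute[of f g] by linarith
  qed
  then show "\<exists>no. \<forall>n\<ge>no. norm (L2_norm (\<lambda>z. tau (h n) f z - f z) - 0) < e"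
    by (intro exI[of _ n0]) simp
qed

section \<open>The Fourier integral is an isometry\<close>

lemma borel_measurable_cis [measurable]: "cis \<in> borel_measurable borel"
  by (intro borel_measurable_continuous_onI continuous_intros)

lemma borel_measurable_fst_snd [measurable]:
  "(fst :: real \<times> real \<Rightarrow> real) \<in> borel_measurable borel"
  "(snd :: real \<times> real \<Rightarrow> real) \<in> borel_measurable borel"
  by (intro borel_measurable_continuous_onI continuous_intros)+

lemma fourier_integral_measurable [measurable]:
  assumes [measurable]: "f \<in> borel_measurable borel"
  shows "fourier_integral f \<in> borel_measurable borel"
  unfolding fourier_integral_def by measurable

lemma integrable_cis_mult:
  assumes f: "integrable lborel (f :: plane_fun)" and [measurable]: "a \<in> borel_measurable borel"
  shows "integrable lborel (\<lambda>z. cis (a z) * f z)"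
proof (rule Bochner_Integration.integrable_bound[OF f])
  have [measurable]: "f \<in> borel_measurable borel" using borel_measurable_integrable[OF f] by simp
  show "(\<lambda>z. cis (a z) * f z) \<in> borel_measurable lborel" by measurable
qed (simp add: norm_mult)

lemma fourier_integral_bound:
  assumes "integrable lborel f"
  shows "cmod (fourier_integral f \<zeta>) \<le> (LINT z|lborel. cmod (f z)) / (2 * pi)"
proof -
  have "cmod (LINT z|lborel. cis (- (z \<bullet> \<zeta>)) * f z) \<le> (LINT z|lborel. cmod (cis (- (z \<bullet> \<zeta>)) * f z))"
    by (rule integral_norm_bound)
  then show ?thesis
    by (simp add: fourier_integral_def norm_mult norm_divide divide_right_mono)
qed

lemma fourier_integral_multiplication:
  assumes f: "integrable lborel f" and g: "integrable lborel g"
  shows "(LINT \<zeta>|lborel. fourier_integral f \<zeta> * g \<zeta>) = (LINT z|lborel. f z * fourier_integral g z)"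
proof -
  have [measurable]: "f \<in> borel_measurable borel" "g \<in> borel_measurable borel"
    using borel_measurable_integrable[OF f] borel_measurable_integrable[OF g] by simp_all
  define K where "K z \<zeta> = cis (- (z \<bullet> \<zeta>)) * f z * g \<zeta>" for z \<zeta> :: "real \<times> real"
  have meas [measurable]: "(\<lambda>(z, \<zeta>). K z \<zeta>) \<in> borel_measurable (lborel \<Otimes>\<^sub>M lborel)"
    unfolding K_def by measurable
  have int: "integrable (lborel \<Otimes>\<^sub>M lborel) (\<lambda>(z, \<zeta>). K z \<zeta>)"
  proof (rule lborel_pair.Fubini_integrable[OF meas])
    show "integrable lborel (\<lambda>z. LINT \<zeta>|lborel. norm (case (z, \<zeta>) of (z, \<zeta>) \<Rightarrow> K z \<zeta>))"
      using f g by (simp add: K_def norm_mult)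
    show "AE z in lborel. integrable lborel (\<lambda>\<zeta>. case (z, \<zeta>) of (z, \<zeta>) \<Rightarrow> K z \<zeta>)"
    proof (rule AE_I2)
      fix z :: "real \<times> real"
      have "integrable lborel (\<lambda>\<zeta>. f z * (cis (- (z \<bullet> \<zeta>)) * g \<zeta>))"
        by (intro integrable_mult_right integrable_cis_mult g) measurable
      then show "integrable lborel (\<lambda>\<zeta>. case (z, \<zeta>) of (z, \<zeta>) \<Rightarrow> K z \<zeta>)"
        by (simp add: K_def ac_simps)
    qed
  qed
  have "(LINT \<zeta>|lborel. fourier_integral f \<zeta> * g \<zeta>) = (LINT \<zeta>|lborel. (LINT z|lborel. K z \<zeta>)) / (2 * pi)"
  proof -
    have "fourier_integral f \<zeta> * g \<zeta> = (LINT z|lborel. K z \<zeta>) / (2 * pi)" for \<zeta>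
      by (simp add: fourier_integral_def K_def)
    then show ?thesis by simp
  qed
  also have "(LINT \<zeta>|lborel. (LINT z|lborel. K z \<zeta>)) = (LINT z|lborel. (LINT \<zeta>|lborel. K z \<zeta>))"
    by (rule lborel_pair.Fubini_integral) (use int in simp)
  also have "\<dots> / (2 * pi) = (LINT z|lborel. f z * fourier_integral g z)"
  proof -
    have "f z * fourier_integral g z = (LINT \<zeta>|lborel. K z \<zeta>) / (2 * pi)" for z
    proof -
      have "(LINT \<zeta>|lborel. K z \<zeta>) = (LINT \<zeta>|lborel. f z * (cis (- (\<zeta> \<bullet> z)) * g \<zeta>))"
        by (simp add: K_def ac_simps inner_commute)
      then show ?thesis by (simp add: fourier_integral_def)
    qed
    then show ?thesis by simp
  qed
  finally show ?thesis .
qed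

text \<open>The standard normal density of the plane. With the normalizing factor \<open>1/(2\<pi>)\<close> of \<open>fourier_integral\<close>, it is
its own Fourier transform.\<close>
definition gauss :: "real \<times> real \<Rightarrow> real" where
  "gauss z = std_normal_density (fst z) * std_normal_density (snd z)"

lemma gauss_eq: "gauss z = exp (- (norm z)\<^sup>2 / 2) / (2 * pi)"
proof -
  have "sqrt (2 * pi) * sqrt (2 * pi) = 2 * pi" by simp
  then show ?thesis
    by (cases z) (simp add: gauss_def std_normal_density_def norm_Pair flip: exp_add add_divide_distrib)
qed

lemma gauss_pos: "0 < gauss z"
  by (simp add: gauss_eq)

lemma gauss_measurable [measurable]: "gauss \<in> borel_measurable borel"
  unfolding gauss_eq[abs_def] by measurable

lemma integrable_prod_complex:
  fixes a b :: "real \<Rightarrow> complex"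
  assumes a: "integrable lborel a" and b: "integrable lborel b"
  shows "integrable lborel (\<lambda>z. a (fst z) * b (snd z))"
    "(LINT z|lborel. a (fst z) * b (snd z)) = (LINT x|lborel. a x) * (LINT y|lborel. b y)"
proof -
  have [measurable]: "a \<in> borel_measurable borel" "b \<in> borel_measurable borel"
    using borel_measurable_integrable[OF a] borel_measurable_integrable[OF b] by simp_all
  have int: "integrable (lborel \<Otimes>\<^sub>M lborel) (\<lambda>z. a (fst z) * b (snd z))"
    by (rule lborel_pair.Fubini_integrable) (use a b in \<open>auto simp: norm_mult\<close>)
  then show "integrable lborel (\<lambda>z. a (fst z) * b (snd z))" by (simp add: lborel_prod)
  have "(LINT z|lborel. a (fst z) * b (snd z)) = (LINT z|(lborel \<Otimes>\<^sub>M lborel). a (fst z) * b (snd z))"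
    by (simp add: lborel_prod)
  also have "\<dots> = (LINT x|lborel. LINT y|lborel. a x * b y)"
    by (subst lborel_pair.integral_fst'[OF int, symmetric]) simp
  also have "\<dots> = (LINT x|lborel. a x) * (LINT y|lborel. b y)" by simp
  finally show "(LINT z|lborel. a (fst z) * b (snd z)) = (LINT x|lborel. a x) * (LINT y|lborel. b y)" .
qed

lemma std_normal_fourier:
  "integrable lborel (\<lambda>x. cis (t * x) * complex_of_real (std_normal_density x))"
  "(LINT x|lborel. cis (t * x) * complex_of_real (std_normal_density x)) = complex_of_real (exp (- t\<^sup>2 / 2))"
proof -
  have i: "integrable lborel std_normal_density" by simp
  show "integrable lborel (\<lambda>x. cis (t * x) * complex_of_real (std_normal_density x))"
    by (rule Bochner_Integration.integrable_bound[OF i]) (auto simp: norm_mult)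
  have "complex_of_real (exp (- t\<^sup>2 / 2)) = (LINT x|std_normal_distribution. iexp (t * x))"
    using char_std_normal_distribution by (simp add: char_def fun_eq_iff)
  also have "\<dots> = (LINT x|lborel. std_normal_density x *\<^sub>R iexp (t * x))"
    by (rule integral_density) auto
  also have "\<dots> = (LINT x|lborel. cis (t * x) * complex_of_real (std_normal_density x))"
    by (simp add: cis_conv_exp scaleR_conv_of_real mult.commute)
  finally show "(LINT x|lborel. cis (t * x) * complex_of_real (std_normal_density x)) = complex_of_real (exp (- t\<^sup>2 / 2))"
    by simp
qed

lemma gauss_fourier:
  "integrable lborel (\<lambda>z. cis (z \<bullet> \<zeta>) * complex_of_real (gauss z))"
  "(LINT z|lborel. cis (z \<bullet> \<zeta>) * complex_of_real (gauss z)) = complex_of_real (2 * pi * gauss \<zeta>)"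
proof -
  have eq: "cis (z \<bullet> \<zeta>) * complex_of_real (gauss z) =
    (cis (fst \<zeta> * fst z) * complex_of_real (std_normal_density (fst z))) *
    (cis (snd \<zeta> * snd z) * complex_of_real (std_normal_density (snd z)))" for z
    by (simp add: gauss_def inner_prod_def cis_mult[symmetric] ac_simps)
  show "integrable lborel (\<lambda>z. cis (z \<bullet> \<zeta>) * complex_of_real (gauss z))"
    unfolding eq by (rule integrable_prod_complex; rule std_normal_fourier)
  have "(LINT z|lborel. cis (z \<bullet> \<zeta>) * complex_of_real (gauss z)) =
     complex_of_real (exp (- (fst \<zeta>)\<^sup>2 / 2)) * complex_of_real (exp (- (snd \<zeta>)\<^sup>2 / 2))"
    unfolding eq by (subst integrable_prod_complex(2)) (simp_all only: std_normal_fourier)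
  also have "\<dots> = complex_of_real (2 * pi * gauss \<zeta>)"
    unfolding gauss_eq of_real_mult[symmetric]
    by (cases \<zeta>) (simp add: norm_Pair flip: exp_add add_divide_distrib)
  finally show "(LINT z|lborel. cis (z \<bullet> \<zeta>) * complex_of_real (gauss z)) = complex_of_real (2 * pi * gauss \<zeta>)" .
qed

lemma integrable_gauss: "integrable lborel gauss"
  using gauss_fourier(1)[of 0] by (simp add: complex_of_real_integrable_eq)

lemma integral_gauss: "(LINT z|lborel. gauss z) = 1"
proof -
  have "complex_of_real (LINT z|lborel. gauss z) = 1"
    using gauss_fourier(2)[of 0] by (simp add: gauss_eq)
  then show ?thesis by (simp only: of_real_eq_1_iff)
qed

lemma integral_affine_plane:
  fixes f :: plane_fun
  assumes [measurable]: "f \<in> borel_measurable borel" and c: "c \<noteq> 0"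
  shows "(LINT z|lborel. f z) = complex_of_real (c\<^sup>2) * (LINT z|lborel. f (t + c *\<^sub>R z))"
proof -
  have "(LINT z|lborel. f z) = (LINT z|density (distr lborel borel (\<lambda>x. t + c *\<^sub>R x)) (\<lambda>_. ennreal (\<bar>c\<bar>^DIM(real\<times>real))). f z)"
    using lborel_affine[OF c, of t] by simp
  also have "\<dots> = (LINT z|distr lborel borel (\<lambda>x. t + c *\<^sub>R x). (\<bar>c\<bar>^DIM(real\<times>real)) *\<^sub>R f z)"
    by (rule integral_density) auto
  also have "\<dots> = (LINT z|lborel. (\<bar>c\<bar>^DIM(real\<times>real)) *\<^sub>R f (t + c *\<^sub>R z))"
    by (rule integral_distr) measurable
  finally show ?thesis by (simp add: scaleR_conv_of_real power2_eq_square)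
qed

lemma gauss_scaled_fourier:
  assumes e: "0 < e"
  shows "integrable lborel (\<lambda>\<zeta>. complex_of_real (gauss (e *\<^sub>R \<zeta>)))"
    "(LINT \<zeta>|lborel. cis (- (\<zeta> \<bullet> z)) * complex_of_real (2 * pi * gauss (e *\<^sub>R \<zeta>)))
      = complex_of_real ((2 * pi)\<^sup>2 * gauss (z /\<^sub>R e) / e\<^sup>2)"
proof -
  have "(LINT \<zeta>|lborel. cis (\<zeta> \<bullet> (- z /\<^sub>R e)) * complex_of_real (gauss \<zeta>)) =
    complex_of_real (e\<^sup>2) * (LINT \<zeta>|lborel. cis ((0 + e *\<^sub>R \<zeta>) \<bullet> (- z /\<^sub>R e)) * complex_of_real (gauss (0 + e *\<^sub>R \<zeta>)))"
    by (rule integral_affine_plane[where f="\<lambda>\<zeta>. cis (\<zeta> \<bullet> (- z /\<^sub>R e)) * complex_of_real (gauss \<zeta>)"])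
      (use e in auto)
  also have "\<dots> = complex_of_real (e\<^sup>2) * (LINT \<zeta>|lborel. cis (- (\<zeta> \<bullet> z)) * complex_of_real (gauss (e *\<^sub>R \<zeta>)))"
    using e by (simp add: mult.assoc[symmetric])
  finally have "complex_of_real (2 * pi * gauss (- z /\<^sub>R e)) =
     complex_of_real (e\<^sup>2) * (LINT \<zeta>|lborel. cis (- (\<zeta> \<bullet> z)) * complex_of_real (gauss (e *\<^sub>R \<zeta>)))"
    unfolding gauss_fourier(2) .
  then have *: "(LINT \<zeta>|lborel. cis (- (\<zeta> \<bullet> z)) * complex_of_real (gauss (e *\<^sub>R \<zeta>)))
    = complex_of_real (2 * pi * gauss (z /\<^sub>R e) / e\<^sup>2)"
    using e by (simp add: gauss_eq field_simps)
  have "(LINT \<zeta>|lborel. cis (- (\<zeta> \<bullet> z)) * complex_of_real (2 * pi * gauss (e *\<^sub>R \<zeta>)))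
    = (LINT \<zeta>|lborel. complex_of_real (2 * pi) * (cis (- (\<zeta> \<bullet> z)) * complex_of_real (gauss (e *\<^sub>R \<zeta>))))"
    by (simp add: ac_simps)
  also have "\<dots> = complex_of_real (2 * pi) * (LINT \<zeta>|lborel. cis (- (\<zeta> \<bullet> z)) * complex_of_real (gauss (e *\<^sub>R \<zeta>)))"
    by (rule integral_mult_right_zero)
  finally show "(LINT \<zeta>|lborel. cis (- (\<zeta> \<bullet> z)) * complex_of_real (2 * pi * gauss (e *\<^sub>R \<zeta>)))
      = complex_of_real ((2 * pi)\<^sup>2 * gauss (z /\<^sub>R e) / e\<^sup>2)"
    unfolding * by (simp add: power2_eq_square)
  have "integrable (distr lborel borel (\<lambda>x. 0 + e *\<^sub>R x)) gauss"
  proof -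
    have "integrable (density (distr lborel borel (\<lambda>x. 0 + e *\<^sub>R x)) (\<lambda>_. ennreal (\<bar>e\<bar>^DIM(real\<times>real)))) gauss"
      using integrable_gauss lborel_affine[of e "0 :: real \<times> real"] e by simp
    then show ?thesis using e by (subst (asm) integrable_density) auto
  qed
  then have "integrable lborel (\<lambda>x. gauss (0 + e *\<^sub>R x))"
    by (subst (asm) integrable_distr_eq) auto
  then show "integrable lborel (\<lambda>\<zeta>. complex_of_real (gauss (e *\<^sub>R \<zeta>)))" by simp
qed

text \<open>The regularized Plancherel identity. The weight makes the left side absolutely convergent, and by
the multiplication formula it acts as an average of the correlations of \<open>f\<close> with its translates,
taken with respect to a Gaussian of width \<open>e\<close>.\<close>
lemma gauss_weighted_Plancherel:
  assumes f: "f \<in> L2" "integrable lborel f" and e: "0 < e"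
  shows "(LINT \<zeta>|lborel. fourier_integral f \<zeta> * (cnj (fourier_integral f \<zeta>) * complex_of_real (2 * pi * gauss (e *\<^sub>R \<zeta>))))
    = (LINT h|lborel. complex_of_real (gauss h) * ip f (tau (e *\<^sub>R h) f))"
proof -
  have [measurable]: "f \<in> borel_measurable borel" using f by auto
  define k where "k \<zeta> = complex_of_real (2 * pi * gauss (e *\<^sub>R \<zeta>))" for \<zeta>
  have k_int: "integrable lborel k"
    unfolding k_def of_real_mult by (intro integrable_mult_right gauss_scaled_fourier e)
  have [measurable]: "k \<in> borel_measurable borel" unfolding k_def by measurable
  define g where "g \<zeta> = cnj (fourier_integral f \<zeta>) * k \<zeta>" for \<zeta>
  define C where "C = (LINT z|lborel. cmod (f z)) / (2 * pi)"
  have "integrable lborel (\<lambda>\<zeta>. C * cmod (k \<zeta>))" using k_int by simp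
  then have g_int: "integrable lborel g"
  proof (rule Bochner_Integration.integrable_bound)
    show "AE \<zeta> in lborel. norm (g \<zeta>) \<le> norm (C * cmod (k \<zeta>))"
    proof (rule AE_I2)
      fix \<zeta>
      have "cmod (fourier_integral f \<zeta>) \<le> \<bar>C\<bar>"
        using fourier_integral_bound[OF f(2), of \<zeta>] unfolding C_def by linarith
      then show "norm (g \<zeta>) \<le> norm (C * cmod (k \<zeta>))"
        unfolding g_def norm_mult real_norm_def abs_mult complex_mod_cnj abs_norm_cancel by (rule mult_right_mono) simp
    qed
    show "g \<in> borel_measurable lborel" unfolding g_def by measurable
  qed
  have Fg: "fourier_integral g z = (LINT h|lborel. complex_of_real (gauss h) * cnj (f (z + e *\<^sub>R h)))" for z
  proof -
    (* the transform of a modulated Gaussian is a Gaussian centred at z; another use of the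
       multiplication formula then evaluates the transform of g at z *)
    define m where "m \<zeta> = cis (\<zeta> \<bullet> z) * k \<zeta>" for \<zeta>
    have m_int: "integrable lborel m"
      unfolding m_def by (intro integrable_cis_mult k_int) measurable
    have Fm: "fourier_integral m z' = complex_of_real (2 * pi * gauss ((z' - z) /\<^sub>R e) / e\<^sup>2)" for z'
    proof -
      have "(LINT \<zeta>|lborel. cis (- (\<zeta> \<bullet> z')) * m \<zeta>) = (LINT \<zeta>|lborel. cis (- (\<zeta> \<bullet> (z' - z))) * k \<zeta>)"
        by (simp add: m_def inner_diff_right flip: cis_mult mult.assoc) (simp add: cis_mult mult.assoc[symmetric])
      also have "\<dots> = complex_of_real ((2 * pi)\<^sup>2 * gauss ((z' - z) /\<^sub>R e) / e\<^sup>2)"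
        unfolding k_def by (rule gauss_scaled_fourier(2)[OF e])
      finally show ?thesis by (simp add: fourier_integral_def power2_eq_square)
    qed
    have "(LINT \<zeta>|lborel. cis (- (\<zeta> \<bullet> z)) * g \<zeta>) = (LINT \<zeta>|lborel. cnj (fourier_integral f \<zeta> * m \<zeta>))"
      by (simp add: g_def m_def k_def cis_cnj ac_simps)
    also have "\<dots> = cnj (LINT \<zeta>|lborel. fourier_integral f \<zeta> * m \<zeta>)"
      by (rule Bochner_Integration.integral_cnj)
    also have "\<dots> = cnj (LINT z'|lborel. f z' * complex_of_real (2 * pi * gauss ((z' - z) /\<^sub>R e) / e\<^sup>2))"
      by (simp only: fourier_integral_multiplication[OF f(2) m_int] Fm)
    also have "(LINT z'|lborel. f z' * complex_of_real (2 * pi * gauss ((z' - z) /\<^sub>R e) / e\<^sup>2)) =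
      complex_of_real (e\<^sup>2) * (LINT h|lborel. f (z + e *\<^sub>R h) * complex_of_real (2 * pi * gauss (((z + e *\<^sub>R h) - z) /\<^sub>R e) / e\<^sup>2))"
      by (rule integral_affine_plane[where f="\<lambda>z'. f z' * complex_of_real (2 * pi * gauss ((z' - z) /\<^sub>R e) / e\<^sup>2)"])
        (use e in auto)
    also have "\<dots> = (LINT h|lborel. complex_of_real (e\<^sup>2) * (f (z + e *\<^sub>R h) * complex_of_real (2 * pi * gauss (((z + e *\<^sub>R h) - z) /\<^sub>R e) / e\<^sup>2)))"
      by (rule integral_mult_right_zero[symmetric])
    also have "\<dots> = (LINT h|lborel. complex_of_real (2 * pi) * (complex_of_real (gauss h) * f (z + e *\<^sub>R h)))"
      using e by (intro Bochner_Integration.integral_cong) (auto simp: ac_simps)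
    also have "\<dots> = complex_of_real (2 * pi) * (LINT h|lborel. complex_of_real (gauss h) * f (z + e *\<^sub>R h))"
      by (rule integral_mult_right_zero)
    also have "cnj \<dots> = complex_of_real (2 * pi) * (LINT h|lborel. cnj (complex_of_real (gauss h) * f (z + e *\<^sub>R h)))"
      by (simp only: complex_cnj_mult complex_cnj_complex_of_real flip: Bochner_Integration.integral_cnj)
    finally show ?thesis by (simp add: fourier_integral_def)
  qed
  define K where "K h z = complex_of_real (gauss h) * (f z * cnj (f (z + e *\<^sub>R h)))" for h z
  have K_meas [measurable]: "(\<lambda>(h, z). K h z) \<in> borel_measurable (lborel \<Otimes>\<^sub>M lborel)"
    unfolding K_def by measurable
  have tf: "tau (e *\<^sub>R h) f \<in> L2" for h using f by auto
  have K_int: "integrable (lborel \<Otimes>\<^sub>M lborel) (\<lambda>(h, z). K h z)"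
  proof (rule lborel_pair.Fubini_integrable[OF K_meas])
    show "AE h in lborel. integrable lborel (\<lambda>z. case (h, z) of (h, z) \<Rightarrow> K h z)"
      using integrable_ip[OF f(1) tf] by (auto simp: K_def tau_def)
    have "integrable lborel (\<lambda>h. gauss h * (L2_norm f * L2_norm f))"
      using integrable_gauss by simp
    then show "integrable lborel (\<lambda>h. LINT z|lborel. norm (case (h, z) of (h, z) \<Rightarrow> K h z))"
    proof (rule Bochner_Integration.integrable_bound)
      show "(\<lambda>h. LINT z|lborel. norm (case (h, z) of (h, z) \<Rightarrow> K h z)) \<in> borel_measurable lborel"
        unfolding K_def by measurable
      show "AE h in lborel. norm (LINT z|lborel. norm (case (h, z) of (h, z) \<Rightarrow> K h z))
          \<le> norm (gauss h * (L2_norm f * L2_norm f))"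
      proof (rule AE_I2)
        fix h
        have "(LINT z|lborel. cmod (f z) * cmod (f (z + e *\<^sub>R h))) \<le> L2_norm f * L2_norm f"
          using L2_Cauchy_Schwarz_abs[OF f(1) tf, of h] by (simp add: L2_norm_tau[OF f(1)]) (simp add: tau_def)
        moreover have "0 \<le> (LINT z|lborel. cmod (f z) * cmod (f (z + e *\<^sub>R h)))" by simp
        ultimately show "norm (LINT z|lborel. norm (case (h, z) of (h, z) \<Rightarrow> K h z))
          \<le> norm (gauss h * (L2_norm f * L2_norm f))"
          using gauss_pos[of h] by (simp add: K_def norm_mult abs_mult)
      qed
    qed
  qed
  have "(LINT \<zeta>|lborel. fourier_integral f \<zeta> * g \<zeta>) = (LINT z|lborel. f z * fourier_integral g z)"
    by (rule fourier_integral_multiplication[OF f(2) g_int])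
  also have "\<dots> = (LINT z|lborel. LINT h|lborel. K h z)"
  proof -
    have "f z * fourier_integral g z = (LINT h|lborel. K h z)" for z
    proof -
      have "f z * fourier_integral g z = (LINT h|lborel. f z * (complex_of_real (gauss h) * cnj (f (z + e *\<^sub>R h))))"
        unfolding Fg by (rule integral_mult_right_zero[symmetric])
      then show ?thesis by (simp add: K_def ac_simps)
    qed
    then show ?thesis by simp
  qed
  also have "\<dots> = (LINT h|lborel. LINT z|lborel. K h z)"
    by (rule lborel_pair.Fubini_integral) (use K_int in simp)
  also have "\<dots> = (LINT h|lborel. complex_of_real (gauss h) * ip f (tau (e *\<^sub>R h) f))"
    by (simp add: K_def ip_def tau_def)
  finally show ?thesis unfolding g_def k_def .
qed

text \<open>Let the width of the Gaussian tend to \<open>0\<close> in \<open>gauss_weighted_Plancherel\<close>. The left side increases to the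
squared norm of the transform, and the right side tends to the squared norm of \<open>f\<close> because
translation is continuous.\<close>
lemma fourier_integral_isometry:
  assumes f: "f \<in> L2" "integrable lborel f"
  shows "fourier_integral f \<in> L2" "L2_norm (fourier_integral f) = L2_norm f"
proof -
  have [measurable]: "f \<in> borel_measurable borel" using f by auto
  define e where "e n = 1 / real (Suc n)" for n
  have e: "0 < e n" for n by (simp add: e_def)
  have e_lim: "e \<longlonglongrightarrow> 0" unfolding e_def by (rule LIMSEQ_inverse_real_of_nat[unfolded inverse_eq_divide])
  define w where "w n \<zeta> = (cmod (fourier_integral f \<zeta>))\<^sup>2 * (2 * pi * gauss (e n *\<^sub>R \<zeta>))" for n \<zeta>
  have w_eq: "complex_of_real (w n \<zeta>) =
    fourier_integral f \<zeta> * (cnj (fourier_integral f \<zeta>) * complex_of_real (2 * pi * gauss (e n *\<^sub>R \<zeta>)))" for n \<zeta>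
    unfolding w_def by (simp only: of_real_mult complex_norm_square mult.assoc)
  define C where "C = (LINT z|lborel. cmod (f z)) / (2 * pi)"
  have w_int: "integrable lborel (w n)" for n
  proof (rule Bochner_Integration.integrable_bound)
    have "integrable lborel (\<lambda>\<zeta>. gauss (e n *\<^sub>R \<zeta>))"
      using gauss_scaled_fourier(1)[OF e[of n]] by (simp only: complex_of_real_integrable_eq)
    then show "integrable lborel (\<lambda>\<zeta>. C\<^sup>2 * (2 * pi * gauss (e n *\<^sub>R \<zeta>)))" by simp
    show "w n \<in> borel_measurable lborel" unfolding w_def by measurable
    show "AE \<zeta> in lborel. norm (w n \<zeta>) \<le> norm (C\<^sup>2 * (2 * pi * gauss (e n *\<^sub>R \<zeta>)))"
    proof (rule AE_I2)
      fix \<zeta>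
      have "(cmod (fourier_integral f \<zeta>))\<^sup>2 \<le> C\<^sup>2"
        using fourier_integral_bound[OF f(2), of \<zeta>] unfolding C_def by (rule power_mono) simp
      then have "w n \<zeta> \<le> C\<^sup>2 * (2 * pi * gauss (e n *\<^sub>R \<zeta>))"
        unfolding w_def using gauss_pos by (intro mult_right_mono) (auto simp: less_imp_le)
      moreover have "0 \<le> w n \<zeta>" unfolding w_def using gauss_pos by (auto simp: less_imp_le)
      ultimately show "norm (w n \<zeta>) \<le> norm (C\<^sup>2 * (2 * pi * gauss (e n *\<^sub>R \<zeta>)))" by simp
    qed
  qed
  have w_nonneg: "0 \<le> w n \<zeta>" for n \<zeta> unfolding w_def using gauss_pos by (auto simp: less_imp_le)
  have gauss_lim: "(\<lambda>n. LINT h|lborel. complex_of_real (gauss h) * ip f (tau (e n *\<^sub>R h) f))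
      \<longlonglongrightarrow> (LINT h|lborel. complex_of_real (gauss h) * ip f f)"
  proof (rule integral_dominated_convergence[where w="\<lambda>h. gauss h * (L2_norm f * L2_norm f)"])
    show "integrable lborel (\<lambda>h. gauss h * (L2_norm f * L2_norm f))" using integrable_gauss by simp
    show "(\<lambda>h. complex_of_real (gauss h) * ip f (tau (e n *\<^sub>R h) f)) \<in> borel_measurable lborel" for n
      unfolding ip_def tau_def by measurable
    show "AE h in lborel. (\<lambda>n. complex_of_real (gauss h) * ip f (tau (e n *\<^sub>R h) f))
       \<longlonglongrightarrow> complex_of_real (gauss h) * ip f f"
    proof (rule AE_I2)
      fix h :: "real \<times> real"
      have "(\<lambda>n. e n *\<^sub>R h) \<longlonglongrightarrow> 0 *\<^sub>R h" by (intro tendsto_intros e_lim)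
      then have "(\<lambda>n. L2_norm (\<lambda>z. tau (e n *\<^sub>R h) f z - f z)) \<longlonglongrightarrow> 0"
        by (intro tau_continuous f) simp
      then have "(\<lambda>n. ip f (tau (e n *\<^sub>R h) f)) \<longlonglongrightarrow> ip f f"
        using L2_zero f by (intro L2_tendsto_ip[where f="\<lambda>n. f"]) (auto simp: L2_norm_def)
      then show "(\<lambda>n. complex_of_real (gauss h) * ip f (tau (e n *\<^sub>R h) f))
       \<longlonglongrightarrow> complex_of_real (gauss h) * ip f f" by (intro tendsto_intros)
    qed
    show "AE h in lborel. norm (complex_of_real (gauss h) * ip f (tau (e n *\<^sub>R h) f))
        \<le> gauss h * (L2_norm f * L2_norm f)" for n
    proof (rule AE_I2)
      fix h
      have "cmod (ip f (tau (e n *\<^sub>R h) f)) \<le> L2_norm f * L2_norm f"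
        using ip_Cauchy_Schwarz[OF f(1) tau_L2[OF f(1)]] by (simp add: L2_norm_tau[OF f(1)])
      then show "norm (complex_of_real (gauss h) * ip f (tau (e n *\<^sub>R h) f)) \<le> gauss h * (L2_norm f * L2_norm f)"
        using gauss_pos[of h] by (simp add: norm_mult)
    qed
  qed (simp)
  have "(LINT h|lborel. complex_of_real (gauss h) * ip f f) = complex_of_real ((L2_norm f)\<^sup>2)"
    using integral_gauss by (simp add: ip_self)
  with gauss_lim have "(\<lambda>n. LINT \<zeta>|lborel. complex_of_real (w n \<zeta>)) \<longlonglongrightarrow> complex_of_real ((L2_norm f)\<^sup>2)"
    unfolding w_eq gauss_weighted_Plancherel[OF f e] by simp
  then have "(\<lambda>n. complex_of_real (LINT \<zeta>|lborel. w n \<zeta>)) \<longlonglongrightarrow> complex_of_real ((L2_norm f)\<^sup>2)"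
    by simp
  then have lim1: "(\<lambda>n. LINT \<zeta>|lborel. w n \<zeta>) \<longlonglongrightarrow> (L2_norm f)\<^sup>2"
    by (simp only: tendsto_of_real_iff)
  have lim1': "(\<lambda>n. \<integral>\<^sup>+\<zeta>. ennreal (w n \<zeta>) \<partial>lborel) \<longlonglongrightarrow> ennreal ((L2_norm f)\<^sup>2)"
    using tendsto_ennrealI[OF lim1] nn_integral_eq_integral[OF w_int] w_nonneg by simp
  have [measurable]: "w n \<in> borel_measurable borel" for n unfolding w_def by measurable
  have lim2: "(\<lambda>n. \<integral>\<^sup>+\<zeta>. ennreal (w n \<zeta>) \<partial>lborel) \<longlonglongrightarrow> (\<integral>\<^sup>+\<zeta>. ennreal ((cmod (fourier_integral f \<zeta>))\<^sup>2) \<partial>lborel)"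
  proof (rule nn_integral_LIMSEQ)
    show "incseq (\<lambda>n \<zeta>. ennreal (w n \<zeta>))"
    proof (intro incseq_SucI le_funI ennreal_leI)
      fix n :: nat and \<zeta> :: "real \<times> real"
      have "e (Suc n) \<le> e n" by (simp add: e_def frac_le)
      then have "norm (e (Suc n) *\<^sub>R \<zeta>) \<le> norm (e n *\<^sub>R \<zeta>)"
        using e[of n] e[of "Suc n"] by (simp add: mult_right_mono)
      then have "(norm (e (Suc n) *\<^sub>R \<zeta>))\<^sup>2 \<le> (norm (e n *\<^sub>R \<zeta>))\<^sup>2" by (rule power_mono) simp
      then have "gauss (e n *\<^sub>R \<zeta>) \<le> gauss (e (Suc n) *\<^sub>R \<zeta>)"
        unfolding gauss_eq by (intro divide_right_mono) auto
      then show "w n \<zeta> \<le> w (Suc n) \<zeta>" unfolding w_def by (intro mult_left_mono) auto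
    qed
    show "(\<lambda>n. ennreal (w n \<zeta>)) \<longlonglongrightarrow> ennreal ((cmod (fourier_integral f \<zeta>))\<^sup>2)" for \<zeta>
    proof (rule tendsto_ennrealI)
      have "(\<lambda>n. w n \<zeta>) = (\<lambda>n. (cmod (fourier_integral f \<zeta>))\<^sup>2 * exp (- (e n * norm \<zeta>)\<^sup>2 / 2))"
        unfolding w_def gauss_eq using e by (auto simp: fun_eq_iff power_mult_distrib)
      moreover have "\<dots> \<longlonglongrightarrow> (cmod (fourier_integral f \<zeta>))\<^sup>2 * exp (- (0 * norm \<zeta>)\<^sup>2 / 2)"
        by (intro tendsto_intros e_lim) auto
      ultimately show "(\<lambda>n. w n \<zeta>) \<longlonglongrightarrow> (cmod (fourier_integral f \<zeta>))\<^sup>2" by simp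
    qed
  qed measurable
  have eq: "(\<integral>\<^sup>+\<zeta>. ennreal ((cmod (fourier_integral f \<zeta>))\<^sup>2) \<partial>lborel) = ennreal ((L2_norm f)\<^sup>2)"
    by (rule LIMSEQ_unique[OF lim2 lim1'])
  show F: "fourier_integral f \<in> L2"
    by (rule L2I_nn_integral(1)[where c="L2_norm f"]) (use eq in auto)
  have "(L2_norm (fourier_integral f))\<^sup>2 = (L2_norm f)\<^sup>2"
    using eq unfolding L2_nn_integral[OF F] by (subst (asm) ennreal_inj) auto
  then show "L2_norm (fourier_integral f) = L2_norm f" by (rule power2_eq_imp_eq) auto
qed

section \<open>The Fourier--Plancherel transform\<close>

lemma nn_integral_L2_tendsto_0_iff:
  assumes "\<And>n. f n \<in> L2" "g \<in> L2"
  shows "(\<lambda>n. \<integral>\<^sup>+z. ennreal ((cmod (f n z - g z))\<^sup>2) \<partial>lborel) \<longlonglongrightarrow> 0 \<longleftrightarrow>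
    (\<lambda>n. L2_norm (\<lambda>z. f n z - g z)) \<longlonglongrightarrow> 0"
proof -
  have "(\<integral>\<^sup>+z. ennreal ((cmod (f n z - g z))\<^sup>2) \<partial>lborel) = ennreal ((L2_norm (\<lambda>z. f n z - g z))\<^sup>2)" for n
    using L2_nn_integral[OF L2_diff[OF assms(1) assms(2)]] .
  then have "(\<lambda>n. \<integral>\<^sup>+z. ennreal ((cmod (f n z - g z))\<^sup>2) \<partial>lborel) \<longlonglongrightarrow> 0 \<longleftrightarrow>
     (\<lambda>n. (L2_norm (\<lambda>z. f n z - g z))\<^sup>2) \<longlonglongrightarrow> 0"
    by (simp add: ennreal_tendsto_0_iff)
  also have "\<dots> \<longleftrightarrow> (\<lambda>n. L2_norm (\<lambda>z. f n z - g z)) \<longlonglongrightarrow> 0"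
  proof
    assume "(\<lambda>n. (L2_norm (\<lambda>z. f n z - g z))\<^sup>2) \<longlonglongrightarrow> 0"
    from tendsto_real_sqrt[OF this] show "(\<lambda>n. L2_norm (\<lambda>z. f n z - g z)) \<longlonglongrightarrow> 0" by simp
  next
    assume "(\<lambda>n. L2_norm (\<lambda>z. f n z - g z)) \<longlonglongrightarrow> 0"
    from tendsto_power[OF this, of 2] show "(\<lambda>n. (L2_norm (\<lambda>z. f n z - g z))\<^sup>2) \<longlonglongrightarrow> 0" by simp
  qed
  finally show ?thesis .
qed

text \<open>All differences are square integrable here, so nonnegative integrals can be traded for norms.\<close>
lemma has_fourier_iff:
  "has_fourier u w \<longleftrightarrow> u \<in> L2 \<and> w \<in> L2 \<and>
    (\<exists>f. (\<forall>n. f n \<in> L2 \<and> integrable lborel (f n)) \<and>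
      (\<lambda>n. L2_norm (\<lambda>z. f n z - u z)) \<longlonglongrightarrow> 0 \<and>
      (\<lambda>n. L2_norm (\<lambda>z. fourier_integral (f n) z - w z)) \<longlonglongrightarrow> 0)"
proof -
  have "((\<lambda>n. \<integral>\<^sup>+z. ennreal ((cmod (f n z - u z))\<^sup>2) \<partial>lborel) \<longlonglongrightarrow> 0 \<and>
      (\<lambda>n. \<integral>\<^sup>+z. ennreal ((cmod (fourier_integral (f n) z - w z))\<^sup>2) \<partial>lborel) \<longlonglongrightarrow> 0) =
    ((\<lambda>n. L2_norm (\<lambda>z. f n z - u z)) \<longlonglongrightarrow> 0 \<and>
      (\<lambda>n. L2_norm (\<lambda>z. fourier_integral (f n) z - w z)) \<longlonglongrightarrow> 0)"
    if "u \<in> L2" "w \<in> L2" "\<forall>n. f n \<in> L2 \<and> integrable lborel (f n)" for f :: "nat \<Rightarrow> plane_fun"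
    using that by (intro arg_cong2[where f="(\<and>)"] nn_integral_L2_tendsto_0_iff)
      (auto intro: fourier_integral_isometry)
  then show ?thesis unfolding has_fourier_def by blast
qed

lemma has_fourier_L2: assumes "has_fourier u w" shows "u \<in> L2" "w \<in> L2"
  using assms by (auto simp: has_fourier_def)

lemma fourier_integral_linear:
  assumes "integrable lborel f" "integrable lborel g"
  shows "fourier_integral (\<lambda>z. a * f z + b * g z) \<zeta> = a * fourier_integral f \<zeta> + b * fourier_integral g \<zeta>"
proof -
  have 1: "integrable lborel (\<lambda>z. cis (- (z \<bullet> \<zeta>)) * f z)" "integrable lborel (\<lambda>z. cis (- (z \<bullet> \<zeta>)) * g z)"
    by (intro integrable_cis_mult assms; measurable)+
  have "(LINT z|lborel. cis (- (z \<bullet> \<zeta>)) * (a * f z + b * g z)) =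
    (LINT z|lborel. a * (cis (- (z \<bullet> \<zeta>)) * f z) + b * (cis (- (z \<bullet> \<zeta>)) * g z))"
    by (simp add: algebra_simps)
  also have "\<dots> = a * (LINT z|lborel. cis (- (z \<bullet> \<zeta>)) * f z) + b * (LINT z|lborel. cis (- (z \<bullet> \<zeta>)) * g z)"
    using 1 by simp
  finally show ?thesis by (simp add: fourier_integral_def add_divide_distrib)
qed

lemma L2_tendsto_linear:
  assumes f: "\<And>n. f n \<in> L2" "u \<in> L2" "(\<lambda>n. L2_norm (\<lambda>z. f n z - u z)) \<longlonglongrightarrow> 0"
    and g: "\<And>n. g n \<in> L2" "v \<in> L2" "(\<lambda>n. L2_norm (\<lambda>z. g n z - v z)) \<longlonglongrightarrow> 0"
  shows "(\<lambda>n. L2_norm (\<lambda>z. (a * f n z + b * g n z) - (a * u z + b * v z))) \<longlonglongrightarrow> 0"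
proof -
  have eq: "(\<lambda>z. (a * f n z + b * g n z) - (a * u z + b * v z)) = (\<lambda>z. a * (f n z - u z) + b * (g n z - v z))" for n
    by (simp add: fun_eq_iff algebra_simps)
  have lim: "(\<lambda>n. cmod a * L2_norm (\<lambda>z. f n z - u z) + cmod b * L2_norm (\<lambda>z. g n z - v z)) \<longlonglongrightarrow> cmod a * 0 + cmod b * 0"
    by (intro tendsto_intros f g)
  have "norm (L2_norm (\<lambda>z. a * (f n z - u z) + b * (g n z - v z))) \<le>
     cmod a * L2_norm (\<lambda>z. f n z - u z) + cmod b * L2_norm (\<lambda>z. g n z - v z)" for n
    using L2_norm_triangle[OF L2_cmult[OF L2_diff[OF f(1,2)]] L2_cmult[OF L2_diff[OF g(1,2)]], of a n b n]
    by (simp add: L2_norm_cmult)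
  then show ?thesis unfolding eq
    by (intro Lim_null_comparison[OF always_eventually[OF allI] lim[simplified]])
qed

lemma has_fourier_linear:
  assumes "has_fourier u w" "has_fourier u' w'"
  shows "has_fourier (\<lambda>z. a * u z + b * u' z) (\<lambda>z. a * w z + b * w' z)"
proof -
  obtain f where f: "\<And>n. f n \<in> L2" "\<And>n. integrable lborel (f n)"
      "(\<lambda>n. L2_norm (\<lambda>z. f n z - u z)) \<longlonglongrightarrow> 0"
      "(\<lambda>n. L2_norm (\<lambda>z. fourier_integral (f n) z - w z)) \<longlonglongrightarrow> 0"
    using assms(1) unfolding has_fourier_iff by blast
  obtain g where g: "\<And>n. g n \<in> L2" "\<And>n. integrable lborel (g n)"
      "(\<lambda>n. L2_norm (\<lambda>z. g n z - u' z)) \<longlonglongrightarrow> 0"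
      "(\<lambda>n. L2_norm (\<lambda>z. fourier_integral (g n) z - w' z)) \<longlonglongrightarrow> 0"
    using assms(2) unfolding has_fourier_iff by blast
  note L = has_fourier_L2[OF assms(1)] has_fourier_L2[OF assms(2)]
  have Ff: "fourier_integral (f n) \<in> L2" "fourier_integral (g n) \<in> L2" for n
    using fourier_integral_isometry f g by auto
  show ?thesis unfolding has_fourier_iff
  proof (intro conjI exI[of _ "\<lambda>n z. a * f n z + b * g n z"] allI)
    show "(\<lambda>n. L2_norm (\<lambda>z. a * f n z + b * g n z - (a * u z + b * u' z))) \<longlonglongrightarrow> 0"
      by (intro L2_tendsto_linear L f g)
    show "(\<lambda>n. L2_norm (\<lambda>z. fourier_integral (\<lambda>z. a * f n z + b * g n z) z - (a * w z + b * w' z))) \<longlonglongrightarrow> 0"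
      unfolding fourier_integral_linear[OF f(2) g(2)] by (intro L2_tendsto_linear L f g Ff)
  qed (use f g L in \<open>auto intro!: L2_add L2_cmult\<close>)
qed

lemma has_fourier_norm: assumes "has_fourier u w" shows "L2_norm w = L2_norm u"
proof -
  obtain f where f: "\<And>n. f n \<in> L2" "\<And>n. integrable lborel (f n)"
      "(\<lambda>n. L2_norm (\<lambda>z. f n z - u z)) \<longlonglongrightarrow> 0"
      "(\<lambda>n. L2_norm (\<lambda>z. fourier_integral (f n) z - w z)) \<longlonglongrightarrow> 0"
    using assms(1) unfolding has_fourier_iff by blast
  note L = has_fourier_L2[OF assms(1)]
  have "(\<lambda>n. L2_norm (fourier_integral (f n))) \<longlonglongrightarrow> L2_norm w"
    using fourier_integral_isometry(1)[OF f(1,2)] L(2) f(4) by (rule L2_tendsto_norm)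
  then have "(\<lambda>n. L2_norm (f n)) \<longlonglongrightarrow> L2_norm w"
    by (simp only: fourier_integral_isometry(2)[OF f(1,2)])
  moreover have "(\<lambda>n. L2_norm (f n)) \<longlonglongrightarrow> L2_norm u"
    using f(1) L(1) f(3) by (rule L2_tendsto_norm)
  ultimately show ?thesis by (rule LIMSEQ_unique)
qed

text \<open>Polarization: the norms of all combinations \<open>u + c u'\<close> with \<open>c = 1\<close> and \<open>c = \<i>\<close> are preserved.\<close>
lemma has_fourier_ip:
  assumes "has_fourier u w" "has_fourier u' w'"
  shows "ip w w' = ip u u'"
proof -
  note L = has_fourier_L2[OF assms(1)] has_fourier_L2[OF assms(2)]
  have *: "Re (cnj c * ip w w') = Re (cnj c * ip u u')" for c
  proof -
    have "L2_norm (\<lambda>z. 1 * w z + c * w' z) = L2_norm (\<lambda>z. 1 * u z + c * u' z)"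
      by (rule has_fourier_norm[OF has_fourier_linear[OF assms]])
    then have "(L2_norm (\<lambda>z. w z + c * w' z))\<^sup>2 = (L2_norm (\<lambda>z. u z + c * u' z))\<^sup>2" by simp
    moreover have "L2_norm (\<lambda>z. c * w' z) = L2_norm (\<lambda>z. c * u' z)"
      by (simp add: L2_norm_cmult has_fourier_norm[OF assms(2)])
    ultimately show ?thesis
      using L by (simp add: L2_norm_add_sq L2_cmult ip_cmult_right has_fourier_norm[OF assms(1)])
  qed
  show ?thesis using *[of 1] *[of "\<i>"] by (simp add: complex_eq_iff)
qed

text \<open>Truncation to balls gives functions in \<open>L\<^sup>1 \<inter> L\<^sup>2\<close>; their transforms form a Cauchy sequence by isometry.\<close>
lemma has_fourier_ex: assumes u: "u \<in> L2" obtains w where "has_fourier u w"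
proof -
  have [measurable]: "u \<in> borel_measurable borel" using u by auto
  define f where "f n z = indicator (cball 0 (real n)) z * u z" for n :: nat and z :: "real \<times> real"
  have [measurable]: "f n \<in> borel_measurable borel" for n
    unfolding f_def by (intro borel_measurable_times borel_measurable_indicator) (use u in auto)
  have fb: "cmod (f n z) \<le> cmod (u z)" for n z by (auto simp: f_def indicator_def)
  have flim: "(\<lambda>n. f n z) \<longlonglongrightarrow> u z" for z
  proof (rule tendsto_eventually)
    obtain n0 :: nat where "norm z \<le> real n0" using real_arch_simple by blast
    show "\<forall>\<^sub>F n in sequentially. f n z = u z"
      using eventually_ge_at_top[of n0]
      by eventually_elim (use \<open>norm z \<le> real n0\<close> in \<open>auto simp: f_def indicator_def\<close>)
  qed
  have fm: "f n \<in> borel_measurable borel" for n by measurable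
  have um: "u \<in> borel_measurable borel" by measurable
  note f = L2_dominated(1,3)[where f=f and g=u and w="\<lambda>z. cmod (u z)",
      OF fm um L2_square_integrable[OF u] fb AE_I2[OF flim]]
  have fi: "integrable lborel (f n)" for n
  proof -
    have "(\<lambda>z. indicator (cball 0 (real n)) z :: complex) \<in> L2"
    proof (rule L2I_bound[OF _ integrable_indicator_ball[of "real n"]])
      show "AE z in lborel. (cmod (indicator (cball 0 (real n)) z))\<^sup>2 \<le> indicator (cball 0 (real n)) z"
        by (auto simp: indicator_def)
    qed (intro borel_measurable_indicator, simp)
    from integrable_L2_mult[OF this u] show ?thesis by (simp add: f_def[abs_def])
  qed
  have Ff: "fourier_integral (f n) \<in> L2" for n by (rule fourier_integral_isometry(1)[OF f(1) fi])
  have d: "L2_norm (\<lambda>z. fourier_integral (f m) z - fourier_integral (f n) z) = L2_norm (\<lambda>z. f m z - f n z)" for m n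
  proof -
    have "(\<lambda>z. fourier_integral (f m) z - fourier_integral (f n) z) = fourier_integral (\<lambda>z. f m z - f n z)"
      using fourier_integral_linear[OF fi fi, of 1 m "-1" n] by (simp add: fun_eq_iff)
    then show ?thesis
      using fourier_integral_isometry(2)[of "\<lambda>z. f m z - f n z"] f(1) fi by (simp add: L2_diff)
  qed
  have "\<exists>N. \<forall>m\<ge>N. \<forall>n\<ge>N. L2_norm (\<lambda>z. fourier_integral (f m) z - fourier_integral (f n) z) < e" if e: "0 < e" for e
  proof -
    have "eventually (\<lambda>n. L2_norm (\<lambda>z. f n z - u z) < e/2) sequentially"
      using e by (intro order_tendstoD(2)[OF f(2)]) auto
    then obtain N where N: "\<And>n. N \<le> n \<Longrightarrow> L2_norm (\<lambda>z. f n z - u z) < e/2"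
      by (auto simp: eventually_sequentially)
    have "L2_norm (\<lambda>z. f m z - f n z) < e" if "N \<le> m" "N \<le> n" for m n
      using L2_norm_diff_triangle[OF f(1)[of m] u f(1)[of n]] N[OF that(1)] N[OF that(2)]
        L2_norm_minus_commute[of u "f n"] by linarith
    then show ?thesis unfolding d by blast
  qed
  then obtain w r where w: "w \<in> L2" "(\<lambda>n. L2_norm (\<lambda>z. fourier_integral (f n) z - w z)) \<longlonglongrightarrow> 0"
    by (rule L2_complete[where f="\<lambda>n. fourier_integral (f n)", OF Ff])
  then have "has_fourier u w" unfolding has_fourier_iff using u w f fi by blast
  then show ?thesis using that by blast
qed

lemma has_fourier_zero: "has_fourier (\<lambda>z. 0) (\<lambda>z. 0)"
proof -
  obtain w where "has_fourier (\<lambda>z. 0) w" using has_fourier_ex[OF L2_zero] .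
  from has_fourier_linear[OF this this, of 0 0] show ?thesis by simp
qed

lemma has_fourier_unique:
  assumes "has_fourier u w" "has_fourier u' w'" "AE z in lborel. u z = u' z"
  shows "AE z in lborel. w z = w' z"
proof -
  note L = has_fourier_L2[OF assms(1)] has_fourier_L2[OF assms(2)]
  have "L2_norm (\<lambda>z. 1 * w z + (-1) * w' z) = L2_norm (\<lambda>z. 1 * u z + (-1) * u' z)"
    by (rule has_fourier_norm[OF has_fourier_linear[OF assms(1,2)]])
  also have "\<dots> = L2_norm (\<lambda>z. u z - u' z)" by simp
  also have "\<dots> = 0"
    using L assms(3) by (subst L2_norm_zero_iff) (auto intro: L2_diff)
  finally have "L2_norm (\<lambda>z. w z - w' z) = 0" by simp
  then show ?thesis using L by (subst (asm) L2_norm_zero_iff) (auto intro: L2_diff)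
qed

lemma has_fourier_cong:
  assumes F: "has_fourier u w" and m: "u' \<in> borel_measurable borel" "w' \<in> borel_measurable borel"
    and ae: "AE z in lborel. u z = u' z" "AE z in lborel. w z = w' z"
  shows "has_fourier u' w'"
proof -
  note L = has_fourier_L2[OF F]
  have L': "u' \<in> L2" "w' \<in> L2"
    using L2_cong_AE[OF L(1) m(1) ae(1)] L2_cong_AE[OF L(2) m(2) ae(2)] .
  obtain f where f: "\<And>n. f n \<in> L2" "\<And>n. integrable lborel (f n)"
      "(\<lambda>n. L2_norm (\<lambda>z. f n z - u z)) \<longlonglongrightarrow> 0"
      "(\<lambda>n. L2_norm (\<lambda>z. fourier_integral (f n) z - w z)) \<longlonglongrightarrow> 0"
    using F unfolding has_fourier_iff by blast
  have Ff: "fourier_integral (f n) \<in> L2" for n by (rule fourier_integral_isometry(1)[OF f(1,2)])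
  have "L2_norm (\<lambda>z. f n z - u z) = L2_norm (\<lambda>z. f n z - u' z)" for n
    by (rule L2_norm_cong_AE) (use L2_diff[OF f(1) L(1)] L2_diff[OF f(1) L'(1)] ae in auto)
  moreover have "L2_norm (\<lambda>z. fourier_integral (f n) z - w z) = L2_norm (\<lambda>z. fourier_integral (f n) z - w' z)" for n
    by (rule L2_norm_cong_AE) (use L2_diff[OF Ff L(2)] L2_diff[OF Ff L'(2)] ae in auto)
  ultimately show ?thesis unfolding has_fourier_iff using L' f by (intro conjI exI[of _ f]) auto
qed

lemma has_fourier_multiplication:
  assumes "has_fourier u w" "has_fourier u' w'"
  shows "ip w (\<lambda>z. cnj (u' z)) = ip u (\<lambda>z. cnj (w' z))"
proof -
  note L = has_fourier_L2[OF assms(1)] has_fourier_L2[OF assms(2)]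
  obtain f where f: "\<And>n. f n \<in> L2" "\<And>n. integrable lborel (f n)"
      "(\<lambda>n. L2_norm (\<lambda>z. f n z - u z)) \<longlonglongrightarrow> 0"
      "(\<lambda>n. L2_norm (\<lambda>z. fourier_integral (f n) z - w z)) \<longlonglongrightarrow> 0"
    using assms(1) unfolding has_fourier_iff by blast
  obtain g where g: "\<And>n. g n \<in> L2" "\<And>n. integrable lborel (g n)"
      "(\<lambda>n. L2_norm (\<lambda>z. g n z - u' z)) \<longlonglongrightarrow> 0"
      "(\<lambda>n. L2_norm (\<lambda>z. fourier_integral (g n) z - w' z)) \<longlonglongrightarrow> 0"
    using assms(2) unfolding has_fourier_iff by blast
  have Ff: "fourier_integral (f n) \<in> L2" "fourier_integral (g n) \<in> L2" for n
    using fourier_integral_isometry f g by auto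
  have c: "(\<lambda>n. L2_norm (\<lambda>z. cnj (a n z) - cnj (b z))) = (\<lambda>n. L2_norm (\<lambda>z. a n z - b z))" for a :: "nat \<Rightarrow> plane_fun" and b
    by (simp add: L2_norm_cnj flip: complex_cnj_diff)
  have "(\<lambda>n. ip (fourier_integral (f n)) (\<lambda>z. cnj (g n z))) \<longlonglongrightarrow> ip w (\<lambda>z. cnj (u' z))"
    by (rule L2_tendsto_ip) (use Ff f g L c in auto)
  moreover have "(\<lambda>n. ip (f n) (\<lambda>z. cnj (fourier_integral (g n) z))) \<longlonglongrightarrow> ip u (\<lambda>z. cnj (w' z))"
    by (rule L2_tendsto_ip) (use Ff f g L c in auto)
  moreover have "ip (fourier_integral (f n)) (\<lambda>z. cnj (g n z)) = ip (f n) (\<lambda>z. cnj (fourier_integral (g n) z))" for n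
    using fourier_integral_multiplication[OF f(2) g(2), of n n] by (simp add: ip_def)
  ultimately show ?thesis using LIMSEQ_unique by simp
qed

text \<open>The preimage is \<open>u = cnj (F (cnj v))\<close>, since the inverse transform is a conjugated transform. The
multiplication formula gives \<open>\<langle>F u, v\<rangle> = \<parallel>v\<parallel>\<^sup>2\<close>, and with \<open>\<parallel>F u\<parallel> = \<parallel>v\<parallel>\<close> the square
\<open>\<parallel>F u - v\<parallel>\<^sup>2 = \<parallel>v\<parallel>\<^sup>2 - 2 \<parallel>v\<parallel>\<^sup>2 + \<parallel>v\<parallel>\<^sup>2\<close> vanishes.\<close>
lemma has_fourier_surj: assumes v: "v \<in> L2" obtains u where "has_fourier u v"
proof -
  obtain s where s: "has_fourier (\<lambda>z. cnj (v z)) s" using has_fourier_ex[OF L2_cnj[OF v]] .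
  have sL: "s \<in> L2" using has_fourier_L2[OF s] by simp
  define u where "u z = cnj (s z)" for z
  have u: "u \<in> L2" unfolding u_def using sL by (rule L2_cnj)
  obtain w where w: "has_fourier u w" using has_fourier_ex[OF u] .
  have wL: "w \<in> L2" using has_fourier_L2[OF w] by simp
  have n: "L2_norm w = L2_norm v"
    using has_fourier_norm[OF w] has_fourier_norm[OF s] by (simp add: u_def[abs_def] L2_norm_cnj)
  have "ip w (\<lambda>z. cnj (cnj (v z))) = ip u (\<lambda>z. cnj (s z))"
    by (rule has_fourier_multiplication[OF w s])
  then have i: "ip w v = complex_of_real ((L2_norm v)\<^sup>2)"
    using has_fourier_norm[OF s] by (simp add: u_def[symmetric] ip_self) (simp add: u_def[abs_def] L2_norm_cnj)
  have r: "Re (ip w (\<lambda>z. (-1) * v z)) = - (L2_norm v)\<^sup>2"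
    by (subst ip_cmult_right, subst i) (simp del: of_real_power)
  have m: "L2_norm (\<lambda>z. (-1) * v z) = L2_norm v"
    by (subst L2_norm_cmult) simp
  have "(L2_norm (\<lambda>z. w z + (-1) * v z))\<^sup>2 = 0"
    unfolding L2_norm_add_sq[OF wL L2_cmult[OF v]] r m n by simp
  then have "L2_norm (\<lambda>z. w z - v z) = 0" by simp
  then have ae: "AE z in lborel. w z = v z"
    using wL v by (subst (asm) L2_norm_zero_iff) auto
  have "has_fourier u v"
    by (rule has_fourier_cong[OF w]) (use u v ae in auto)
  then show ?thesis using that by blast
qed

lemma fourier_integral_tau:
  assumes [measurable]: "f \<in> borel_measurable borel"
  shows "fourier_integral (tau h f) \<zeta> = cis (h \<bullet> \<zeta>) * fourier_integral f \<zeta>"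
proof -
  have "(LINT z|lborel. cis (- (z \<bullet> \<zeta>)) * tau h f z) =
    (LINT z|lborel. cis (h \<bullet> \<zeta>) * (cis (- ((z + h) \<bullet> \<zeta>)) * f (z + h)))"
  proof (rule Bochner_Integration.integral_cong)
    fix z :: "real \<times> real"
    have "cis (- (z \<bullet> \<zeta>)) = cis (h \<bullet> \<zeta>) * cis (- ((z + h) \<bullet> \<zeta>))"
      by (simp add: cis_mult inner_add_left)
    then show "cis (- (z \<bullet> \<zeta>)) * tau h f z = cis (h \<bullet> \<zeta>) * (cis (- ((z + h) \<bullet> \<zeta>)) * f (z + h))"
      by (simp add: tau_def)
  qed simp
  also have "\<dots> = cis (h \<bullet> \<zeta>) * (LINT z|lborel. cis (- ((z + h) \<bullet> \<zeta>)) * f (z + h))"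
    by (rule integral_mult_right_zero)
  also have "(LINT z|lborel. cis (- ((z + h) \<bullet> \<zeta>)) * f (z + h)) = (LINT z|lborel. cis (- (z \<bullet> \<zeta>)) * f z)"
    by (rule integral_shift) measurable
  finally show ?thesis by (simp add: fourier_integral_def)
qed

lemma L2_cis_mult: "w \<in> L2 \<Longrightarrow> (\<lambda>\<zeta>. cis (h \<bullet> \<zeta>) * w \<zeta>) \<in> L2"
proof (rule L2_bound[where v=w and c=1])
  assume "w \<in> L2"
  then have [measurable]: "w \<in> borel_measurable borel" by auto
  show "(\<lambda>\<zeta>. cis (h \<bullet> \<zeta>) * w \<zeta>) \<in> borel_measurable borel" by measurable
qed (auto simp: norm_mult)

lemma has_fourier_tau:
  assumes "has_fourier u w" shows "has_fourier (tau h u) (\<lambda>\<zeta>. cis (h \<bullet> \<zeta>) * w \<zeta>)"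
proof -
  note L = has_fourier_L2[OF assms(1)]
  obtain f where f: "\<And>n. f n \<in> L2" "\<And>n. integrable lborel (f n)"
      "(\<lambda>n. L2_norm (\<lambda>z. f n z - u z)) \<longlonglongrightarrow> 0"
      "(\<lambda>n. L2_norm (\<lambda>z. fourier_integral (f n) z - w z)) \<longlonglongrightarrow> 0"
    using assms(1) unfolding has_fourier_iff by blast
  have 1: "L2_norm (\<lambda>z. tau h (f n) z - tau h u z) = L2_norm (\<lambda>z. f n z - u z)" for n
    using L2_norm_tau[OF L2_diff[OF f(1) L(1)], of h] by (simp add: tau_def)
  have 2: "L2_norm (\<lambda>z. fourier_integral (tau h (f n)) z - cis (h \<bullet> z) * w z) = L2_norm (\<lambda>z. fourier_integral (f n) z - w z)" for n
  proof -
    have "fourier_integral (tau h (f n)) z - cis (h \<bullet> z) * w z = cis (h \<bullet> z) * (fourier_integral (f n) z - w z)" for z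
      using f(1) by (subst fourier_integral_tau) (auto simp: algebra_simps)
    then show ?thesis by (simp add: L2_norm_def norm_mult)
  qed
  have 3: "integrable lborel (tau h (f n))" for n
    unfolding tau_def by (rule integrable_shift[OF f(2)])
  show ?thesis unfolding has_fourier_iff
    using L f 1 2 3 L2_cis_mult[OF L(2)]
    by (intro conjI exI[of _ "\<lambda>n. tau h (f n)"]) auto
qed

section \<open>Averages over parabolic dyadic boxes\<close>

text \<open>The scaling \<open>(x, y) \<mapsto> (x/2, y/4)\<close> is the one under which \<open>\<xi>\<^sup>2\<close> and \<open>|\<eta>|\<close> are multiplied by the same
factor. A box is named by its integer coordinates.\<close>
definition dyadic_cell :: "nat \<Rightarrow> real \<times> real \<Rightarrow> int \<times> int" where
  "dyadic_cell k z = (\<lfloor>2^k * fst z\<rfloor>, \<lfloor>4^k * snd z\<rfloor>)"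

definition cell_ind :: "nat \<Rightarrow> real \<times> real \<Rightarrow> plane_fun" where
  "cell_ind k z w = (if dyadic_cell k w = dyadic_cell k z then 1 else 0)"

text \<open>The mean over the box that contains \<open>z\<close>; the factor is the inverse of the measure of the box.\<close>
definition avg :: "nat \<Rightarrow> plane_fun \<Rightarrow> plane_fun" where
  "avg k u z = 8^k * ip u (cell_ind k z)"

lemma cell_ind_measurable2 [measurable]:
  "(\<lambda>(z, w). cell_ind k z w) \<in> borel_measurable (borel \<Otimes>\<^sub>M borel)"
proof -
  define A B :: "(real \<times> real) \<times> (real \<times> real) \<Rightarrow> real" where
    "A p = real_of_int \<lfloor>2^k * fst (snd p)\<rfloor> - real_of_int \<lfloor>2^k * fst (fst p)\<rfloor>" and
    "B p = real_of_int \<lfloor>4^k * snd (snd p)\<rfloor> - real_of_int \<lfloor>4^k * snd (fst p)\<rfloor>" for p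
  have A: "A \<in> borel_measurable (borel \<Otimes>\<^sub>M borel)" unfolding A_def
    by (intro borel_measurable_diff measurable_compose[OF _ borel_measurable_real_floor] borel_measurable_times
        borel_measurable_const measurable_compose[OF _ borel_measurable_fst_snd(1)] measurable_fst measurable_snd)
  have B: "B \<in> borel_measurable (borel \<Otimes>\<^sub>M borel)" unfolding B_def
    by (intro borel_measurable_diff measurable_compose[OF _ borel_measurable_real_floor] borel_measurable_times
        borel_measurable_const measurable_compose[OF _ borel_measurable_fst_snd(2)] measurable_fst measurable_snd)
  have g: "(\<lambda>a. indicator {0} a :: complex) \<in> borel_measurable (borel :: real measure)" by simp
  have "(\<lambda>(z, w). cell_ind k z w) = (\<lambda>p. indicator {0} (A p) * indicator {0} (B p))"
    by (auto simp: fun_eq_iff cell_ind_def dyadic_cell_def A_def B_def indicator_def)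
  then show ?thesis using measurable_compose[OF A g] measurable_compose[OF B g] by simp
qed

lemma cell_ind_measurable [measurable]: "cell_ind k z \<in> borel_measurable borel"
  using measurable_Pair2[OF cell_ind_measurable2, of z k] by simp

lemma cnj_cell_ind [simp]: "cnj (cell_ind k z w) = cell_ind k z w"
  by (simp add: cell_ind_def)

lemma dyadic_cell_eq_iff:
  "dyadic_cell k w = dyadic_cell k z \<longleftrightarrow>
    w \<in> {\<lfloor>2^k * fst z\<rfloor> / 2^k ..< (\<lfloor>2^k * fst z\<rfloor> + 1) / 2^k} \<times>
        {\<lfloor>4^k * snd z\<rfloor> / 4^k ..< (\<lfloor>4^k * snd z\<rfloor> + 1) / 4^k}"
  by (cases w) (auto simp: dyadic_cell_def floor_eq_iff field_simps)

lemma dyadic_cell_measure: "emeasure lborel {w. dyadic_cell k w = dyadic_cell k z} = ennreal (1 / 8^k)"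
proof -
  have "emeasure lborel {w. dyadic_cell k w = dyadic_cell k z} =
    emeasure (lborel \<Otimes>\<^sub>M lborel) ({\<lfloor>2^k * fst z\<rfloor> / 2^k ..< (\<lfloor>2^k * fst z\<rfloor> + 1) / 2^k} \<times>
        {\<lfloor>4^k * snd z\<rfloor> / 4^k ..< (\<lfloor>4^k * snd z\<rfloor> + 1) / (4^k :: real)})"
    by (auto simp: dyadic_cell_eq_iff lborel_prod)
  also have "\<dots> = ennreal (1 / 2^k) * ennreal (1 / 4^k)"
    by (subst lborel.emeasure_pair_measure_Times) (auto simp: field_simps divide_right_mono diff_divide_distrib[symmetric])
  also have "\<dots> = ennreal (1 / 8^k)"
    by (simp flip: ennreal_mult power_mult_distrib)
  finally show ?thesis .
qed

lemma cell_ind_nn_integral: "(\<integral>\<^sup>+w. ennreal ((cmod (cell_ind k z w))\<^sup>2) \<partial>lborel) = ennreal (1 / 8^k)"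
proof -
  have s: "{w. dyadic_cell k w = dyadic_cell k z} \<in> sets lborel"
    by (auto simp: dyadic_cell_eq_iff simp del: lborel_prod intro!: pair_measureI borel_prod[THEN arg_cong[where f=sets], THEN equalityD1, THEN subsetD])
  have "ennreal ((cmod (cell_ind k z w))\<^sup>2) = indicator {w. dyadic_cell k w = dyadic_cell k z} w" for w
    by (auto simp: cell_ind_def indicator_def)
  then show ?thesis using s by (simp add: dyadic_cell_measure)
qed

lemma cell_ind_L2: "cell_ind k z \<in> L2" and cell_ind_norm: "L2_norm (cell_ind k z) = sqrt (1 / 8^k)"
proof -
  have e: "1 / 8^k = (sqrt (1 / 8^k))\<^sup>2" by simp
  show L: "cell_ind k z \<in> L2"
    by (rule L2I_nn_integral(1)[where c="sqrt (1 / 8^k)"]) (auto simp: cell_ind_nn_integral)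
  have "ennreal ((L2_norm (cell_ind k z))\<^sup>2) = ennreal (1 / 8^k)"
    using L2_nn_integral[OF L] cell_ind_nn_integral by simp
  then have "(L2_norm (cell_ind k z))\<^sup>2 = 1 / 8^k" by (subst (asm) ennreal_inj) auto
  then have "(L2_norm (cell_ind k z))\<^sup>2 = (sqrt (1 / 8^k))\<^sup>2" using e by simp
  then show "L2_norm (cell_ind k z) = sqrt (1 / 8^k)" by (rule power2_eq_imp_eq) auto
qed

lemma cell_ind_integral:
  "integrable lborel (cell_ind k z)" "(LINT w|lborel. cell_ind k z w) = 1 / 8^k"
proof -
  have eq: "(\<lambda>w. cell_ind k z w * cell_ind k z w) = cell_ind k z" by (auto simp: cell_ind_def)
  show "integrable lborel (cell_ind k z)"
    using integrable_L2_mult[OF cell_ind_L2 cell_ind_L2, of k z k z] unfolding eq .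
  have "(LINT w|lborel. cell_ind k z w) = ip (cell_ind k z) (cell_ind k z)"
    unfolding ip_def cnj_cell_ind eq ..
  also have "\<dots> = complex_of_real (1 / 8^k)"
    unfolding ip_self cell_ind_norm by (subst real_sqrt_pow2) auto
  also have "\<dots> = 1 / 8^k" by simp
  finally show "(LINT w|lborel. cell_ind k z w) = 1 / 8^k" .
qed

lemma avg_measurable [measurable]:
  assumes [measurable]: "u \<in> borel_measurable borel"
  shows "avg k u \<in> borel_measurable borel"
proof -
  have "(\<lambda>z. LINT w|lborel. u w * cell_ind k z w) \<in> borel_measurable borel"
    by (rule lborel.borel_measurable_lebesgue_integral) measurable
  then show ?thesis unfolding avg_def[abs_def] ip_def by simp
qed

lemma avg_bound: assumes "u \<in> L2" shows "cmod (avg k u z) \<le> sqrt (8^k) * L2_norm u"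
proof -
  have "cmod (avg k u z) \<le> 8^k * (L2_norm u * sqrt (1 / 8^k))"
    using ip_Cauchy_Schwarz[OF assms cell_ind_L2, of k z] by (simp add: avg_def norm_mult norm_power cell_ind_norm)
  also have "\<dots> = sqrt (8^k) * L2_norm u"
  proof -
    have "sqrt (8^k) * sqrt (8^k) = (8^k :: real)" by simp
    then have "8^k * sqrt (1 / 8^k) = sqrt (8^k :: real)"
      by (simp only: real_sqrt_divide real_sqrt_one) (simp add: field_simps)
    then show ?thesis by (metis mult.assoc mult.commute)
  qed
  finally show ?thesis .
qed

lemma avg_cell_cong: "dyadic_cell k w = dyadic_cell k z \<Longrightarrow> avg k u w = avg k u z"
  by (simp add: avg_def cell_ind_def[abs_def])

lemma dyadic_cell_refine: "dyadic_cell (Suc k) w = dyadic_cell (Suc k) z \<Longrightarrow> dyadic_cell k w = dyadic_cell k z"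
proof -
  assume a: "dyadic_cell (Suc k) w = dyadic_cell (Suc k) z"
  have 1: "\<lfloor>2^k * x\<rfloor> = \<lfloor>2^Suc k * x\<rfloor> div 2" "\<lfloor>4^k * x\<rfloor> = \<lfloor>4^Suc k * x\<rfloor> div 4" for x :: real
    using floor_divide_real_eq_div[of 2 "2^Suc k * x"] floor_divide_real_eq_div[of 4 "4^Suc k * x"] by simp_all
  have "fst (dyadic_cell (Suc k) w) = fst (dyadic_cell (Suc k) z)" "snd (dyadic_cell (Suc k) w) = snd (dyadic_cell (Suc k) z)"
    using a by simp_all
  then show ?thesis unfolding dyadic_cell_def 1 fst_conv snd_conv by (simp only:)
qed

lemma ip_cell_ind_const:
  assumes "\<And>w. dyadic_cell k w = dyadic_cell k z \<Longrightarrow> v w = c"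
  shows "8^k * ip v (cell_ind k z) = c"
proof -
  have "ip v (cell_ind k z) = (LINT w|lborel. c * cell_ind k z w)"
    unfolding ip_def by (intro Bochner_Integration.integral_cong) (auto simp: cell_ind_def assms)
  then show ?thesis by (simp add: cell_ind_integral)
qed

text \<open>On each box \<open>u - A\<^sub>k u\<close> is a mean of differences \<open>u z - u (z + h)\<close> with \<open>h\<close> in the box of differences.
Cauchy--Schwarz on the box and Fubini bound its square by the mean of \<open>\<parallel>\<tau>\<^sub>h u - u\<parallel>\<^sup>2\<close>. The box of
differences is four times as large as the dyadic box, whence the factor \<open>2 = \<surd>4\<close>.\<close>
lemma dyadic_Poincare:
  assumes u: "u \<in> L2"
    and s: "\<And>h. \<bar>fst h\<bar> \<le> 1 / 2^k \<Longrightarrow> \<bar>snd h\<bar> \<le> 1 / 4^k \<Longrightarrow> L2_norm (\<lambda>z. tau h u z - u z) \<le> s"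
  shows "avg k u \<in> L2" "L2_norm (\<lambda>z. u z - avg k u z) \<le> 2 * s"
proof -
  have [measurable]: "u \<in> borel_measurable borel" using u by auto
  have s0: "0 \<le> s" using s[of 0] order_trans[OF L2_norm_nonneg] by force
  (* the set of differences of two points of one box *)
  define J where "J = cbox (- (1/2^k) :: real, - (1/4^k) :: real) (1/2^k, 1/4^k)"
  have J_iff: "h \<in> J \<longleftrightarrow> \<bar>fst h\<bar> \<le> 1/2^k \<and> \<bar>snd h\<bar> \<le> 1/4^k" for h :: "real \<times> real"
    by (cases h) (auto simp: J_def cbox_Pair_eq)
  have J_meas [measurable]: "J \<in> sets borel" by (simp add: J_def)
  have J_em: "emeasure lborel J = ennreal (4 / 8^k)"
  proof -
    have "emeasure lborel J = ennreal ((2 / 2^k) * (2 / 4^k))"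
      unfolding J_def by (subst emeasure_lborel_cbox_eq) (auto simp: Basis_prod_def prod.union_disjoint inner_prod_def prod.reindex inj_on_def)
    then show ?thesis by (simp flip: power_mult_distrib)
  qed
  have cell_J: "w - z \<in> J" if "dyadic_cell k w = dyadic_cell k z" for w z :: "real \<times> real"
  proof -
    have "\<bar>2^k * fst w - 2^k * fst z\<bar> \<le> 1" "\<bar>4^k * snd w - 4^k * snd z\<bar> \<le> 1"
      using that unfolding dyadic_cell_def by (simp_all) linarith+
    then have "\<bar>fst w - fst z\<bar> * 2^k \<le> 1" "\<bar>snd w - snd z\<bar> * 4^k \<le> 1"
      unfolding right_diff_distrib[symmetric] abs_mult by (simp_all add: mult.commute)
    then show ?thesis by (simp add: J_iff pos_le_divide_eq)
  qed
  define d where "d z w = u z - u w" for z w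
  have pt: "ennreal ((cmod (u z - avg k u z))\<^sup>2) \<le>
     ennreal (8^k) * (\<integral>\<^sup>+h. indicator J h * ennreal ((cmod (u z - u (z + h)))\<^sup>2) \<partial>lborel)" for z
  proof -
    have i1: "integrable lborel (\<lambda>w. u z * cell_ind k z w)" using cell_ind_integral(1) by simp
    have i2: "integrable lborel (\<lambda>w. u w * cell_ind k z w)" using integrable_L2_mult[OF u cell_ind_L2] .
    have "u z - avg k u z = 8^k * (LINT w|lborel. d z w * cell_ind k z w)"
    proof -
      have "(LINT w|lborel. d z w * cell_ind k z w) = (LINT w|lborel. u z * cell_ind k z w - u w * cell_ind k z w)"
        by (simp add: d_def left_diff_distrib)
      also have "\<dots> = u z / 8^k - ip u (cell_ind k z)"
        using i1 i2 by (simp add: cell_ind_integral ip_def)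
      finally show ?thesis by (simp add: avg_def right_diff_distrib)
    qed
    then have "cmod (u z - avg k u z) = 8^k * cmod (LINT w|lborel. d z w * cell_ind k z w)"
      by (simp add: norm_mult norm_power)
    then have "ennreal (cmod (u z - avg k u z)) = ennreal (8^k) * ennreal (cmod (LINT w|lborel. d z w * cell_ind k z w))"
      by (simp add: ennreal_mult)
    also have "\<dots> \<le> ennreal (8^k) * (\<integral>\<^sup>+w. ennreal (cmod (d z w * cell_ind k z w)) \<partial>lborel)"
    proof (intro mult_left_mono integral_norm_bound_ennreal)
      show "integrable lborel (\<lambda>w. d z w * cell_ind k z w)"
        using Bochner_Integration.integrable_diff[OF i1 i2] by (simp add: d_def left_diff_distrib)
    qed simp
    also have "(\<integral>\<^sup>+w. ennreal (cmod (d z w * cell_ind k z w)) \<partial>lborel) =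
       (\<integral>\<^sup>+w. ennreal (cmod (d z w) * cmod (cell_ind k z w)) * ennreal (cmod (cell_ind k z w)) \<partial>lborel)"
      by (intro nn_integral_cong) (auto simp: cell_ind_def norm_mult)
    finally have "(ennreal (cmod (u z - avg k u z)))\<^sup>2 \<le> (ennreal (8^k))\<^sup>2 *
      (\<integral>\<^sup>+w. ennreal (cmod (d z w) * cmod (cell_ind k z w)) * ennreal (cmod (cell_ind k z w)) \<partial>lborel)\<^sup>2"
      unfolding power_mult_distrib[symmetric] by (rule power_mono) simp
    also have "\<dots> \<le> (ennreal (8^k))\<^sup>2 *
      ((\<integral>\<^sup>+w. ennreal (cmod (d z w) * cmod (cell_ind k z w))^2 \<partial>lborel) * (\<integral>\<^sup>+w. ennreal (cmod (cell_ind k z w))^2 \<partial>lborel))"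
      unfolding d_def by (intro mult_left_mono Cauchy_Schwarz_nn_integral) measurable
    also have "(\<integral>\<^sup>+w. ennreal (cmod (cell_ind k z w))^2 \<partial>lborel) = ennreal (1 / 8^k)"
      using cell_ind_nn_integral by (simp add: ennreal_power)
    also have "(ennreal (8^k))\<^sup>2 * ((\<integral>\<^sup>+w. ennreal (cmod (d z w) * cmod (cell_ind k z w))^2 \<partial>lborel) * ennreal (1 / 8^k))
      = ennreal (8^k) * (\<integral>\<^sup>+w. ennreal (cmod (d z w) * cmod (cell_ind k z w))^2 \<partial>lborel)"
    proof -
      have "(ennreal (8^k))\<^sup>2 * ennreal (1 / 8^k) = ennreal (8^k)"
        by (simp add: ennreal_power flip: ennreal_mult) (simp add: power2_eq_square)
      moreover have "a * (x * b) = (a * b) * x" for a b x :: ennreal by (simp only: ac_simps)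
      ultimately show ?thesis by (simp only:)
    qed
    also have "\<dots> \<le> ennreal (8^k) * (\<integral>\<^sup>+w. indicator J (w - z) * ennreal ((cmod (d z w))\<^sup>2) \<partial>lborel)"
      by (intro mult_left_mono nn_integral_mono) (auto simp: cell_ind_def cell_J ennreal_power)
    also have "(\<integral>\<^sup>+w. indicator J (w - z) * ennreal ((cmod (d z w))\<^sup>2) \<partial>lborel)
      = (\<integral>\<^sup>+h. indicator J ((h + z) - z) * ennreal ((cmod (d z (h + z)))\<^sup>2) \<partial>lborel)"
      unfolding d_def by (rule nn_integral_shift[symmetric]) measurable
    finally show ?thesis by (simp add: d_def ennreal_power add.commute)
  qed
  have "(\<integral>\<^sup>+z. ennreal ((cmod (u z - avg k u z))\<^sup>2) \<partial>lborel) \<le>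
     (\<integral>\<^sup>+z. ennreal (8^k) * (\<integral>\<^sup>+h. indicator J h * ennreal ((cmod (u z - u (z + h)))\<^sup>2) \<partial>lborel) \<partial>lborel)"
    by (intro nn_integral_mono pt)
  also have "\<dots> = ennreal (8^k) * (\<integral>\<^sup>+z. (\<integral>\<^sup>+h. indicator J h * ennreal ((cmod (u z - u (z + h)))\<^sup>2) \<partial>lborel) \<partial>lborel)"
    by (rule nn_integral_cmult) measurable
  also have "(\<integral>\<^sup>+z. (\<integral>\<^sup>+h. indicator J h * ennreal ((cmod (u z - u (z + h)))\<^sup>2) \<partial>lborel) \<partial>lborel)
    = (\<integral>\<^sup>+h. (\<integral>\<^sup>+z. indicator J h * ennreal ((cmod (u z - u (z + h)))\<^sup>2) \<partial>lborel) \<partial>lborel)"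
    by (rule lborel_pair.Fubini') measurable
  also have "\<dots> \<le> (\<integral>\<^sup>+h. ennreal (s\<^sup>2) * indicator J h \<partial>lborel)"
  proof (rule nn_integral_mono)
    fix h
    have "(\<integral>\<^sup>+z. indicator J h * ennreal ((cmod (u z - u (z + h)))\<^sup>2) \<partial>lborel)
      = indicator J h * (\<integral>\<^sup>+z. ennreal ((cmod (u z - u (z + h)))\<^sup>2) \<partial>lborel)"
      by (rule nn_integral_cmult) measurable
    also have "(\<integral>\<^sup>+z. ennreal ((cmod (u z - u (z + h)))\<^sup>2) \<partial>lborel) = ennreal ((L2_norm (\<lambda>z. tau h u z - u z))\<^sup>2)"
      using L2_nn_integral[OF L2_diff[OF tau_L2[OF u] u], of h] by (simp add: tau_def norm_minus_commute)
    also have "indicator J h * \<dots> \<le> indicator J h * ennreal (s\<^sup>2)"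
      using s[of h] by (auto simp: indicator_def J_iff intro!: power_mono)
    finally show "(\<integral>\<^sup>+z. indicator J h * ennreal ((cmod (u z - u (z + h)))\<^sup>2) \<partial>lborel) \<le> ennreal (s\<^sup>2) * indicator J h"
      by (simp add: mult.commute)
  qed
  also have "\<dots> = ennreal (s\<^sup>2) * ennreal (4 / 8^k)"
    by (subst nn_integral_cmult_indicator) (simp_all add: J_em)
  also have "ennreal (8^k) * \<dots> = ennreal ((2 * s)\<^sup>2)"
    by (simp flip: ennreal_mult)
  finally have *: "(\<integral>\<^sup>+z. ennreal ((cmod (u z - avg k u z))\<^sup>2) \<partial>lborel) \<le> ennreal ((2 * s)\<^sup>2)"
    by (simp add: mult_left_mono)
  have m: "(\<lambda>z. u z - avg k u z) \<in> borel_measurable borel" by measurable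
  show "L2_norm (\<lambda>z. u z - avg k u z) \<le> 2 * s"
    using L2I_nn_integral(2)[OF m *] s0 by simp
  have "(\<lambda>z. u z - (u z - avg k u z)) \<in> L2"
    by (rule L2_diff[OF u L2I_nn_integral(1)[OF m *]])
  then show "avg k u \<in> L2" by simp
qed

section \<open>Subcritical embedding and non-vanishing\<close>

text \<open>The only property of the ball \<open>E u \<le> 1\<close> that the embedding and compactness arguments use: functions
that are approximated in \<open>L\<^sup>2\<close> by their box averages at a geometric rate.\<close>
definition dyadic_class :: "real \<Rightarrow> plane_fun set" where
  "dyadic_class M = {u \<in> L2. L2_norm u \<le> M \<and>
     (\<forall>k. avg k u \<in> L2 \<and> L2_norm (\<lambda>z. u z - avg k u z) \<le> M / 2^k)}"

lemma dyadic_classD: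
  assumes "u \<in> dyadic_class M"
  shows "u \<in> L2" "L2_norm u \<le> M" "avg k u \<in> L2" "L2_norm (\<lambda>z. u z - avg k u z) \<le> M / 2^k" "0 \<le> M"
proof -
  show *: "u \<in> L2" "L2_norm u \<le> M" "avg k u \<in> L2" "L2_norm (\<lambda>z. u z - avg k u z) \<le> M / 2^k"
    using assms unfolding dyadic_class_def by blast+
  show "0 \<le> M" using L2_norm_nonneg[of u] *(2) by linarith
qed

text \<open>The dyadic boxes are nested, so averaging the coarse average again leaves it unchanged.\<close>
lemma avg_Suc:
  assumes u: "u \<in> L2" "avg k u \<in> L2"
  shows "avg (Suc k) u z = avg k u z + avg (Suc k) (\<lambda>w. u w - avg k u w) z"
proof -
  have "8^Suc k * ip (avg k u) (cell_ind (Suc k) z) = avg k u z"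
    by (rule ip_cell_ind_const) (rule avg_cell_cong, rule dyadic_cell_refine)
  then show ?thesis
    unfolding avg_def[of "Suc k"] ip_diff_left[OF u cell_ind_L2] right_diff_distrib by simp
qed

text \<open>Successive averages differ by an average, over a box of measure \<open>8\<^sup>-\<^sup>k\<^sup>-\<^sup>1\<close>, of a function of norm
at most \<open>2\<^sup>-\<^sup>k M\<close>; Cauchy--Schwarz bounds the difference by \<open>2\<surd>2 M (\<surd>2)\<^sup>k\<close>. The
constant 8 closes the induction because \<open>8 + 2\<surd>2 \<le> 8\<surd>2\<close>.\<close>
lemma dyadic_class_avg_bound:
  assumes u: "u \<in> dyadic_class M"
  shows "cmod (avg k u z) \<le> 8 * M * (sqrt 2)^k"
proof (induction k)
  case 0
  have "cmod (avg 0 u z) \<le> M"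
    using avg_bound[OF dyadic_classD(1)[OF u], of 0 z] dyadic_classD(2)[OF u] by simp
  then show ?case using dyadic_classD(5)[OF u] by simp
next
  case (Suc k)
  note D = dyadic_classD[OF u]
  have s2: "4/3 \<le> sqrt 2" by (rule real_le_rsqrt) (simp add: power2_eq_square)
  have s8: "sqrt (8^Suc k) = 2 * sqrt 2 * (2 * sqrt 2)^k"
  proof -
    have "sqrt 8 = sqrt (2^2 * 2)" by simp
    also have "\<dots> = 2 * sqrt 2" by (simp only: real_sqrt_mult real_sqrt_abs)
    finally show ?thesis by (simp only: real_sqrt_power power_Suc real_sqrt_mult)
  qed
  have "cmod (avg (Suc k) (\<lambda>w. u w - avg k u w) z) \<le> sqrt (8^Suc k) * L2_norm (\<lambda>w. u w - avg k u w)"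
    by (rule avg_bound) (use D in auto)
  also have "\<dots> \<le> sqrt (8^Suc k) * (M / 2^k)"
    using D by (intro mult_left_mono) auto
  also have "\<dots> = 2 * sqrt 2 * M * (sqrt 2)^k"
    unfolding s8 power_mult_distrib by simp
  finally have "cmod (avg (Suc k) u z) \<le> 8 * M * (sqrt 2)^k + 2 * sqrt 2 * M * (sqrt 2)^k"
    unfolding avg_Suc[OF D(1,3)] using Suc
    by (intro norm_triangle_mono)
  also have "\<dots> = (8 + 2 * sqrt 2) * (M * (sqrt 2)^k)" by (simp add: algebra_simps)
  also have "\<dots> \<le> (8 * sqrt 2) * (M * (sqrt 2)^k)"
    using s2 D(5) by (intro mult_right_mono) auto
  finally show ?case by (simp add: ac_simps)
qed

text \<open>The contribution of scale \<open>k\<close> to the integral of \<open>|u|\<^sup>q\<close>: the function is below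
\<open>16 M (\<surd>2)\<^sup>k\<^sup>+\<^sup>1\<close> there, and its square is controlled by \<open>4 |u - A\<^sub>k u|\<^sup>2\<close>.\<close>
definition tail_term :: "real \<Rightarrow> real \<Rightarrow> nat \<Rightarrow> real" where
  "tail_term q M k = (16 * M * (sqrt 2)^Suc k) powr (q - 2) * (4 * (M / 2^k)\<^sup>2)"

lemma tail_term_nonneg: "0 \<le> tail_term q M k"
  by (simp add: tail_term_def)

text \<open>A geometric series of ratio \<open>(\<surd>2)\<^sup>q\<^sup>-\<^sup>2 / 4\<close>. It is here that the exponent 6
is critical.\<close>
lemma summable_tail_term:
  assumes "2 < q" "q < 6" "0 < M" shows "summable (tail_term q M)"
proof -
  define r where "r = (sqrt 2) powr (q - 2) / 4"
  have "(sqrt 2) powr (q - 2) < (sqrt 2) powr 4"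
    using assms by (intro powr_less_mono) auto
  also have "(sqrt 2) powr 4 = 4"
  proof -
    have "(sqrt 2) powr 4 = (sqrt 2)^4" using powr_realpow[of "sqrt 2" 4] by simp
    also have "\<dots> = ((sqrt 2)\<^sup>2)\<^sup>2" by (simp only: power_mult[symmetric]) simp
    also have "\<dots> = 4" by simp
    finally show ?thesis .
  qed
  finally have r: "0 \<le> r" "r < 1" by (auto simp: r_def)
  define C where "C = (16 * M * sqrt 2) powr (q - 2) * (4 * M\<^sup>2)"
  have "tail_term q M k = C * r^k" for k
  proof -
    have "(16 * M * (sqrt 2)^Suc k) powr (q - 2) = (16 * M * sqrt 2) powr (q - 2) * ((sqrt 2)^k) powr (q - 2)"
      using assms(3) by (subst powr_mult[symmetric]) (auto simp: ac_simps)
    also have "((sqrt 2)^k) powr (q - 2) = ((sqrt 2) powr (q - 2))^k"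
      by (simp flip: powr_realpow add: powr_powr mult.commute)
    finally have 1: "(16 * M * (sqrt 2)^Suc k) powr (q - 2) = (16 * M * sqrt 2) powr (q - 2) * ((sqrt 2) powr (q - 2))^k" .
    have 2: "(2^k)\<^sup>2 = (4^k :: real)" by (simp add: power2_eq_square flip: power_mult_distrib)
    show ?thesis unfolding tail_term_def 1 C_def r_def power_divide 2 by (simp add: ac_simps)
  qed
  then have "tail_term q M = (\<lambda>k. C * r^k)" by auto
  then show ?thesis using r by (auto intro!: summable_mult summable_geometric)
qed

lemma powr_split_square: "0 \<le> x \<Longrightarrow> 2 < q \<Longrightarrow> x powr q = x powr (q - 2) * (x\<^sup>2 :: real)"
proof (cases "x = 0")
  case False
  assume "0 \<le> x"
  then have "x powr q = x powr ((q - 2) + 2)" "0 < x" using False by simp_all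
  then show ?thesis unfolding powr_add by (simp add: powr_numeral)
qed simp

text \<open>Where \<open>|u| > \<epsilon>\<close>, choose the first scale \<open>k \<ge> K\<close> at which \<open>|u|\<close> falls below
\<open>16 M (\<surd>2)\<^sup>k\<^sup>+\<^sup>1\<close>, twice the bound on the next average. Then \<open>|u|\<close> is still at least
\<open>2 |A\<^sub>k u|\<close>, so that \<open>|u| \<le> 2 |u - A\<^sub>k u|\<close>, and summing over the scales controls the integral by the
rates of approximation. Taking \<open>K = 0\<close> gives the embedding, and a large \<open>K\<close> the
non-vanishing statement.\<close>
lemma dyadic_class_nn_integral_powr:
  assumes u: "u \<in> dyadic_class M" and M: "0 < M" and q: "2 < q" "q < 6"
    and \<epsilon>: "0 \<le> \<epsilon>" "\<And>z. cmod (avg K u z) \<le> \<epsilon> / 2"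
  shows "(\<integral>\<^sup>+z. ennreal (cmod (u z) powr q) \<partial>lborel) \<le>
    ennreal (\<epsilon> powr (q - 2) * M\<^sup>2 + (\<Sum>k. tail_term q M (K + k)))"
proof -
  note D = dyadic_classD[OF u]
  have [measurable]: "u \<in> borel_measurable borel" using D by auto
  (* twice the bound on the averages at scale k *)
  define lam where "lam k = 16 * M * (sqrt 2)^k" for k :: nat
  define d where "d k z = 4 * (cmod (u z - avg k u z))\<^sup>2" for k z
  have pt: "ennreal (cmod (u z) powr q) \<le> ennreal (\<epsilon> powr (q - 2) * (cmod (u z))\<^sup>2) +
      (\<Sum>k. ennreal (lam (Suc (K + k)) powr (q - 2) * d (K + k) z))" for z
  proof (cases "cmod (u z) \<le> \<epsilon>")
    case True
    have "cmod (u z) powr q = cmod (u z) powr (q - 2) * (cmod (u z))\<^sup>2"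
      using q by (intro powr_split_square) auto
    also have "\<dots> \<le> \<epsilon> powr (q - 2) * (cmod (u z))\<^sup>2"
      using True q by (intro mult_right_mono powr_mono2) auto
    finally have "ennreal (cmod (u z) powr q) \<le> ennreal (\<epsilon> powr (q - 2) * (cmod (u z))\<^sup>2)"
      by (rule ennreal_leI)
    then show ?thesis by (rule order_trans) simp
  next
    case False
    have ex: "\<exists>k. cmod (u z) < lam (Suc (K + k))"
    proof -
      obtain n where n: "cmod (u z) / (16 * M) < (sqrt 2)^n"
        using real_arch_pow[of "sqrt 2" "cmod (u z) / (16 * M)"] by auto
      also have "(sqrt 2)^n \<le> (sqrt 2)^(Suc (K + n))" by (rule power_increasing) auto
      finally have "cmod (u z) < lam (Suc (K + n))"
        using M unfolding lam_def by (simp add: pos_divide_less_eq mult.commute)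
      then show ?thesis ..
    qed
    define k where "k = (LEAST k. cmod (u z) < lam (Suc (K + k)))"
    have k: "cmod (u z) < lam (Suc (K + k))" unfolding k_def by (rule LeastI_ex[OF ex])
    have a: "2 * cmod (avg (K + k) u z) \<le> cmod (u z)"
    proof (cases k)
      case 0 then show ?thesis using False \<epsilon>(2)[of z] by simp
    next
      case (Suc j)
      then have "j < (LEAST k. cmod (u z) < lam (Suc (K + k)))" unfolding k_def by simp
      from not_less_Least[OF this] have "\<not> cmod (u z) < lam (Suc (K + j))" .
      then have "lam (K + k) \<le> cmod (u z)" using Suc by simp
      then show ?thesis using dyadic_class_avg_bound[OF u, of "K + k" z] unfolding lam_def by linarith
    qed
    have "cmod (u z) \<le> cmod (u z - avg (K + k) u z) + cmod (avg (K + k) u z)"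
      using norm_triangle_ineq[of "u z - avg (K + k) u z" "avg (K + k) u z"] by simp
    then have "cmod (u z) \<le> 2 * cmod (u z - avg (K + k) u z)" using a by linarith
    then have "(cmod (u z))\<^sup>2 \<le> (2 * cmod (u z - avg (K + k) u z))\<^sup>2" by (rule power_mono) simp
    then have sq: "(cmod (u z))\<^sup>2 \<le> d (K + k) z" by (simp add: d_def power_mult_distrib)
    have "cmod (u z) powr q = cmod (u z) powr (q - 2) * (cmod (u z))\<^sup>2"
      using q by (intro powr_split_square) auto
    also have "\<dots> \<le> lam (Suc (K + k)) powr (q - 2) * d (K + k) z"
      using k q sq by (intro mult_mono powr_mono2) auto
    finally have "ennreal (cmod (u z) powr q) \<le> ennreal (lam (Suc (K + k)) powr (q - 2) * d (K + k) z)"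
      by (rule ennreal_leI)
    also have "\<dots> \<le> (\<Sum>k. ennreal (lam (Suc (K + k)) powr (q - 2) * d (K + k) z))"
      using sum_le_suminf[of "\<lambda>k. ennreal (lam (Suc (K + k)) powr (q - 2) * d (K + k) z)" "{k}"] by simp
    finally show ?thesis by (rule order_trans) simp
  qed
  have d_meas [measurable]: "d k \<in> borel_measurable borel" for k unfolding d_def by measurable
  have d_nn: "(\<integral>\<^sup>+z. ennreal (d k z) \<partial>lborel) \<le> ennreal (4 * (M / 2^k)\<^sup>2)" for k
  proof -
    have "(\<integral>\<^sup>+z. ennreal (d k z) \<partial>lborel) = ennreal 4 * (\<integral>\<^sup>+z. ennreal ((cmod (u z - avg k u z))\<^sup>2) \<partial>lborel)"
      unfolding d_def by (subst nn_integral_cmult[symmetric]) (auto simp: ennreal_mult)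
    also have "\<dots> = ennreal 4 * ennreal ((L2_norm (\<lambda>z. u z - avg k u z))\<^sup>2)"
      using L2_nn_integral[OF L2_diff[OF D(1,3)]] by simp
    also have "\<dots> \<le> ennreal 4 * ennreal ((M / 2^k)\<^sup>2)"
      by (intro mult_left_mono ennreal_leI power_mono D) auto
    finally show ?thesis by (simp add: ennreal_mult)
  qed
  have "(\<integral>\<^sup>+z. ennreal (cmod (u z) powr q) \<partial>lborel) \<le>
    (\<integral>\<^sup>+z. ennreal (\<epsilon> powr (q - 2) * (cmod (u z))\<^sup>2) + (\<Sum>k. ennreal (lam (Suc (K + k)) powr (q - 2) * d (K + k) z)) \<partial>lborel)"
    by (intro nn_integral_mono pt)
  also have "\<dots> = (\<integral>\<^sup>+z. ennreal (\<epsilon> powr (q - 2) * (cmod (u z))\<^sup>2) \<partial>lborel) +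
     (\<integral>\<^sup>+z. (\<Sum>k. ennreal (lam (Suc (K + k)) powr (q - 2) * d (K + k) z)) \<partial>lborel)"
    by (rule nn_integral_add) measurable
  also have "(\<integral>\<^sup>+z. (\<Sum>k. ennreal (lam (Suc (K + k)) powr (q - 2) * d (K + k) z)) \<partial>lborel)
     = (\<Sum>k. \<integral>\<^sup>+z. ennreal (lam (Suc (K + k)) powr (q - 2) * d (K + k) z) \<partial>lborel)"
    by (rule nn_integral_suminf) measurable
  also have "\<dots> \<le> (\<Sum>k. ennreal (tail_term q M (K + k)))"
  proof (rule suminf_le)
    fix k
    have "(\<integral>\<^sup>+z. ennreal (lam (Suc (K + k)) powr (q - 2) * d (K + k) z) \<partial>lborel) =
      ennreal (lam (Suc (K + k)) powr (q - 2)) * (\<integral>\<^sup>+z. ennreal (d (K + k) z) \<partial>lborel)"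
      by (subst nn_integral_cmult[symmetric]) (auto simp: ennreal_mult d_def)
    also have "\<dots> \<le> ennreal (lam (Suc (K + k)) powr (q - 2)) * ennreal (4 * (M / 2^(K + k))\<^sup>2)"
      by (intro mult_left_mono d_nn) simp
    also have "\<dots> = ennreal (tail_term q M (K + k))"
      by (simp add: tail_term_def lam_def ennreal_mult)
    finally show "(\<integral>\<^sup>+z. ennreal (lam (Suc (K + k)) powr (q - 2) * d (K + k) z) \<partial>lborel) \<le> ennreal (tail_term q M (K + k))" .
  qed auto
  also have "\<dots> = ennreal (\<Sum>k. tail_term q M (K + k))"
    using summable_ignore_initial_segment[OF summable_tail_term[OF q M], of K]
    by (intro suminf_ennreal2) (auto simp: tail_term_nonneg add.commute)
  also have "(\<integral>\<^sup>+z. ennreal (\<epsilon> powr (q - 2) * (cmod (u z))\<^sup>2) \<partial>lborel) \<le> ennreal (\<epsilon> powr (q - 2) * M\<^sup>2)"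
  proof -
    have "(\<integral>\<^sup>+z. ennreal (\<epsilon> powr (q - 2) * (cmod (u z))\<^sup>2) \<partial>lborel) =
      ennreal (\<epsilon> powr (q - 2)) * ennreal ((L2_norm u)\<^sup>2)"
      unfolding L2_nn_integral[OF D(1), symmetric]
      by (subst nn_integral_cmult[symmetric]) (auto simp: ennreal_mult)
    also have "\<dots> \<le> ennreal (\<epsilon> powr (q - 2)) * ennreal (M\<^sup>2)"
      by (intro mult_left_mono ennreal_leI power_mono D) auto
    finally show ?thesis by (simp add: ennreal_mult)
  qed
  finally have "(\<integral>\<^sup>+z. ennreal (cmod (u z) powr q) \<partial>lborel) \<le>
      ennreal (\<epsilon> powr (q - 2) * M\<^sup>2) + ennreal (\<Sum>k. tail_term q M (K + k))"
    by (simp add: add_right_mono)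
  also have "\<dots> = ennreal (\<epsilon> powr (q - 2) * M\<^sup>2 + (\<Sum>k. tail_term q M (K + k)))"
    using summable_ignore_initial_segment[OF summable_tail_term[OF q M], of K]
    by (intro ennreal_plus[symmetric] suminf_nonneg) (auto simp: tail_term_nonneg add.commute)
  finally show ?thesis .
qed

lemma dyadic_class_Sobolev:
  assumes M: "0 < M" and q: "2 < q" "q < 6"
  obtains C where "0 < C" "\<And>u. u \<in> dyadic_class M \<Longrightarrow> integrable lborel (\<lambda>z. cmod (u z) powr q)"
    "\<And>u. u \<in> dyadic_class M \<Longrightarrow> Lq_norm_pow q u \<le> C"
proof -
  define C where "C = (16 * M) powr (q - 2) * M\<^sup>2 + (\<Sum>k. tail_term q M (0 + k))"
  have C: "0 < C"
    using M suminf_nonneg[OF summable_tail_term[OF q M] tail_term_nonneg]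
    unfolding C_def by (intro add_pos_nonneg) auto
  have *: "integrable lborel (\<lambda>z. cmod (u z) powr q) \<and> Lq_norm_pow q u \<le> C" if u: "u \<in> dyadic_class M" for u
  proof -
    have [measurable]: "u \<in> borel_measurable borel" using dyadic_classD[OF u] by auto
    have "cmod (avg 0 u z) \<le> 16 * M / 2" for z using dyadic_class_avg_bound[OF u, of 0 z] by simp
    then have b: "(\<integral>\<^sup>+z. ennreal (cmod (u z) powr q) \<partial>lborel) \<le> ennreal C"
      unfolding C_def using M by (intro dyadic_class_nn_integral_powr[OF u M q]) auto
    have i: "integrable lborel (\<lambda>z. cmod (u z) powr q)"
      by (rule integrableI_bounded) (use b in \<open>auto intro: le_less_trans\<close>)
    have "ennreal (Lq_norm_pow q u) \<le> ennreal C"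
      unfolding Lq_norm_pow_def using b by (subst nn_integral_eq_integral[OF i, symmetric]) auto
    then show ?thesis using i C by simp
  qed
  show ?thesis using that[OF C] * by blast
qed

text \<open>A form of the vanishing lemma of Lions, by contraposition: if all averages at scale \<open>K\<close> are below
\<open>\<epsilon>/2\<close>, the previous bound consists of the tail beyond \<open>K\<close> and of a term of size \<open>\<epsilon>\<^sup>q\<^sup>-\<^sup>2\<close>,
both of which can be made small.\<close>
lemma dyadic_class_nonvanishing:
  assumes M: "0 < M" and q: "2 < q" "q < 6" and b: "0 < b"
  obtains K \<epsilon> where "0 < \<epsilon>"
    "\<And>u. u \<in> dyadic_class M \<Longrightarrow> b \<le> Lq_norm_pow q u \<Longrightarrow> \<exists>z. \<epsilon> < cmod (avg K u z)"
proof -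
  have "(\<lambda>K. \<Sum>k. tail_term q M (k + K)) \<longlonglongrightarrow> 0"
    by (rule suminf_exist_split2[OF summable_tail_term[OF q M]])
  then have "eventually (\<lambda>K. (\<Sum>k. tail_term q M (k + K)) < b / 4) sequentially"
    using b by (intro order_tendstoD(2)) auto
  then obtain K where K: "(\<Sum>k. tail_term q M (K + k)) < b / 4"
    by (auto simp: eventually_sequentially add.commute)
  define \<epsilon> where "\<epsilon> = (b / (4 * M\<^sup>2)) powr (1 / (q - 2))"
  have \<epsilon>: "0 < \<epsilon>" using b M by (simp add: \<epsilon>_def)
  have "\<epsilon> powr (q - 2) = b / (4 * M\<^sup>2)" using b M q by (simp add: \<epsilon>_def powr_powr)
  then have e: "\<epsilon> powr (q - 2) * M\<^sup>2 = b / 4" using M by simp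
  have "\<exists>z. \<epsilon> / 2 < cmod (avg K u z)" if u: "u \<in> dyadic_class M" and bu: "b \<le> Lq_norm_pow q u" for u
  proof (rule ccontr)
    assume "\<not> ?thesis"
    then have "cmod (avg K u z) \<le> \<epsilon> / 2" for z unfolding not_ex not_less by blast
    from dyadic_class_nn_integral_powr[OF u M q less_imp_le[OF \<epsilon>] this]
    have 1: "(\<integral>\<^sup>+z. ennreal (cmod (u z) powr q) \<partial>lborel) \<le> ennreal (b / 4 + (\<Sum>k. tail_term q M (K + k)))"
      unfolding e .
    also have "\<dots> \<le> ennreal (b / 2)" using K by (intro ennreal_leI) simp
    finally have 2: "(\<integral>\<^sup>+z. ennreal (cmod (u z) powr q) \<partial>lborel) \<le> ennreal (b / 2)" .
    have [measurable]: "u \<in> borel_measurable borel" using dyadic_classD[OF u] by auto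
    have i: "integrable lborel (\<lambda>z. cmod (u z) powr q)"
      by (rule integrableI_bounded) (use 2 in \<open>auto intro: le_less_trans\<close>)
    have "ennreal (Lq_norm_pow q u) \<le> ennreal (b / 2)"
      unfolding Lq_norm_pow_def using 2 by (subst nn_integral_eq_integral[OF i, symmetric]) auto
    then have "Lq_norm_pow q u \<le> b / 2" using b by simp
    then show False using bu b by simp
  qed
  then show ?thesis using that[of "\<epsilon> / 2" K] \<epsilon> by simp
qed

section \<open>Local compactness\<close>

lemma gauss_le_1: "gauss z \<le> 1"
proof -
  have "exp (- (norm z)\<^sup>2 / 2) \<le> 1" by simp
  moreover have "1 \<le> 2 * pi" using pi_gt3 by simp
  ultimately have "exp (- (norm z)\<^sup>2 / 2) \<le> 2 * pi" by linarith
  then show ?thesis unfolding gauss_eq by (subst divide_le_eq_1_pos) auto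
qed

lemma gauss_sq_integrable: "integrable lborel (\<lambda>z. (c * gauss z)\<^sup>2)"
proof -
  have "integrable lborel (\<lambda>z. (gauss z)\<^sup>2)"
  proof (rule Bochner_Integration.integrable_bound[OF integrable_gauss])
    show "AE z in lborel. norm ((gauss z)\<^sup>2) \<le> norm (gauss z)"
      using gauss_le_1 gauss_pos by (auto simp: power2_eq_square abs_mult less_imp_le intro!: AE_I2 mult_left_le)
  qed measurable
  then show ?thesis by (simp add: power_mult_distrib)
qed

lemma dyadic_cell_corner:
  "dyadic_cell k (real_of_int \<lfloor>2^k * fst z\<rfloor> / 2^k, real_of_int \<lfloor>4^k * snd z\<rfloor> / 4^k) = dyadic_cell k z"
  by (simp add: dyadic_cell_def)

text \<open>There are countably many boxes, and each average is bounded uniformly in the sequence, so that a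
diagonal argument applies. Dividing by \<open>(\<surd>2)\<^sup>k\<close> makes the bound independent of the scale.\<close>
lemma dyadic_averages_subsequence:
  assumes u: "\<And>n. u n \<in> dyadic_class M"
  obtains s where "strict_mono (s :: nat \<Rightarrow> nat)" "\<And>k z. convergent (\<lambda>n. avg k (u (s n)) z)"
proof -
  define f where "f n i = (case i of (k, a, b) \<Rightarrow> avg k (u n) (real_of_int a / 2^k, real_of_int b / 4^k) / (sqrt 2)^k)"
    for n :: nat and i :: "nat \<times> int \<times> int"
  have b: "norm (f n i) \<le> 8 * M" for n i
  proof (cases i)
    case (fields k a b)
    have "cmod (avg k (u n) (real_of_int a / 2^k, real_of_int b / 4^k)) \<le> 8 * M * (sqrt 2)^k"
      by (rule dyadic_class_avg_bound[OF u])
    then show ?thesis by (simp add: f_def fields norm_divide norm_power divide_le_eq)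
  qed
  have "countable (UNIV :: (nat \<times> int \<times> int) set)" by simp
  from this b obtain s where
    s: "strict_mono s" "\<And>i. i \<in> UNIV \<Longrightarrow> \<exists>l. (\<lambda>n. f (s n) i) \<longlonglongrightarrow> l"
    by (rule function_convergent_subsequence[where f=f and S=UNIV and M="8 * M"]) (rule that)
  have "convergent (\<lambda>n. avg k (u (s n)) z)" for k z
  proof -
    define c where "c = (real_of_int \<lfloor>2^k * fst z\<rfloor> / 2^k, real_of_int \<lfloor>4^k * snd z\<rfloor> / 4^k)"
    obtain l where "(\<lambda>n. f (s n) (k, \<lfloor>2^k * fst z\<rfloor>, \<lfloor>4^k * snd z\<rfloor>)) \<longlonglongrightarrow> l"
      using s(2)[OF UNIV_I] by metis
    then have "(\<lambda>n. (sqrt 2)^k * f (s n) (k, \<lfloor>2^k * fst z\<rfloor>, \<lfloor>4^k * snd z\<rfloor>)) \<longlonglongrightarrow> (sqrt 2)^k * l"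
      by (intro tendsto_intros)
    then have "(\<lambda>n. avg k (u (s n)) c) \<longlonglongrightarrow> (sqrt 2)^k * l"
      by (simp add: f_def c_def)
    moreover have "avg k (u (s n)) c = avg k (u (s n)) z" for n
      unfolding c_def by (rule avg_cell_cong[OF dyadic_cell_corner])
    ultimately show ?thesis by (auto simp: convergent_def)
  qed
  then show ?thesis using that[OF s(1)] by blast
qed

text \<open>Once all averages converge pointwise, multiplying by a Gaussian weight makes them converge in
\<open>L\<^sup>2\<close>; the rate of approximation transfers this to the functions, which are thus Cauchy for the
weighted norm. The weight is positive, so that almost everywhere convergence follows, and weak
convergence first against functions supported where the weight is bounded below and then by density.\<close>
lemma dyadic_class_compact:
  assumes u: "\<And>n. u n \<in> dyadic_class M"
  obtains r v where "strict_mono (r :: nat \<Rightarrow> nat)" "v \<in> L2"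
    "AE z in lborel. (\<lambda>n. u (r n) z) \<longlonglongrightarrow> v z"
    "\<And>h. h \<in> L2 \<Longrightarrow> (\<lambda>n. ip (u (r n)) h) \<longlonglongrightarrow> ip v h"
proof -
  note D = dyadic_classD[OF u]
  have [measurable]: "u n \<in> borel_measurable borel" for n using D(1)[of n] by (rule L2_measurable)
  obtain s where s: "strict_mono s" "\<And>k z. convergent (\<lambda>n. avg k (u (s n)) z)"
    by (rule dyadic_averages_subsequence[of u M, OF u]) (rule that)
  define \<rho> where "\<rho> z = complex_of_real (gauss z)" for z
  have [measurable]: "\<rho> \<in> borel_measurable borel" unfolding \<rho>_def by measurable
  have \<rho>0: "\<rho> z \<noteq> 0" for z using gauss_pos[of z] by (simp add: \<rho>_def)
  have \<rho>1: "cmod (\<rho> z) \<le> 1" for z using gauss_pos[of z] gauss_le_1[of z] by (simp add: \<rho>_def)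
  have \<rho>L: "(\<lambda>z. \<rho> z * f z) \<in> L2" and \<rho>n: "L2_norm (\<lambda>z. \<rho> z * f z) \<le> L2_norm f" if f: "f \<in> L2" for f
  proof -
    have [measurable]: "f \<in> borel_measurable borel" using f by auto
    have le: "cmod (\<rho> z * f z) \<le> cmod (f z)" for z
      using \<rho>1[of z] by (simp add: norm_mult mult_left_le_one_le)
    show L: "(\<lambda>z. \<rho> z * f z) \<in> L2" by (rule L2_bound[OF f, where c=1]) (use le in auto)
    show "L2_norm (\<lambda>z. \<rho> z * f z) \<le> L2_norm f"
      unfolding L2_norm_def using L f le
      by (intro real_sqrt_le_mono integral_mono power_mono) (auto intro: L2_square_integrable)
  qed
  define a where "a k z = lim (\<lambda>n. avg k (u (s n)) z)" for k z
  have a_lim: "(\<lambda>n. avg k (u (s n)) z) \<longlonglongrightarrow> a k z" for k z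
    using s(2)[of k z] unfolding a_def by (simp add: convergent_LIMSEQ_iff)
  have [measurable]: "a k \<in> borel_measurable borel" for k unfolding a_def by measurable
  have A: "(\<lambda>z. \<rho> z * a k z) \<in> L2" "(\<lambda>n. L2_norm (\<lambda>z. \<rho> z * avg k (u (s n)) z - \<rho> z * a k z)) \<longlonglongrightarrow> 0" for k
  proof -
    have 1: "(\<lambda>z. \<rho> z * avg k (u (s n)) z) \<in> borel_measurable borel" for n by measurable
    have 2: "(\<lambda>z. \<rho> z * a k z) \<in> borel_measurable borel" by measurable
    have 3: "cmod (\<rho> z * avg k (u (s n)) z) \<le> 8 * M * (sqrt 2)^k * gauss z" for n z
      using mult_right_mono[OF dyadic_class_avg_bound[OF u[of "s n"], of k z], of "gauss z"] gauss_pos[of z]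
      by (simp add: \<rho>_def norm_mult mult.commute)
    have 4: "AE z in lborel. (\<lambda>n. \<rho> z * avg k (u (s n)) z) \<longlonglongrightarrow> \<rho> z * a k z"
      by (intro AE_I2 tendsto_intros a_lim)
    show "(\<lambda>z. \<rho> z * a k z) \<in> L2" "(\<lambda>n. L2_norm (\<lambda>z. \<rho> z * avg k (u (s n)) z - \<rho> z * a k z)) \<longlonglongrightarrow> 0"
      by (rule L2_dominated[OF 1 2 gauss_sq_integrable 3 4])+
  qed
  define V where "V n z = \<rho> z * u (s n) z" for n z
  have V: "V n \<in> L2" for n unfolding V_def by (rule \<rho>L[OF D(1)])
  have cauchy: "\<exists>N. \<forall>m\<ge>N. \<forall>n\<ge>N. L2_norm (\<lambda>z. V m z - V n z) < e" if e: "0 < e" for e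
  proof -
    have "(\<lambda>k. M * (1/2)^k) \<longlonglongrightarrow> M * 0" by (intro tendsto_intros) auto
    then have "eventually (\<lambda>k. M * (1/2)^k < e/4) sequentially"
      using e by (intro order_tendstoD(2)) auto
    then obtain k where k: "M / 2^k < e/4" by (auto simp: eventually_sequentially power_one_over)
    have "eventually (\<lambda>n. L2_norm (\<lambda>z. \<rho> z * avg k (u (s n)) z - \<rho> z * a k z) < e/4) sequentially"
      using e by (intro order_tendstoD(2)[OF A(2)]) auto
    then obtain N where N: "\<And>n. N \<le> n \<Longrightarrow> L2_norm (\<lambda>z. \<rho> z * avg k (u (s n)) z - \<rho> z * a k z) < e/4"
      by (auto simp: eventually_sequentially)
    have near: "L2_norm (\<lambda>z. V n z - \<rho> z * a k z) < e/2" if "N \<le> n" for n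
    proof -
      have "L2_norm (\<lambda>z. \<rho> z * (u (s n) z - avg k (u (s n)) z)) \<le> M / 2^k"
        using \<rho>n[OF L2_diff[OF D(1,3)], of "s n" k "s n"] D(4)[of "s n" k] by linarith
      then have "L2_norm (\<lambda>z. V n z - \<rho> z * avg k (u (s n)) z) \<le> M / 2^k"
        by (simp add: V_def right_diff_distrib)
      then show ?thesis
        using L2_norm_diff_triangle[OF V \<rho>L[OF D(3)] A(1), of n k k "s n"] N[OF that] k by linarith
    qed
    have "L2_norm (\<lambda>z. V m z - V n z) < e" if "N \<le> m" "N \<le> n" for m n
      using L2_norm_diff_triangle[OF V[of m] A(1)[of k] V[of n]] near[OF that(1)] near[OF that(2)]
        L2_norm_minus_commute[of "V n" "\<lambda>z. \<rho> z * a k z"] by linarith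
    then show ?thesis by blast
  qed
  obtain g t where g: "g \<in> L2" "(\<lambda>n. L2_norm (\<lambda>z. V n z - g z)) \<longlonglongrightarrow> 0"
    "strict_mono t" "AE z in lborel. (\<lambda>n. V (t n) z) \<longlonglongrightarrow> g z"
    by (rule L2_complete[OF V cauchy])
  define r where "r n = s (t n)" for n
  have r: "strict_mono r" unfolding r_def using s(1) g(3) by (simp add: strict_mono_def)
  define v where "v z = g z / \<rho> z" for z
  have vm [measurable]: "v \<in> borel_measurable borel"
    unfolding v_def using L2_measurable[OF g(1)] by measurable
  have ae: "AE z in lborel. (\<lambda>n. u (r n) z) \<longlonglongrightarrow> v z"
    using g(4)
  proof eventually_elim
    case (elim z)
    then have "(\<lambda>n. V (t n) z / \<rho> z) \<longlonglongrightarrow> g z / \<rho> z"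
      using \<rho>0 by (intro tendsto_intros) auto
    then show ?case using \<rho>0 by (simp add: V_def v_def r_def)
  qed
  have vL: "v \<in> L2" and vn: "L2_norm v \<le> M"
    using L2_Fatou[of "\<lambda>n. u (r n)" M v, OF D(1,2) vm ae] by auto
  have Vt: "(\<lambda>n. L2_norm (\<lambda>z. V (t n) z - g z)) \<longlonglongrightarrow> 0"
    using LIMSEQ_subseq_LIMSEQ[OF g(2,3)] by (simp add: o_def)
  have weak: "(\<lambda>n. ip (u (r n)) h) \<longlonglongrightarrow> ip v h" if h: "h \<in> L2" for h
  proof (rule LIMSEQ_I)
    fix e :: real assume e: "0 < e"
    have [measurable]: "h \<in> borel_measurable borel" using h by auto
    (* h restricted to the region where the weight is at least 1 / (m + 1), so that the restriction
       can be divided by the weight *)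
    define c where "c m z = (if 1 \<le> real (Suc m) * gauss z then h z else 0)" for m z
    have [measurable]: "c m \<in> borel_measurable borel" for m unfolding c_def by measurable
    have "(\<lambda>m. c m z) \<longlonglongrightarrow> h z" for z
    proof (rule tendsto_eventually)
      obtain n0 :: nat where n0: "1 / gauss z \<le> real n0" using real_arch_simple by blast
      show "\<forall>\<^sub>F m in sequentially. c m z = h z"
        using eventually_ge_at_top[of n0]
      proof eventually_elim
        case (elim m)
        then have "1 / gauss z \<le> real (Suc m)" using n0 by linarith
        then have "1 \<le> real (Suc m) * gauss z" using gauss_pos[of z] by (simp add: divide_le_eq)
        then show ?case unfolding c_def by (simp only: if_True)
      qed
    qed
    then have c_ae: "AE z in lborel. (\<lambda>m. c m z) \<longlonglongrightarrow> h z" by simp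
    have cm: "c m \<in> borel_measurable borel" for m by measurable
    have hm: "h \<in> borel_measurable borel" by measurable
    have cb: "cmod (c m z) \<le> cmod (h z)" for m z by (simp add: c_def)
    note c = L2_dominated[where f=c and w="\<lambda>z. cmod (h z)", OF cm hm L2_square_integrable[OF h] cb c_ae]
    have "0 < e / (2 * (2 * M + 1))" using e D(5) by simp
    then have "eventually (\<lambda>m. L2_norm (\<lambda>z. c m z - h z) < e / (2 * (2 * M + 1))) sequentially"
      by (rule order_tendstoD(2)[OF c(3)])
    then obtain m where m: "L2_norm (\<lambda>z. c m z - h z) < e / (2 * (2 * M + 1))"
      by (auto simp: eventually_sequentially)
    define h' where "h' z = c m z / \<rho> z" for z
    have h'm: "h' \<in> borel_measurable borel" unfolding h'_def by measurable
    have h'L: "h' \<in> L2"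
    proof (rule L2_bound[OF h h'm, where c="real (Suc m)"])
      fix z
      show "cmod (h' z) \<le> real (Suc m) * cmod (h z)"
      proof (cases "1 \<le> real (Suc m) * gauss z")
        case True
        have "cmod (h z) * 1 \<le> cmod (h z) * (real (Suc m) * gauss z)"
          by (rule mult_left_mono[OF True]) simp
        then have "cmod (h z) / gauss z \<le> real (Suc m) * cmod (h z)"
          using gauss_pos[of z] by (simp add: pos_divide_le_eq ac_simps)
        then show ?thesis using True gauss_pos[of z] by (simp add: h'_def c_def \<rho>_def norm_divide)
      qed (auto simp: h'_def c_def)
    qed
    have eq: "ip (\<lambda>z. u (r n) z - v z) (c m) = ip (\<lambda>z. V (t n) z - g z) h'" for n
    proof -
      have "(u (r n) z - v z) * cnj (c m z) = (V (t n) z - g z) * cnj (h' z)" for z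
      proof -
        have "cnj (\<rho> z) = \<rho> z" by (simp add: \<rho>_def)
        then show ?thesis using \<rho>0[of z] by (simp add: V_def r_def v_def h'_def field_simps)
      qed
      then show ?thesis unfolding ip_def by simp
    qed
    have "(\<lambda>n. L2_norm (\<lambda>z. V (t n) z - g z) * L2_norm h') \<longlonglongrightarrow> 0 * L2_norm h'"
      by (intro tendsto_intros Vt)
    then have "eventually (\<lambda>n. L2_norm (\<lambda>z. V (t n) z - g z) * L2_norm h' < e/2) sequentially"
      using e by (intro order_tendstoD(2)) auto
    then obtain N where N: "\<And>n. N \<le> n \<Longrightarrow> L2_norm (\<lambda>z. V (t n) z - g z) * L2_norm h' < e/2"
      by (auto simp: eventually_sequentially)
    have "cmod (ip (u (r n)) h - ip v h) < e" if n: "N \<le> n" for n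
    proof -
      define d where "d z = u (r n) z - v z" for z
      have dL: "d \<in> L2" unfolding d_def by (rule L2_diff[OF D(1) vL])
      have dn: "L2_norm d \<le> 2 * M"
        using L2_norm_diff_le[OF D(1)[of "r n"] vL] D(2)[of "r n"] vn unfolding d_def by linarith
      have "ip (u (r n)) h - ip v h = ip d h"
        unfolding d_def by (rule ip_diff_left[OF D(1) vL h, symmetric])
      also have "\<dots> = ip d (c m) - ip d (\<lambda>z. c m z - h z)"
        by (simp add: ip_diff_right[OF dL c(1) h])
      also have "cmod \<dots> \<le> cmod (ip d (c m)) + cmod (ip d (\<lambda>z. c m z - h z))"
        by (rule norm_triangle_ineq4)
      also have "cmod (ip d (c m)) < e/2"
        using ip_Cauchy_Schwarz[OF L2_diff[OF V g(1)] h'L, of "t n"] N[OF n]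
        unfolding d_def eq by linarith
      also have "cmod (ip d (\<lambda>z. c m z - h z)) \<le> (2 * M + 1) * (e / (2 * (2 * M + 1)))"
      proof (rule order_trans[OF ip_Cauchy_Schwarz[OF dL L2_diff[OF c(1) h]]])
        show "L2_norm d * L2_norm (\<lambda>z. c m z - h z) \<le> (2 * M + 1) * (e / (2 * (2 * M + 1)))"
          using m dn D(5) by (intro mult_mono) auto
      qed
      also have "(2 * M + 1) * (e / (2 * (2 * M + 1))) = e / 2"
      proof -
        have *: "x * (e / (2 * x)) = e / 2" if "x \<noteq> 0" for x :: real using that by simp
        show ?thesis by (rule *) (use D(5) in linarith)
      qed
      finally show ?thesis by simp
    qed
    then show "\<exists>no. \<forall>n\<ge>no. norm (ip (u (r n)) h - ip v h) < e" by blast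
  qed
  show ?thesis using that[OF r vL ae weak] .
qed

section \<open>Test functions and the fundamental lemma\<close>

text \<open>The functions \<open>P(1/t) exp(-1/t)\<close>, extended by zero. This family is closed under differentiation,
which gives smoothness by induction.\<close>
definition exp_bump :: "real poly \<Rightarrow> real \<Rightarrow> real" where
  "exp_bump p t = (if 0 < t then poly p (1 / t) * exp (- (1 / t)) else 0)"

text \<open>By the chain rule, \<open>(P(s) exp(-s))' = s\<^sup>2 (P - P')(s) exp(-s)\<close> for \<open>s = 1/t\<close>.\<close>
definition exp_bump_deriv :: "real poly \<Rightarrow> real poly" where
  "exp_bump_deriv p = monom 1 2 * (p - pderiv p)"

lemma poly_div_exp_tendsto_0: "((\<lambda>s. poly p s / exp s) \<longlongrightarrow> (0::real)) at_top"
proof -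
  have "((\<lambda>s. \<Sum>i\<le>degree p. coeff p i * (s^i / exp s)) \<longlongrightarrow> (\<Sum>i\<le>degree p. coeff p i * 0)) at_top"
    by (intro tendsto_intros tendsto_power_div_exp_0)
  moreover have "(\<lambda>s. poly p s / exp s) = (\<lambda>s. \<Sum>i\<le>degree p. coeff p i * (s^i / exp s))"
    by (simp add: poly_altdef sum_divide_distrib fun_eq_iff)
  ultimately show ?thesis by simp
qed

lemma exp_bump_has_derivative:
  "(exp_bump p has_real_derivative exp_bump (exp_bump_deriv p) t) (at t)"
proof -
  consider "0 < t" | "t < 0" | "t = 0" by linarith
  then show ?thesis
  proof cases
    case 1
    have "((\<lambda>t. poly p (1 / t) * exp (- (1 / t))) has_real_derivative
       poly (exp_bump_deriv p) (1 / t) * exp (- (1 / t))) (at t)"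
      using 1 by (auto intro!: derivative_eq_intros DERIV_chain2[OF poly_DERIV]
          simp: exp_bump_deriv_def poly_monom power2_eq_square field_simps)
    then have "(exp_bump p has_real_derivative poly (exp_bump_deriv p) (1 / t) * exp (- (1 / t))) (at t)"
      by (rule DERIV_cong_ev[THEN iffD1, rotated 3])
        (use 1 in \<open>auto simp: exp_bump_def intro: eventually_mono[OF order_tendstoD(1)[OF tendsto_ident_at]] eventually_nhds_top eventually_mono[OF eventually_nhds_in_open[of "{0<..}"]]\<close>)
    then show ?thesis using 1 by (simp add: exp_bump_def)
  next
    case 2
    have "((\<lambda>t. 0) has_real_derivative 0) (at t)" by simp
    then have "(exp_bump p has_real_derivative 0) (at t)"
      by (rule DERIV_cong_ev[THEN iffD1, rotated 3])
        (use 2 in \<open>auto simp: exp_bump_def intro: eventually_mono[OF eventually_nhds_in_open[of "{..<0}"]]\<close>)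
    then show ?thesis using 2 by (simp add: exp_bump_def)
  next
    case 3
    have "((\<lambda>h. exp_bump p h / h) \<longlongrightarrow> 0) (at_right 0)"
    proof -
      have "((\<lambda>h. poly (pCons 0 p) (inverse h) / exp (inverse h)) \<longlongrightarrow> 0) (at_right 0)"
        by (rule filterlim_compose[OF poly_div_exp_tendsto_0 filterlim_inverse_at_top_right])
      moreover have "\<forall>\<^sub>F h in at_right 0. poly (pCons 0 p) (inverse h) / exp (inverse h) = exp_bump p h / h"
        using eventually_at_right_less
        by eventually_elim (simp add: exp_bump_def exp_minus field_simps)
      ultimately show ?thesis by (rule Lim_transform_eventually)
    qed
    moreover have "((\<lambda>h. exp_bump p h / h) \<longlongrightarrow> 0) (at_left 0)"
    proof (rule tendsto_eventually)
      have "\<forall>\<^sub>F h in at_left 0. h < (0::real)" by (simp add: eventually_at_filter)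
      then show "\<forall>\<^sub>F h in at_left 0. exp_bump p h / h = 0"
        by eventually_elim (simp add: exp_bump_def)
    qed
    ultimately have "((\<lambda>h. exp_bump p h / h) \<longlongrightarrow> 0) (at 0)" by (simp add: filterlim_at_split)
    then show ?thesis using 3 by (simp add: DERIV_def exp_bump_def)
  qed
qed

lemma Ck_continuous: "Ck k \<phi> \<Longrightarrow> continuous_on UNIV \<phi>"
  by (cases k) auto

lemma Ck_SucD: "Ck (Suc k) \<phi> \<Longrightarrow> Ck k \<phi>"
proof (induction k arbitrary: \<phi>)
  case 0 then show ?case by simp
next
  case (Suc k)
  obtain \<phi>x \<phi>y where *: "continuous_on UNIV \<phi>" "Ck (Suc k) \<phi>x" "Ck (Suc k) \<phi>y"
    "\<forall>x y. ((\<lambda>s. \<phi> (s, y)) has_vector_derivative \<phi>x (x, y)) (at x) \<and>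
              ((\<lambda>t. \<phi> (x, t)) has_vector_derivative \<phi>y (x, y)) (at y)"
    using Suc.prems unfolding Ck.simps(2)[of "Suc k"] by blast
  show ?case unfolding Ck.simps(2)[of k]
    using *(1,4) Suc.IH[OF *(2)] Suc.IH[OF *(3)] by blast
qed

lemma Ck_const: "Ck k (\<lambda>z. c)"
proof (induction k arbitrary: c)
  case (Suc k)
  show ?case unfolding Ck.simps(2)
    using Suc[of 0] by (intro conjI exI[of _ "\<lambda>z. 0"]) (auto simp: has_vector_derivative_const)
qed simp

lemma Ck_add: "Ck k \<phi> \<Longrightarrow> Ck k \<psi> \<Longrightarrow> Ck k (\<lambda>z. \<phi> z + \<psi> z)"
proof (induction k arbitrary: \<phi> \<psi>)
  case 0 then show ?case by (auto intro: continuous_on_add)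
next
  case (Suc k)
  obtain \<phi>x \<phi>y where *: "continuous_on UNIV \<phi>" "Ck k \<phi>x" "Ck k \<phi>y"
    "\<And>x y. ((\<lambda>s. \<phi> (s, y)) has_vector_derivative \<phi>x (x, y)) (at x)"
    "\<And>x y. ((\<lambda>t. \<phi> (x, t)) has_vector_derivative \<phi>y (x, y)) (at y)"
    using Suc.prems(1) unfolding Ck.simps(2)[of k] by blast
  obtain \<psi>x \<psi>y where **: "continuous_on UNIV \<psi>" "Ck k \<psi>x" "Ck k \<psi>y"
    "\<And>x y. ((\<lambda>s. \<psi> (s, y)) has_vector_derivative \<psi>x (x, y)) (at x)"
    "\<And>x y. ((\<lambda>t. \<psi> (x, t)) has_vector_derivative \<psi>y (x, y)) (at y)"
    using Suc.prems(2) unfolding Ck.simps(2)[of k] by blast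
  show ?case unfolding Ck.simps(2)[of k]
    by (intro conjI exI[of _ "\<lambda>z. \<phi>x z + \<psi>x z"] exI[of _ "\<lambda>z. \<phi>y z + \<psi>y z"] allI
        Suc.IH * ** continuous_on_add has_vector_derivative_add)
qed

lemma Ck_mult: "Ck k \<phi> \<Longrightarrow> Ck k \<psi> \<Longrightarrow> Ck k (\<lambda>z. \<phi> z * \<psi> z)"
proof (induction k arbitrary: \<phi> \<psi>)
  case 0 then show ?case by (auto intro: continuous_on_mult)
next
  case (Suc k)
  obtain \<phi>x \<phi>y where *: "continuous_on UNIV \<phi>" "Ck k \<phi>x" "Ck k \<phi>y"
    "\<And>x y. ((\<lambda>s. \<phi> (s, y)) has_vector_derivative \<phi>x (x, y)) (at x)"
    "\<And>x y. ((\<lambda>t. \<phi> (x, t)) has_vector_derivative \<phi>y (x, y)) (at y)"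
    using Suc.prems(1) unfolding Ck.simps(2)[of k] by blast
  obtain \<psi>x \<psi>y where **: "continuous_on UNIV \<psi>" "Ck k \<psi>x" "Ck k \<psi>y"
    "\<And>x y. ((\<lambda>s. \<psi> (s, y)) has_vector_derivative \<psi>x (x, y)) (at x)"
    "\<And>x y. ((\<lambda>t. \<psi> (x, t)) has_vector_derivative \<psi>y (x, y)) (at y)"
    using Suc.prems(2) unfolding Ck.simps(2)[of k] by blast
  show ?case unfolding Ck.simps(2)[of k]
    by (intro conjI exI[of _ "\<lambda>z. \<phi> z * \<psi>x z + \<phi>x z * \<psi> z"] exI[of _ "\<lambda>z. \<phi> z * \<psi>y z + \<phi>y z * \<psi> z"] allI
        Ck_add Suc.IH Ck_SucD[OF Suc.prems(1)] Ck_SucD[OF Suc.prems(2)] * ** continuous_on_mult has_vector_derivative_mult)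
qed

lemma Ck_shift: "Ck k \<phi> \<Longrightarrow> Ck k (\<lambda>z. \<phi> (z + h))"
proof (induction k arbitrary: \<phi>)
  case 0 then show ?case
    by (auto intro!: continuous_on_compose2[where f="\<lambda>z. z + h" and g=\<phi>] continuous_intros)
next
  case (Suc k)
  obtain \<phi>x \<phi>y where *: "continuous_on UNIV \<phi>" "Ck k \<phi>x" "Ck k \<phi>y"
    "\<And>x y. ((\<lambda>s. \<phi> (s, y)) has_vector_derivative \<phi>x (x, y)) (at x)"
    "\<And>x y. ((\<lambda>t. \<phi> (x, t)) has_vector_derivative \<phi>y (x, y)) (at y)"
    using Suc.prems(1) unfolding Ck.simps(2)[of k] by blast
  have s: "((\<lambda>s. f (s + c)) has_vector_derivative d) (at a)"
    if f: "(f has_vector_derivative d) (at (a + c))" for f :: "real \<Rightarrow> complex" and d a c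
  proof -
    have "((\<lambda>s. s + c) has_vector_derivative 1 + 0) (at a)"
      by (intro has_vector_derivative_add has_vector_derivative_id has_vector_derivative_const)
    then show ?thesis
      using vector_diff_chain_at[of "\<lambda>s. s + c" 1 a f d] f by (simp add: o_def)
  qed
  have cont: "continuous_on UNIV (\<lambda>z. \<phi> (z + h))"
    using *(1) by (auto intro!: continuous_on_compose2[where f="\<lambda>z. z + h" and g=\<phi>] continuous_intros)
  have dx: "((\<lambda>s. \<phi> ((s, y) + h)) has_vector_derivative \<phi>x ((x, y) + h)) (at x)" for x y
    using s[OF *(4)[of "y + snd h" "x + fst h"]] by (simp add: plus_prod_def)
  have dy: "((\<lambda>t. \<phi> ((x, t) + h)) has_vector_derivative \<phi>y ((x, y) + h)) (at y)" for x y
    using s[OF *(5)[of "x + fst h" "y + snd h"]] by (simp add: plus_prod_def)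
  show ?case unfolding Ck.simps(2)[of k]
    by (intro conjI exI[of _ "\<lambda>z. \<phi>x (z + h)"] exI[of _ "\<lambda>z. \<phi>y (z + h)"] allI Suc.IH * cont dx dy)
qed

lemma Ck_exp_bump:
  "Ck k (\<lambda>z. complex_of_real (exp_bump p (a * fst z + b)))"
  "Ck k (\<lambda>z. complex_of_real (exp_bump p (a * snd z + b)))"
proof -
  have cont: "continuous_on UNIV (exp_bump p)" for p
    by (intro continuous_at_imp_continuous_on ballI DERIV_isCont[OF exp_bump_has_derivative])
  have c1: "continuous_on UNIV (\<lambda>z::real\<times>real. complex_of_real (exp_bump p (a * fst z + b)))" for p
    by (intro continuous_intros continuous_on_compose2[OF cont]) auto
  have c2: "continuous_on UNIV (\<lambda>z::real\<times>real. complex_of_real (exp_bump p (a * snd z + b)))" for p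
    by (intro continuous_intros continuous_on_compose2[OF cont]) auto
  have d: "((\<lambda>s. complex_of_real (exp_bump p (a * s + b))) has_vector_derivative
      complex_of_real a * complex_of_real (exp_bump (exp_bump_deriv p) (a * s + b))) (at s)" for p s
  proof -
    have "((\<lambda>s. exp_bump p (a * s + b)) has_real_derivative exp_bump (exp_bump_deriv p) (a * s + b) * a) (at s)"
      by (rule DERIV_chain2[OF exp_bump_has_derivative]) (auto intro!: derivative_eq_intros)
    then show ?thesis
      using has_vector_derivative_of_real by (fastforce simp: has_real_derivative_iff_has_vector_derivative mult.commute)
  qed
  show "Ck k (\<lambda>z. complex_of_real (exp_bump p (a * fst z + b)))"
  proof (induction k arbitrary: p)
    case (Suc k)
    show ?case unfolding Ck.simps(2)[of k]
      by (intro conjI exI[of _ "\<lambda>z. complex_of_real a * complex_of_real (exp_bump (exp_bump_deriv p) (a * fst z + b))"]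
          exI[of _ "\<lambda>z. 0"] allI Ck_mult Ck_const Suc.IH c1) (simp_all add: d)
  qed (simp only: Ck.simps c1)
  show "Ck k (\<lambda>z. complex_of_real (exp_bump p (a * snd z + b)))"
  proof (induction k arbitrary: p)
    case (Suc k)
    show ?case unfolding Ck.simps(2)[of k]
      by (intro conjI exI[of _ "\<lambda>z. complex_of_real a * complex_of_real (exp_bump (exp_bump_deriv p) (a * snd z + b))"]
          exI[of _ "\<lambda>z. 0"] allI Ck_mult Ck_const Suc.IH c2) (simp_all add: d)
  qed (simp only: Ck.simps c2)
qed

text \<open>With \<open>N = n + 1\<close>, the arguments of the two factors are \<open>N (N (t - a) + 1)\<close> and \<open>N (N (b - t) - 1)\<close>.
Both tend to infinity exactly for \<open>a \<le> t < b\<close>, and elsewhere one of them is eventually not positive: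
the limit is the indicator function of the half-open interval, at its end points too.\<close>
definition interval_bump :: "nat \<Rightarrow> real \<Rightarrow> real \<Rightarrow> real \<Rightarrow> real" where
  "interval_bump n a b t = exp_bump 1 (real (Suc n)^2 * t + (real (Suc n) - real (Suc n)^2 * a)) *
     exp_bump 1 (- (real (Suc n)^2) * t + (real (Suc n)^2 * b - real (Suc n)))"

lemma exp_bump_1_bounds: "0 \<le> exp_bump 1 t" "exp_bump 1 t \<le> 1"
  by (auto simp: exp_bump_def)

lemma interval_bump_bounds: "0 \<le> interval_bump n a b t" "interval_bump n a b t \<le> 1"
  unfolding interval_bump_def using exp_bump_1_bounds by (simp_all add: mult_le_one)

lemma interval_bump_support: "t \<notin> {a - 1..b} \<Longrightarrow> interval_bump n a b t = 0"
proof -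
  define N where "N = real (Suc n)"
  have N: "1 \<le> N" by (simp add: N_def)
  have "exp_bump 1 (N^2 * t + (N - N^2 * a)) = 0" if "t < a - 1"
  proof -
    have "N^2 * (t - a) \<le> N^2 * (- 1)" using that N by (intro mult_left_mono) auto
    moreover have "N \<le> N^2" using N by (simp add: power2_eq_square)
    ultimately show ?thesis by (simp add: exp_bump_def right_diff_distrib)
  qed
  moreover have "exp_bump 1 (- (N^2) * t + (N^2 * b - N)) = 0" if "b < t"
  proof -
    have "N^2 * b \<le> N^2 * t" using that N by (intro mult_left_mono) auto
    then have "\<not> 0 < - (N^2) * t + (N^2 * b - N)" using N by linarith
    then show ?thesis by (simp only: exp_bump_def if_False)
  qed
  moreover assume "t \<notin> {a - 1..b}"
  ultimately show ?thesis unfolding interval_bump_def N_def[symmetric] by (cases "t < a - 1") auto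
qed

lemma exp_bump_1_tendsto: "filterlim x at_top F \<Longrightarrow> ((\<lambda>n. exp_bump 1 (x n)) \<longlongrightarrow> 1) F"
proof -
  assume x: "filterlim x at_top F"
  have "((\<lambda>n. exp (- inverse (x n))) \<longlongrightarrow> exp (- 0)) F"
    by (intro tendsto_intros tendsto_inverse_0_at_top x)
  moreover have "\<forall>\<^sub>F n in F. exp (- inverse (x n)) = exp_bump 1 (x n)"
    using x unfolding filterlim_at_top_dense by (auto elim!: eventually_mono[OF spec[of _ 0]] simp: exp_bump_def inverse_eq_divide)
  ultimately show ?thesis by (simp add: Lim_transform_eventually)
qed

lemma interval_bump_tendsto:
  "(\<lambda>n. interval_bump n a b t) \<longlonglongrightarrow> (if a \<le> t \<and> t < b then 1 else 0)"
proof -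
  define N where "N n = real (Suc n)" for n
  have N: "filterlim N at_top sequentially"
    unfolding N_def by (intro filterlim_compose[OF filterlim_real_sequentially] filterlim_Suc)
  have lim_pos: "filterlim (\<lambda>n. N n * (N n * c + 1)) at_top sequentially" if "0 \<le> c" for c
  proof (rule filterlim_at_top_mono[OF N])
    show "\<forall>\<^sub>F n in sequentially. N n \<le> N n * (N n * c + 1)"
      using that by (intro always_eventually allI) (simp add: N_def)
  qed
  have lim_pos': "filterlim (\<lambda>n. N n * (N n * c - 1)) at_top sequentially" if "0 < c" for c
  proof -
    have "filterlim (\<lambda>n. - 1 + N n * c) at_top sequentially"
      by (rule filterlim_tendsto_add_at_top[OF tendsto_const filterlim_at_top_mult_tendsto_pos[OF tendsto_const that N]])
    then have "filterlim (\<lambda>n. N n * (- 1 + N n * c)) at_top sequentially"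
      by (rule filterlim_at_top_mult_at_top[OF N])
    then show ?thesis by (simp add: algebra_simps)
  qed
  have eq: "interval_bump n a b t = exp_bump 1 (N n * (N n * (t - a) + 1)) * exp_bump 1 (N n * (N n * (b - t) - 1))" for n
    unfolding interval_bump_def N_def by (intro arg_cong2[where f=times] arg_cong[where f="exp_bump 1"])
      (simp_all add: algebra_simps power2_eq_square)
  consider "a \<le> t" "t < b" | "t < a" | "b \<le> t" by linarith
  then show ?thesis
  proof cases
    case 1
    have "(\<lambda>n. interval_bump n a b t) \<longlonglongrightarrow> 1 * 1"
      unfolding eq using 1 by (intro tendsto_mult exp_bump_1_tendsto lim_pos lim_pos') auto
    then show ?thesis using 1 by simp
  next
    case 2
    have "\<forall>\<^sub>F n in sequentially. interval_bump n a b t = 0"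
    proof -
      have "\<forall>\<^sub>F n in sequentially. N n > 1 / (a - t)" using N unfolding filterlim_at_top_dense by blast
      then show ?thesis
      proof eventually_elim
        case (elim n)
        then have "1 < N n * (a - t)" using 2 by (simp add: pos_divide_less_eq)
        then have "N n * (t - a) + 1 < 0" by (simp add: algebra_simps)
        then have "N n * (N n * (t - a) + 1) \<le> 0" by (simp add: N_def mult_nonneg_nonpos)
        then show ?case unfolding eq by (simp add: exp_bump_def)
      qed
    qed
    then show ?thesis using 2 by (simp add: tendsto_eventually)
  next
    case 3
    have "interval_bump n a b t = 0" for n
    proof -
      have "N n * (b - t) \<le> 0" using 3 by (simp add: N_def mult_nonneg_nonpos)
      then have "N n * (N n * (b - t) - 1) \<le> 0" by (simp add: N_def mult_nonneg_nonpos)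
      then show ?thesis unfolding eq by (simp add: exp_bump_def)
    qed
    then show ?thesis using 3 by simp
  qed
qed

definition box_bump :: "nat \<Rightarrow> real \<Rightarrow> real \<Rightarrow> real \<Rightarrow> real \<Rightarrow> plane_fun" where
  "box_bump n a b c d z = complex_of_real (interval_bump n a b (fst z)) * complex_of_real (interval_bump n c d (snd z))"

lemma box_bump_test: "box_bump n a b c d \<in> test_functions"
proof -
  have "Ck k (box_bump n a b c d)" for k
    unfolding box_bump_def[abs_def] interval_bump_def of_real_mult by (intro Ck_mult Ck_exp_bump)
  moreover have "compact (closure {z. box_bump n a b c d z \<noteq> 0})"
  proof -
    have "{z. box_bump n a b c d z \<noteq> 0} \<subseteq> cbox (a - 1, c - 1) (b, d)"
      using interval_bump_support[of _ a b n] interval_bump_support[of _ c d n]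
      by (fastforce simp: box_bump_def cbox_Pair_eq)
    then have "bounded {z. box_bump n a b c d z \<noteq> 0}" using bounded_cbox bounded_subset by blast
    then show ?thesis by (simp add: compact_closure)
  qed
  ultimately show ?thesis by (simp add: test_functions_def)
qed

lemma box_bump_tendsto_cell_ind:
  obtains a b c d where "\<And>w. (\<lambda>n. box_bump n a b c d w) \<longlonglongrightarrow> cell_ind k z w"
proof -
  let ?a = "\<lfloor>2^k * fst z\<rfloor> / 2^k" and ?b = "(\<lfloor>2^k * fst z\<rfloor> + 1) / 2^k"
  let ?c = "\<lfloor>4^k * snd z\<rfloor> / 4^k" and ?d = "(\<lfloor>4^k * snd z\<rfloor> + 1) / 4^k"
  have "(\<lambda>n. box_bump n ?a ?b ?c ?d w) \<longlonglongrightarrow> cell_ind k z w" for w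
  proof -
    have "(\<lambda>n. box_bump n ?a ?b ?c ?d w) \<longlonglongrightarrow>
      complex_of_real (if ?a \<le> fst w \<and> fst w < ?b then 1 else 0) * complex_of_real (if ?c \<le> snd w \<and> snd w < ?d then 1 else 0)"
      unfolding box_bump_def by (intro tendsto_mult tendsto_of_real interval_bump_tendsto)
    moreover have "complex_of_real (if ?a \<le> fst w \<and> fst w < ?b then 1 else 0) *
        complex_of_real (if ?c \<le> snd w \<and> snd w < ?d then 1 else 0) = cell_ind k z w"
      unfolding cell_ind_def dyadic_cell_eq_iff by (cases w) auto
    ultimately show ?thesis by (simp only:)
  qed
  then show ?thesis using that by blast
qed

lemma avg_tendsto:
  assumes g: "g \<in> L2" and e: "0 < e"
  obtains k where "L2_norm (\<lambda>z. g z - avg k g z) \<le> e"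
proof -
  have "\<exists>k. \<forall>h. \<bar>fst h\<bar> \<le> 1 / 2^k \<longrightarrow> \<bar>snd h\<bar> \<le> 1 / 4^k \<longrightarrow> L2_norm (\<lambda>z. tau h g z - g z) \<le> e/2"
  proof (rule ccontr)
    assume "\<not> ?thesis"
    then obtain h where h: "\<And>k. \<bar>fst (h k)\<bar> \<le> 1 / 2^k" "\<And>k. \<bar>snd (h k)\<bar> \<le> 1 / 4^k"
      "\<And>k. e/2 < L2_norm (\<lambda>z. tau (h k) g z - g z)"
      unfolding not_ex not_all not_imp not_le by metis
    have "(\<lambda>k. fst (h k)) \<longlonglongrightarrow> 0"
    proof (rule Lim_null_comparison)
      show "(\<lambda>k. (1/2)^k) \<longlonglongrightarrow> (0::real)" by (rule LIMSEQ_power_zero) simp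
    qed (use h(1) in \<open>simp add: power_one_over\<close>)
    moreover have "(\<lambda>k. snd (h k)) \<longlonglongrightarrow> 0"
    proof (rule Lim_null_comparison)
      show "(\<lambda>k. (1/4)^k) \<longlonglongrightarrow> (0::real)" by (rule LIMSEQ_power_zero) simp
    qed (use h(2) in \<open>simp add: power_one_over\<close>)
    ultimately have "(\<lambda>k. (fst (h k), snd (h k))) \<longlonglongrightarrow> (0, 0)" by (rule tendsto_Pair)
    then have "h \<longlonglongrightarrow> 0" by (simp add: zero_prod_def)
    from tau_continuous[OF g this] have "\<forall>\<^sub>F k in sequentially. L2_norm (\<lambda>z. tau (h k) g z - g z) < e/2"
      using e by (intro order_tendstoD(2)) auto
    then show False using h(3) by (auto simp: eventually_sequentially intro: less_asym)
  qed
  then obtain k where k: "\<And>h. \<bar>fst h\<bar> \<le> 1 / 2^k \<Longrightarrow> \<bar>snd h\<bar> \<le> 1 / 4^k \<Longrightarrow> L2_norm (\<lambda>z. tau h g z - g z) \<le> e/2"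
    by blast
  have "L2_norm (\<lambda>z. g z - avg k g z) \<le> 2 * (e / 2)"
    by (rule dyadic_Poincare(2)[OF g]) (rule k)
  then show ?thesis using that[of k] by simp
qed

text \<open>Indicators of dyadic boxes are dominated limits of test functions, so all averages of \<open>g\<close> vanish, and
\<open>g\<close> is the limit of its averages.\<close>
lemma fundamental_lemma:
  assumes g: "g \<in> L2" and 0: "\<And>\<phi>. \<phi> \<in> test_functions \<Longrightarrow> (LINT z|lborel. g z * \<phi> z) = 0"
  shows "AE z in lborel. g z = 0"
proof -
  have [measurable]: "g \<in> borel_measurable borel" using g by auto
  have avg0: "avg k g z = 0" for k z
  proof -
    obtain a b c d where lim: "\<And>w. (\<lambda>n. box_bump n a b c d w) \<longlonglongrightarrow> cell_ind k z w"
      by (rule box_bump_tendsto_cell_ind[of k z]) (rule that)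
    have bm [measurable]: "box_bump n a b c d \<in> borel_measurable borel" for n
      using box_bump_test[of n a b c d] Ck_continuous[of 0 "box_bump n a b c d"]
      by (intro borel_measurable_continuous_onI) (auto simp: test_functions_def)
    have supp: "cmod (box_bump n a b c d w) \<le> indicator (cbox (a - 1, c - 1) (b, d)) w" for n w
    proof (cases "w \<in> cbox (a - 1, c - 1) (b, d)")
      case True
      then show ?thesis using interval_bump_bounds
        by (auto simp: box_bump_def norm_mult intro!: mult_le_one)
    next
      case False
      then have "fst w \<notin> {a - 1..b} \<or> snd w \<notin> {c - 1..d}" by (cases w) (auto simp: cbox_Pair_eq)
      then show ?thesis using interval_bump_support by (auto simp: box_bump_def)
    qed
    define w where "w z = (indicator (cbox (a - 1, c - 1) (b, d)) z :: real)" for z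
    have wi: "integrable lborel (\<lambda>z. (w z)\<^sup>2)"
    proof -
      have "(\<lambda>z. (w z)\<^sup>2) = (\<lambda>z. indicator (cbox (a - 1, c - 1) (b, d)) z)" by (auto simp: w_def indicator_def)
      then show ?thesis using emeasure_lborel_cbox_finite[of "(a - 1, c - 1)" "(b, d)"] by (simp add: integrable_indicator_iff)
    qed
    note B = L2_dominated[where w=w, OF bm cell_ind_measurable wi supp[folded w_def] AE_I2[OF lim]]
    have "(\<lambda>n. ip g (box_bump n a b c d)) \<longlonglongrightarrow> ip g (cell_ind k z)"
      using g B L2_zero by (intro L2_tendsto_ip[where f="\<lambda>n. g"]) (auto simp: L2_norm_def)
    moreover have "ip g (box_bump n a b c d) = 0" for n
    proof -
      have "ip g (box_bump n a b c d) = (LINT z|lborel. g z * box_bump n a b c d z)"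
        by (simp add: ip_def box_bump_def)
      then show ?thesis using 0[OF box_bump_test] by simp
    qed
    ultimately have "ip g (cell_ind k z) = 0" by (simp add: LIMSEQ_const_iff)
    then show ?thesis by (simp add: avg_def)
  qed
  have "L2_norm g \<le> e" if "0 < e" for e
    using avg_tendsto[OF g that] avg0 by auto
  then have "L2_norm g = 0" using L2_norm_nonneg[of g] by (metis order_antisym field_le_epsilon add_0)
  then show ?thesis using L2_norm_zero_iff[OF g] by simp
qed

section \<open>The weak derivative on the Fourier side\<close>

lemma has_vector_derivative_seqI:
  fixes f :: "real \<Rightarrow> complex"
  assumes "\<And>t. t \<longlonglongrightarrow> 0 \<Longrightarrow> (\<And>n. t n \<noteq> 0) \<Longrightarrow> (\<lambda>n. (f (x + t n) - f x) / complex_of_real (t n)) \<longlonglongrightarrow> D"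
  shows "(f has_vector_derivative D) (at x)"
proof -
  have "((\<lambda>h. norm (f (x + h) - f x - h *\<^sub>R D) / norm h) \<longlongrightarrow> 0) (at 0)"
    unfolding tendsto_at_iff_sequentially
  proof (intro allI impI)
    fix t :: "nat \<Rightarrow> real" assume t: "\<forall>i. t i \<in> UNIV - {0}" "t \<longlonglongrightarrow> 0"
    have "(\<lambda>n. (f (x + t n) - f x) / complex_of_real (t n) - D) \<longlonglongrightarrow> D - D"
      by (intro tendsto_intros assms) (use t in auto)
    then have "(\<lambda>n. norm ((f (x + t n) - f x) / complex_of_real (t n) - D)) \<longlonglongrightarrow> 0"
      by (intro tendsto_norm_zero) simp
    moreover have "norm ((f (x + t n) - f x) / complex_of_real (t n) - D) = norm (f (x + t n) - f x - t n *\<^sub>R D) / norm (t n)" for n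
    proof -
      have "(f (x + t n) - f x) / complex_of_real (t n) - D = (f (x + t n) - f x - t n *\<^sub>R D) / complex_of_real (t n)"
        using t(1) by (simp add: scaleR_conv_of_real diff_divide_distrib)
      then show ?thesis by (simp add: norm_divide)
    qed
    ultimately show "((\<lambda>h. norm (f (x + h) - f x - h *\<^sub>R D) / norm h) \<circ> t) \<longlonglongrightarrow> 0"
      by (simp add: o_def)
  qed
  then show ?thesis
    unfolding has_vector_derivative_def has_derivative_at by (simp add: bounded_linear_scaleR_left)
qed

lemma has_vector_derivative_seqD:
  fixes f :: "real \<Rightarrow> complex"
  assumes "(f has_vector_derivative D) (at x)" "t \<longlonglongrightarrow> 0" "\<And>n. t n \<noteq> 0"
  shows "(\<lambda>n. (f (x + t n) - f x) / complex_of_real (t n)) \<longlonglongrightarrow> D"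
proof -
  have "((\<lambda>h. norm (f (x + h) - f x - h *\<^sub>R D) / norm h) \<longlongrightarrow> 0) (at 0)"
    using assms(1) unfolding has_vector_derivative_def has_derivative_at by blast
  then have "((\<lambda>h. norm (f (x + h) - f x - h *\<^sub>R D) / norm h) \<circ> t) \<longlonglongrightarrow> 0"
    using assms(2,3) unfolding tendsto_at_iff_sequentially by blast
  moreover have "norm ((f (x + t n) - f x) / complex_of_real (t n) - D) = norm (f (x + t n) - f x - t n *\<^sub>R D) / norm (t n)" for n
  proof -
    have "(f (x + t n) - f x) / complex_of_real (t n) - D = (f (x + t n) - f x - t n *\<^sub>R D) / complex_of_real (t n)"
      using assms(3) by (simp add: scaleR_conv_of_real diff_divide_distrib)
    then show ?thesis by (simp add: norm_divide)
  qed
  ultimately have "(\<lambda>n. norm ((f (x + t n) - f x) / complex_of_real (t n) - D)) \<longlonglongrightarrow> 0"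
    by (simp add: o_def)
  then have "(\<lambda>n. (f (x + t n) - f x) / complex_of_real (t n) - D) \<longlonglongrightarrow> 0"
    by (rule tendsto_norm_zero_cancel)
  then show ?thesis by (simp add: LIM_zero_iff)
qed

lemma cmod_cis_minus_1: "cmod (cis y - 1) \<le> \<bar>y\<bar>"
  using iexp_approx1[of y 0] by (simp add: cis_conv_exp mult.commute)

lemma cis_difference_quotient:
  assumes "t \<longlonglongrightarrow> 0" "\<And>n. t n \<noteq> (0::real)"
  shows "(\<lambda>n. (cis (t n * a) - 1) / complex_of_real (t n)) \<longlonglongrightarrow> \<i> * complex_of_real a"
proof -
  have "((\<lambda>s. exp (s *\<^sub>R (\<i> * complex_of_real a))) has_vector_derivative exp (0 *\<^sub>R (\<i> * complex_of_real a)) * (\<i> * complex_of_real a)) (at 0)"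
    by (rule exp_scaleR_has_vector_derivative_right)
  from has_vector_derivative_seqD[OF this assms]
  show ?thesis by (simp add: cis_conv_exp scaleR_conv_of_real ac_simps)
qed

lemma test_function_dx:
  assumes "\<phi> \<in> test_functions"
  shows "((\<lambda>s. \<phi> (s, y)) has_vector_derivative classical_dx \<phi> (x, y)) (at x)"
    and "continuous_on UNIV (classical_dx \<phi>)"
proof -
  have "Ck 1 \<phi>" using assms by (simp add: test_functions_def)
  then obtain \<phi>x where *: "continuous_on UNIV \<phi>x"
    "\<And>x y. ((\<lambda>s. \<phi> (s, y)) has_vector_derivative \<phi>x (x, y)) (at x)"
    by (auto simp: numeral_eq_Suc)
  have eq: "classical_dx \<phi> = \<phi>x"
    unfolding classical_dx_def using vector_derivative_at[OF *(2)] by (auto simp: fun_eq_iff)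
  show "((\<lambda>s. \<phi> (s, y)) has_vector_derivative classical_dx \<phi> (x, y)) (at x)"
    "continuous_on UNIV (classical_dx \<phi>)"
    unfolding eq by (rule *)+
qed

lemma test_function_continuous: "\<phi> \<in> test_functions \<Longrightarrow> continuous_on UNIV \<phi>"
  unfolding test_functions_def using Ck_continuous by blast

lemma test_function_support:
  assumes "\<phi> \<in> test_functions"
  obtains R where "\<And>z. R < norm z \<Longrightarrow> \<phi> z = 0"
proof -
  have "bounded (closure {z. \<phi> z \<noteq> 0})" using assms by (simp add: test_functions_def compact_imp_bounded)
  then have "bounded {z. \<phi> z \<noteq> 0}" using bounded_subset closure_subset by blast
  then obtain R where "\<And>z. \<phi> z \<noteq> 0 \<Longrightarrow> norm z \<le> R" unfolding bounded_iff by blast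
  then show ?thesis using that by (meson not_le)
qed

lemma test_function_tau: assumes "\<phi> \<in> test_functions" shows "tau h \<phi> \<in> test_functions"
proof -
  obtain R where R: "\<And>z. R < norm z \<Longrightarrow> \<phi> z = 0" using test_function_support[OF assms] by blast
  have "{z. tau h \<phi> z \<noteq> 0} \<subseteq> cball 0 (R + norm h)"
  proof
    fix z assume "z \<in> {z. tau h \<phi> z \<noteq> 0}"
    then have "norm (z + h) \<le> R" using R[of "z + h"] by (auto simp: tau_def not_less[symmetric])
    then show "z \<in> cball 0 (R + norm h)" using norm_triangle_ineq4[of "z + h" h] by simp
  qed
  then have "bounded {z. tau h \<phi> z \<noteq> 0}" using bounded_cball bounded_subset by blast
  then show ?thesis using assms by (simp add: test_functions_def tau_def Ck_shift compact_closure)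
qed

lemma classical_dx_tau: assumes "\<phi> \<in> test_functions" shows "classical_dx (tau h \<phi>) z = classical_dx \<phi> (z + h)"
proof -
  have d: "((\<lambda>s. s + fst h) has_vector_derivative 1 + 0) (at (fst z))"
    by (intro has_vector_derivative_add has_vector_derivative_id has_vector_derivative_const)
  have "((\<lambda>s. \<phi> (s + fst h, snd z + snd h)) has_vector_derivative classical_dx \<phi> (fst z + fst h, snd z + snd h)) (at (fst z))"
    using vector_diff_chain_at[of "\<lambda>s. s + fst h" 1 "fst z" "\<lambda>s. \<phi> (s, snd z + snd h)"] d test_function_dx(1)[OF assms]
    by (simp add: o_def)
  then have "((\<lambda>s. tau h \<phi> (s, snd z)) has_vector_derivative classical_dx \<phi> (z + h)) (at (fst z))"
    by (simp add: tau_def plus_prod_def)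
  then show ?thesis unfolding classical_dx_def[of "tau h \<phi>"] by (rule vector_derivative_at)
qed

lemma continuous_compact_support_L2:
  assumes "continuous_on UNIV g" "\<And>z. R < norm z \<Longrightarrow> g z = 0" shows "g \<in> L2"
proof -
  have [measurable]: "g \<in> borel_measurable borel" using assms(1) by (rule borel_measurable_continuous_onI)
  have "compact (g ` cball 0 R)"
    by (intro compact_continuous_image continuous_on_subset[OF assms(1)]) auto
  then obtain M where M: "\<And>z. z \<in> cball 0 R \<Longrightarrow> cmod (g z) \<le> M"
    using compact_imp_bounded bounded_iff by (metis imageI)
  have "integrable lborel (\<lambda>z::real\<times>real. M^2 * indicator (cball 0 R) z)"
    by (simp add: integrable_indicator_ball)
  then show ?thesis
  proof (rule L2I_bound[rotated])
    show "AE z in lborel. (cmod (g z))\<^sup>2 \<le> M\<^sup>2 * indicator (cball 0 R) z"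
    proof (rule AE_I2)
      fix z show "(cmod (g z))\<^sup>2 \<le> M\<^sup>2 * indicator (cball 0 R) z"
        using M[of z] assms(2)[of z] by (cases "norm z \<le> R") (auto simp: indicator_def intro: power_mono)
    qed
  qed measurable
qed

lemma test_function_L2: assumes "\<phi> \<in> test_functions" shows "\<phi> \<in> L2"
proof -
  obtain R where "\<And>z. R < norm z \<Longrightarrow> \<phi> z = 0" using test_function_support[OF assms] by blast
  then show ?thesis by (rule continuous_compact_support_L2[OF test_function_continuous[OF assms]])
qed

text \<open>The translation is moved to the test function, whose difference quotients converge boundedly on a
fixed ball.\<close>
lemma tau_difference_quotient_test:
  assumes u: "u \<in> L2" and \<phi>: "\<phi> \<in> test_functions" and t: "t \<longlonglongrightarrow> 0" "\<And>n. t n \<noteq> (0::real)"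
  shows "(\<lambda>n. (ip (tau (t n, 0) u) (\<lambda>z. cnj (\<phi> z)) - ip u (\<lambda>z. cnj (\<phi> z))) / complex_of_real (t n))
    \<longlonglongrightarrow> - (LINT z|lborel. u z * classical_dx \<phi> z)"
proof -
  note \<phi>L = test_function_L2[OF \<phi>]
  have m [measurable]: "\<phi> \<in> borel_measurable borel" using \<phi>L by auto
  have dm [measurable]: "classical_dx \<phi> \<in> borel_measurable borel"
    using test_function_dx(2)[OF \<phi>] by (rule borel_measurable_continuous_onI)
  obtain R where R: "\<And>z. R < norm z \<Longrightarrow> \<phi> z = 0" using test_function_support[OF \<phi>] by blast
  have "Bseq t" using t(1) by (simp add: convergentI convergent_imp_Bseq del: Bseq_eq_bounded)
  then obtain B where B: "\<And>n. norm (t n) \<le> B" by (metis BseqE)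
  have "compact (classical_dx \<phi> ` cball 0 (R + 2 * B))"
    by (intro compact_continuous_image continuous_on_subset[OF test_function_dx(2)[OF \<phi>]]) auto
  then obtain C0 where C0: "\<And>z. z \<in> cball 0 (R + 2 * B) \<Longrightarrow> cmod (classical_dx \<phi> z) \<le> C0"
    using compact_imp_bounded bounded_iff by (metis imageI)
  define C where "C = max 0 C0"
  have C: "cmod (classical_dx \<phi> z) \<le> C" if "norm z \<le> R + 2 * B" for z
    using C0[of z] that by (simp add: C_def)
  define Q where "Q n z = (cnj (\<phi> (z + (- t n, 0))) - cnj (\<phi> z)) / complex_of_real (t n)" for n z
  have Qm: "Q n \<in> borel_measurable borel" for n unfolding Q_def by measurable
  have Qb: "cmod (Q n z) \<le> C * indicator (cball 0 (R + B)) z" for n z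
  proof (cases "norm z \<le> R + B")
    case True
    obtain x y where z: "z = (x, y)" by (cases z)
    let ?S = "closed_segment x (x - t n)"
    have "norm (\<phi> (x - t n, y) - \<phi> (x, y)) \<le> C * norm ((x - t n) - x)"
    proof (rule differentiable_bound[of ?S])
      fix s assume s: "s \<in> ?S"
      show "((\<lambda>s. \<phi> (s, y)) has_derivative (\<lambda>h. h *\<^sub>R classical_dx \<phi> (s, y))) (at s within ?S)"
        using test_function_dx(1)[OF \<phi>, of y s] unfolding has_vector_derivative_def
        by (rule has_derivative_at_withinI)
      show "onorm (\<lambda>h. h *\<^sub>R classical_dx \<phi> (s, y)) \<le> C"
      proof (rule onorm_bound)
        have "\<bar>s - x\<bar> \<le> \<bar>t n\<bar>" using s by (auto simp: closed_segment_eq_real_ivl split: if_splits)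
        then have "\<bar>s - x\<bar> \<le> B" using B[of n] by simp
        moreover have "norm (s, y) \<le> norm (x, y) + norm (s - x, 0 :: real)"
          using norm_triangle_ineq[of "(x, y)" "(s - x, 0)"] by simp
        ultimately have "norm (s, y) \<le> R + 2 * B" using True z by (simp add: norm_Pair)
        then have "cmod (classical_dx \<phi> (s, y)) \<le> C" by (rule C)
        from mult_right_mono[OF this abs_ge_zero]
        show "norm (h *\<^sub>R classical_dx \<phi> (s, y)) \<le> C * norm h" for h :: real
          by (simp add: mult.commute)
      qed (simp add: C_def)
    qed auto
    then have "cmod (cnj (\<phi> (x - t n, y)) - cnj (\<phi> (x, y))) \<le> C * \<bar>t n\<bar>"
      by (simp flip: complex_cnj_diff)
    then have "cmod (Q n z) \<le> C"
      using t(2)[of n] by (simp add: Q_def z norm_divide divide_le_eq)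
    then show ?thesis using True by (simp add: indicator_def)
  next
    case False
    have "norm z \<le> norm (z + (- t n, 0)) + norm (t n, 0 :: real)"
      using norm_triangle_ineq[of "z + (- t n, 0)" "(t n, 0)"] by (simp add: add.assoc flip: zero_prod_def)
    then have "norm z \<le> norm (z + (- t n, 0)) + B" using B[of n] by (simp add: norm_Pair)
    moreover have "0 \<le> B" using B[of 0] norm_ge_zero[of "t 0"] by linarith
    ultimately have "R < norm (z + (- t n, 0))" "R < norm z" using False by linarith+
    then show ?thesis using R False by (simp add: Q_def)
  qed
  have wi: "integrable lborel (\<lambda>z::real\<times>real. (C * indicator (cball 0 (R + B)) z)\<^sup>2)"
  proof -
    have "(\<lambda>z::real\<times>real. (C * indicator (cball 0 (R + B)) z)\<^sup>2) = (\<lambda>z. C\<^sup>2 * indicator (cball 0 (R + B)) z)"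
      by (auto simp: fun_eq_iff indicator_def)
    then show ?thesis by (simp add: integrable_indicator_ball)
  qed
  define P where "P z = - cnj (classical_dx \<phi> z)" for z
  have Pm: "P \<in> borel_measurable borel" unfolding P_def by measurable
  have lim: "(\<lambda>n. Q n z) \<longlonglongrightarrow> P z" for z
  proof -
    obtain x y where z: "z = (x, y)" by (cases z)
    have "(\<lambda>n. (\<phi> (x + - t n, y) - \<phi> (x, y)) / complex_of_real (- t n)) \<longlonglongrightarrow> classical_dx \<phi> (x, y)"
      using test_function_dx(1)[OF \<phi>] by (rule has_vector_derivative_seqD) (use tendsto_minus[OF t(1)] t(2) in auto)
    then have "(\<lambda>n. - cnj ((\<phi> (x + - t n, y) - \<phi> (x, y)) / complex_of_real (- t n))) \<longlonglongrightarrow> - cnj (classical_dx \<phi> (x, y))"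
      by (intro tendsto_intros)
    then show ?thesis by (simp add: Q_def P_def z)
  qed
  (* Q n is the difference quotient of the conjugated test function in the direction - t n *)
  note QQ = L2_dominated[OF Qm Pm wi Qb AE_I2[OF lim]]
  have "(\<lambda>n. ip u (Q n)) \<longlonglongrightarrow> ip u P"
    using u QQ L2_zero by (intro L2_tendsto_ip[where f="\<lambda>n. u"]) (auto simp: L2_norm_def)
  moreover have "ip u P = - (LINT z|lborel. u z * classical_dx \<phi> z)"
    by (simp add: ip_def P_def)
  moreover have "ip u (Q n) = (ip (tau (t n, 0) u) (\<lambda>z. cnj (\<phi> z)) - ip u (\<lambda>z. cnj (\<phi> z))) / complex_of_real (t n)" for n
  proof -
    have c: "(\<lambda>z. cnj (\<phi> z)) \<in> L2" using \<phi>L by auto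
    have "ip u (Q n) = ip u (\<lambda>z. complex_of_real (1 / t n) * (tau (- (t n, 0)) (\<lambda>z. cnj (\<phi> z)) z - cnj (\<phi> z)))"
      by (rule arg_cong[where f="ip u"]) (simp add: Q_def[abs_def] tau_def fun_eq_iff)
    also have "\<dots> = complex_of_real (1 / t n) * (ip u (tau (- (t n, 0)) (\<lambda>z. cnj (\<phi> z))) - ip u (\<lambda>z. cnj (\<phi> z)))"
      by (simp only: ip_cmult_right ip_diff_right[OF u tau_L2[OF c] c] complex_cnj_complex_of_real)
    finally show ?thesis by (simp add: ip_tau_left[OF u c])
  qed
  ultimately show ?thesis by simp
qed

lemma L2_bounded_mult:
  assumes "w \<in> L2" "a \<in> borel_measurable borel" "\<And>z. cmod (a z) \<le> c"
  shows "(\<lambda>z. a z * w z) \<in> L2"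
proof (rule L2_bound[OF assms(1), where c=c])
  have [measurable]: "w \<in> borel_measurable borel" "a \<in> borel_measurable borel" using assms by auto
  show "(\<lambda>z. a z * w z) \<in> borel_measurable borel" by measurable
  show "cmod (a z * w z) \<le> c * cmod (w z)" for z
    unfolding norm_mult by (rule mult_right_mono[OF assms(3)]) simp
qed

lemma has_fourier_tau_x:
  "has_fourier u w \<Longrightarrow> has_fourier (tau (s, 0) u) (\<lambda>\<zeta>. cis (s * fst \<zeta>) * w \<zeta>)"
  using has_fourier_tau[of u w "(s, 0)"] by (simp add: inner_prod_def)

text \<open>The integral of \<open>cis (r \<xi>)\<close> over \<open>r\<close> from \<open>0\<close> to \<open>s\<close>. Unlike \<open>\<i>\<xi>\<close> it is a bounded multiplier, and
\<open>cis (s \<xi>) - 1 = \<i>\<xi>\<close> times it.\<close>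
definition cis_primitive :: "real \<Rightarrow> real \<times> real \<Rightarrow> complex" where
  "cis_primitive s \<zeta> = (if fst \<zeta> = 0 then complex_of_real s else (cis (s * fst \<zeta>) - 1) / (\<i> * complex_of_real (fst \<zeta>)))"

lemma cis_primitive_measurable [measurable]: "cis_primitive s \<in> borel_measurable borel"
  unfolding cis_primitive_def[abs_def] by measurable

lemma cis_primitive_bound: "cmod (cis_primitive s \<zeta>) \<le> \<bar>s\<bar>"
  using cmod_cis_minus_1[of "s * fst \<zeta>"]
  by (auto simp: cis_primitive_def norm_divide norm_mult abs_mult divide_le_eq)

lemma cis_primitive_add: "cis_primitive (s + t) \<zeta> = cis_primitive s \<zeta> + cis (s * fst \<zeta>) * cis_primitive t \<zeta>"
  by (auto simp: cis_primitive_def distrib_right cis_mult[symmetric] add_divide_distrib[symmetric] field_simps)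

lemma cis_primitive_0 [simp]: "cis_primitive 0 \<zeta> = 0"
  by (simp add: cis_primitive_def)

lemma cis_primitive_tendsto:
  assumes t: "t \<longlonglongrightarrow> 0" "\<And>n. t n \<noteq> 0"
  shows "(\<lambda>n. cis_primitive (t n) \<zeta> / complex_of_real (t n)) \<longlonglongrightarrow> 1"
proof (cases "fst \<zeta> = 0")
  case True then show ?thesis using t by (simp add: cis_primitive_def)
next
  case False
  have "(\<lambda>n. ((cis (t n * fst \<zeta>) - 1) / complex_of_real (t n)) / (\<i> * complex_of_real (fst \<zeta>)))
     \<longlonglongrightarrow> (\<i> * complex_of_real (fst \<zeta>)) / (\<i> * complex_of_real (fst \<zeta>))"
    using False by (intro tendsto_divide cis_difference_quotient t tendsto_const) auto
  then show ?thesis using False by (simp add: cis_primitive_def field_simps)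
qed

lemma cis_primitive_has_derivative:
  assumes w: "w \<in> L2" and p: "p \<in> L2"
  shows "((\<lambda>s. ip (\<lambda>\<zeta>. cis_primitive s \<zeta> * w \<zeta>) p) has_vector_derivative
    ip (\<lambda>\<zeta>. cis (s * fst \<zeta>) * w \<zeta>) p) (at s)"
proof (rule has_vector_derivative_seqI)
  fix t :: "nat \<Rightarrow> real" assume t: "t \<longlonglongrightarrow> 0" "\<And>n. t n \<noteq> 0"
  have [measurable]: "w \<in> borel_measurable borel" using w by auto
  have M: "(\<lambda>\<zeta>. cis_primitive r \<zeta> * w \<zeta>) \<in> L2" for r
    by (rule L2_bounded_mult[OF w cis_primitive_measurable cis_primitive_bound])
  define Q where "Q n \<zeta> = cis (s * fst \<zeta>) * (cis_primitive (t n) \<zeta> / complex_of_real (t n)) * w \<zeta>" for n \<zeta>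
  have Qm: "Q n \<in> borel_measurable borel" for n unfolding Q_def by measurable
  have Pm: "(\<lambda>\<zeta>. cis (s * fst \<zeta>) * w \<zeta>) \<in> borel_measurable borel" by measurable
  have Qb: "cmod (Q n \<zeta>) \<le> cmod (w \<zeta>)" for n \<zeta>
  proof -
    have "cmod (cis_primitive (t n) \<zeta> / complex_of_real (t n)) \<le> 1"
      using cis_primitive_bound[of "t n" \<zeta>] t(2)[of n] by (simp add: norm_divide divide_le_eq)
    then show ?thesis unfolding Q_def norm_mult by (simp add: mult_left_le_one_le)
  qed
  have lim: "(\<lambda>n. Q n \<zeta>) \<longlonglongrightarrow> cis (s * fst \<zeta>) * w \<zeta>" for \<zeta>
  proof -
    have "(\<lambda>n. Q n \<zeta>) \<longlonglongrightarrow> cis (s * fst \<zeta>) * 1 * w \<zeta>"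
      unfolding Q_def by (intro tendsto_intros cis_primitive_tendsto t)
    then show ?thesis by simp
  qed
  note QQ = L2_dominated[OF Qm Pm L2_square_integrable[OF w] Qb AE_I2[OF lim]]
  have "(\<lambda>n. ip (Q n) p) \<longlonglongrightarrow> ip (\<lambda>\<zeta>. cis (s * fst \<zeta>) * w \<zeta>) p"
    using p QQ L2_zero by (intro L2_tendsto_ip[where f'="\<lambda>n. p"]) (auto simp: L2_norm_def)
  moreover have "ip (Q n) p = (ip (\<lambda>\<zeta>. cis_primitive (s + t n) \<zeta> * w \<zeta>) p - ip (\<lambda>\<zeta>. cis_primitive s \<zeta> * w \<zeta>) p) / complex_of_real (t n)" for n
  proof -
    have "Q n = (\<lambda>\<zeta>. complex_of_real (1 / t n) * (cis_primitive (s + t n) \<zeta> * w \<zeta> - cis_primitive s \<zeta> * w \<zeta>))"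
      by (simp add: Q_def[abs_def] fun_eq_iff cis_primitive_add algebra_simps)
    then have "ip (Q n) p = complex_of_real (1 / t n) * (ip (\<lambda>\<zeta>. cis_primitive (s + t n) \<zeta> * w \<zeta>) p - ip (\<lambda>\<zeta>. cis_primitive s \<zeta> * w \<zeta>) p)"
      by (simp only: ip_cmult_left ip_diff_left[OF M M p])
    then show ?thesis by simp
  qed
  ultimately show "(\<lambda>n. (ip (\<lambda>\<zeta>. cis_primitive (s + t n) \<zeta> * w \<zeta>) p - ip (\<lambda>\<zeta>. cis_primitive s \<zeta> * w \<zeta>) p) / complex_of_real (t n))
    \<longlonglongrightarrow> ip (\<lambda>\<zeta>. cis (s * fst \<zeta>) * w \<zeta>) p" by simp
qed

text \<open>The definition of the weak derivative, applied to translates of the test function.\<close>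
lemma weak_dx_translation_derivative:
  assumes uv: "has_weak_dx u v" and \<phi>: "\<phi> \<in> test_functions"
  shows "((\<lambda>s. ip (tau (s, 0) u) (\<lambda>z. cnj (\<phi> z))) has_vector_derivative ip (tau (s, 0) v) (\<lambda>z. cnj (\<phi> z))) (at s)"
proof (rule has_vector_derivative_seqI)
  have u: "u \<in> L2" and v: "v \<in> L2" using uv by (auto simp: has_weak_dx_def)
  have [measurable]: "u \<in> borel_measurable borel" "v \<in> borel_measurable borel" "\<phi> \<in> borel_measurable borel"
    using u v test_function_L2[OF \<phi>] by auto
  have dm [measurable]: "classical_dx \<phi> \<in> borel_measurable borel"
    using test_function_dx(2)[OF \<phi>] by (rule borel_measurable_continuous_onI)
  fix t :: "nat \<Rightarrow> real" assume t: "t \<longlonglongrightarrow> 0" "\<And>n. t n \<noteq> 0"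
  let ?h = "(s, 0) :: real \<times> real"
  have "(LINT z|lborel. tau ?h u z * classical_dx \<phi> z) = (LINT z|lborel. u z * classical_dx \<phi> (z - ?h))"
    using integral_shift[of "\<lambda>z. u z * classical_dx \<phi> (z - ?h)" ?h] by (simp add: tau_def)
  also have "\<dots> = (LINT z|lborel. u z * classical_dx (tau (- ?h) \<phi>) z)"
    by (simp only: classical_dx_tau[OF \<phi>] diff_conv_add_uminus)
  also have "\<dots> = - (LINT z|lborel. v z * tau (- ?h) \<phi> z)"
    using uv test_function_tau[OF \<phi>] by (simp add: has_weak_dx_def)
  also have "(LINT z|lborel. v z * tau (- ?h) \<phi> z) = (LINT z|lborel. tau ?h v z * \<phi> z)"
    using integral_shift[of "\<lambda>z. v z * tau (- ?h) \<phi> z" ?h] by (simp add: tau_def add.assoc flip: zero_prod_def)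
  finally have "- (LINT z|lborel. tau ?h u z * classical_dx \<phi> z) = ip (tau ?h v) (\<lambda>z. cnj (\<phi> z))"
    by (simp add: ip_def)
  moreover have "tau (t n, 0) (tau ?h u) = tau (s + t n, 0) u" for n
    by (simp add: tau_tau add.commute)
  ultimately show "(\<lambda>n. (ip (tau (s + t n, 0) u) (\<lambda>z. cnj (\<phi> z)) - ip (tau ?h u) (\<lambda>z. cnj (\<phi> z))) / complex_of_real (t n))
     \<longlonglongrightarrow> ip (tau ?h v) (\<lambda>z. cnj (\<phi> z))"
    using tau_difference_quotient_test[OF tau_L2[OF u] \<phi> t, of ?h] by simp
qed

text \<open>It is not known beforehand that \<open>\<i>\<xi>\<close> times the transform of \<open>u\<close> is square integrable. The identity is
therefore proved in its integrated form \<open>(cis (s \<xi>) - 1) w = cis_primitive s w'\<close>, which involves bounded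
multipliers only: paired with any test function both sides have the same derivative in \<open>s\<close>. Dividing by
\<open>s\<close> and letting \<open>s\<close> tend to \<open>0\<close> gives the claim almost everywhere.\<close>
theorem has_weak_dx_fourier:
  assumes uv: "has_weak_dx u v" and w: "has_fourier u w" and w': "has_fourier v w'"
  shows "AE \<zeta> in lborel. w' \<zeta> = \<i> * complex_of_real (fst \<zeta>) * w \<zeta>"
proof -
  note L = has_fourier_L2[OF w] has_fourier_L2[OF w']
  have [measurable]: "w \<in> borel_measurable borel" "w' \<in> borel_measurable borel" using L by auto
  have CL: "(\<lambda>\<zeta>. cis (s * fst \<zeta>) * w \<zeta>) \<in> L2" for s
    using has_fourier_L2[OF has_fourier_tau_x[OF w]] by auto
  have PrL: "(\<lambda>\<zeta>. cis_primitive s \<zeta> * w' \<zeta>) \<in> L2" for s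
    by (rule L2_bounded_mult[OF L(4) cis_primitive_measurable cis_primitive_bound])
  define d where "d s \<zeta> = cis (s * fst \<zeta>) * w \<zeta> - w \<zeta> - cis_primitive s \<zeta> * w' \<zeta>" for s \<zeta>
  have dL: "d s \<in> L2" for s unfolding d_def by (intro L2_diff CL PrL L(2))
  have d0: "AE \<zeta> in lborel. d s \<zeta> = 0" for s
  proof -
    (* d s vanishes if its inverse transform g does, and g can be tested with smooth functions *)
    obtain g where g: "has_fourier g (d s)" using has_fourier_surj[OF dL] .
    have "AE z in lborel. g z = 0"
    proof (rule fundamental_lemma)
      show "g \<in> L2" using has_fourier_L2[OF g] by simp
      fix \<phi> :: plane_fun assume \<phi>: "\<phi> \<in> test_functions"
      obtain p where p: "has_fourier (\<lambda>z. cnj (\<phi> z)) p"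
        using has_fourier_ex[OF L2_cnj[OF test_function_L2[OF \<phi>]]] .
      have pL: "p \<in> L2" using has_fourier_L2[OF p] by simp
      define H where "H s = ip (\<lambda>\<zeta>. cis (s * fst \<zeta>) * w \<zeta>) p - ip (\<lambda>\<zeta>. cis_primitive s \<zeta> * w' \<zeta>) p" for s
      have Heq: "H s = ip (tau (s, 0) u) (\<lambda>z. cnj (\<phi> z)) - ip (\<lambda>\<zeta>. cis_primitive s \<zeta> * w' \<zeta>) p" for s
        unfolding H_def using has_fourier_ip[OF has_fourier_tau_x[OF w] p] by simp
      have "(H has_vector_derivative 0) (at s)" for s
      proof -
        have "(H has_vector_derivative ip (tau (s, 0) v) (\<lambda>z. cnj (\<phi> z)) - ip (\<lambda>\<zeta>. cis (s * fst \<zeta>) * w' \<zeta>) p) (at s)"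
          unfolding Heq[abs_def]
          by (intro has_vector_derivative_diff weak_dx_translation_derivative[OF uv \<phi>] cis_primitive_has_derivative L pL)
        then show ?thesis using has_fourier_ip[OF has_fourier_tau_x[OF w'] p] by simp
      qed
      then obtain c where "\<And>s. s \<in> UNIV \<Longrightarrow> H s = c"
        by (rule has_vector_derivative_zero_constant[OF convex_UNIV, of H]) auto
      then have "H s = H 0" by simp
      then have "ip (\<lambda>\<zeta>. cis (s * fst \<zeta>) * w \<zeta>) p - ip (\<lambda>\<zeta>. cis_primitive s \<zeta> * w' \<zeta>) p = ip w p"
        by (simp add: H_def ip_def)
      moreover have "ip (d s) p = ip (\<lambda>\<zeta>. cis (s * fst \<zeta>) * w \<zeta>) p - ip w p - ip (\<lambda>\<zeta>. cis_primitive s \<zeta> * w' \<zeta>) p"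
        unfolding d_def by (simp add: ip_diff_left CL PrL L pL L2_diff)
      ultimately have "ip (d s) p = 0" by (simp only: diff_eq_eq) simp
      then have "ip g (\<lambda>z. cnj (\<phi> z)) = 0"
        using has_fourier_ip[OF g p] by simp
      then show "(LINT z|lborel. g z * \<phi> z) = 0" by (simp add: ip_def)
    qed
    from has_fourier_unique[OF g has_fourier_zero this] show ?thesis .
  qed
  define t where "t n = 1 / real (Suc n)" for n
  have t: "t \<longlonglongrightarrow> 0" "t n \<noteq> 0" for n
    unfolding t_def by (rule LIMSEQ_inverse_real_of_nat[unfolded inverse_eq_divide]) simp
  have "AE \<zeta> in lborel. \<forall>n. d (t n) \<zeta> = 0"
    unfolding AE_all_countable using d0 by blast
  then show ?thesis
  proof eventually_elim
    case (elim \<zeta>)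
    have l1: "(\<lambda>n. (cis (t n * fst \<zeta>) - 1) / complex_of_real (t n) * w \<zeta>) \<longlonglongrightarrow> \<i> * complex_of_real (fst \<zeta>) * w \<zeta>"
      by (intro tendsto_mult cis_difference_quotient t tendsto_const)
    have l2: "(\<lambda>n. cis_primitive (t n) \<zeta> / complex_of_real (t n) * w' \<zeta>) \<longlonglongrightarrow> 1 * w' \<zeta>"
      by (intro tendsto_mult cis_primitive_tendsto t tendsto_const)
    have eq: "(cis (t n * fst \<zeta>) - 1) / complex_of_real (t n) * w \<zeta> = cis_primitive (t n) \<zeta> / complex_of_real (t n) * w' \<zeta>" for n
    proof -
      have "(cis (t n * fst \<zeta>) - 1) * w \<zeta> = cis_primitive (t n) \<zeta> * w' \<zeta>"
        using elim[rule_format, of n] by (simp add: d_def left_diff_distrib)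
      then show ?thesis by (simp add: mult.commute)
    qed
    show ?case using LIMSEQ_unique[OF l1[unfolded eq] l2] by simp
  qed
qed

text \<open>By Parseval, the difference quotients of \<open>s \<mapsto> \<langle>\<tau>\<^sub>s u, \<phi>\<rangle>\<close> have multiplier \<open>(cis (s \<xi>) - 1)/s\<close>, which is
dominated by \<open>|\<xi>|\<close>. Their limit is computed once on each side of the transform.\<close>
theorem has_weak_dx_fourierI:
  assumes w: "has_fourier u w" and w': "has_fourier v (\<lambda>\<zeta>. \<i> * complex_of_real (fst \<zeta>) * w \<zeta>)"
  shows "has_weak_dx u v"
  unfolding has_weak_dx_def
proof (intro conjI ballI)
  note L = has_fourier_L2[OF w] has_fourier_L2[OF w']
  show "u \<in> L2" "v \<in> L2" using L by auto
  have [measurable]: "w \<in> borel_measurable borel" using L by auto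
  fix \<phi> :: plane_fun assume \<phi>: "\<phi> \<in> test_functions"
  obtain p where p: "has_fourier (\<lambda>z. cnj (\<phi> z)) p"
    using has_fourier_ex[OF L2_cnj[OF test_function_L2[OF \<phi>]]] .
  have pL: "p \<in> L2" using has_fourier_L2[OF p] by simp
  define t where "t n = 1 / real (Suc n)" for n
  have t: "t \<longlonglongrightarrow> 0" "t n \<noteq> 0" for n
    unfolding t_def by (rule LIMSEQ_inverse_real_of_nat[unfolded inverse_eq_divide]) simp
  have CL: "(\<lambda>\<zeta>. cis (s * fst \<zeta>) * w \<zeta>) \<in> L2" for s
    using has_fourier_L2[OF has_fourier_tau_x[OF w]] by auto
  define Q where "Q n \<zeta> = (cis (t n * fst \<zeta>) - 1) / complex_of_real (t n) * w \<zeta>" for n \<zeta>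
  have Qm: "Q n \<in> borel_measurable borel" for n unfolding Q_def by measurable
  have Pm: "(\<lambda>\<zeta>. \<i> * complex_of_real (fst \<zeta>) * w \<zeta>) \<in> borel_measurable borel" by measurable
  have Qb: "cmod (Q n \<zeta>) \<le> cmod (\<i> * complex_of_real (fst \<zeta>) * w \<zeta>)" for n \<zeta>
  proof -
    have "cmod ((cis (t n * fst \<zeta>) - 1) / complex_of_real (t n)) \<le> \<bar>fst \<zeta>\<bar>"
      using cmod_cis_minus_1[of "t n * fst \<zeta>"] t(2)[of n] by (simp add: norm_divide divide_le_eq abs_mult mult.commute)
    from mult_right_mono[OF this, of "cmod (w \<zeta>)"]
    show ?thesis unfolding Q_def by (simp only: norm_mult norm_ii norm_of_real mult_1) simp
  qed
  have lim: "(\<lambda>n. Q n \<zeta>) \<longlonglongrightarrow> \<i> * complex_of_real (fst \<zeta>) * w \<zeta>" for \<zeta>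
    unfolding Q_def by (intro tendsto_mult cis_difference_quotient t tendsto_const)
  note QQ = L2_dominated[OF Qm Pm L2_square_integrable[OF L(4)] Qb AE_I2[OF lim]]
  have "(\<lambda>n. ip (Q n) p) \<longlonglongrightarrow> ip (\<lambda>\<zeta>. \<i> * complex_of_real (fst \<zeta>) * w \<zeta>) p"
    using pL QQ L2_zero by (intro L2_tendsto_ip[where f'="\<lambda>n. p"]) (auto simp: L2_norm_def)
  moreover have "ip (\<lambda>\<zeta>. \<i> * complex_of_real (fst \<zeta>) * w \<zeta>) p = (LINT z|lborel. v z * \<phi> z)"
    unfolding has_fourier_ip[OF w' p] by (simp add: ip_def)
  moreover have "ip (Q n) p = (ip (tau (t n, 0) u) (\<lambda>z. cnj (\<phi> z)) - ip u (\<lambda>z. cnj (\<phi> z))) / complex_of_real (t n)" for n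
  proof -
    have "Q n = (\<lambda>\<zeta>. complex_of_real (1 / t n) * (cis (t n * fst \<zeta>) * w \<zeta> - w \<zeta>))"
      by (simp add: Q_def[abs_def] fun_eq_iff diff_divide_distrib left_diff_distrib)
    then have "ip (Q n) p = complex_of_real (1 / t n) * (ip (\<lambda>\<zeta>. cis (t n * fst \<zeta>) * w \<zeta>) p - ip w p)"
      by (simp only: ip_cmult_left ip_diff_left[OF CL L(2) pL])
    then show ?thesis
      using has_fourier_ip[OF has_fourier_tau_x[OF w] p] has_fourier_ip[OF w p] by simp
  qed
  ultimately have "(\<lambda>n. (ip (tau (t n, 0) u) (\<lambda>z. cnj (\<phi> z)) - ip u (\<lambda>z. cnj (\<phi> z))) / complex_of_real (t n)) \<longlonglongrightarrow> (LINT z|lborel. v z * \<phi> z)"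
    by simp
  moreover have "(\<lambda>n. (ip (tau (t n, 0) u) (\<lambda>z. cnj (\<phi> z)) - ip u (\<lambda>z. cnj (\<phi> z))) / complex_of_real (t n)) \<longlonglongrightarrow> - (LINT z|lborel. u z * classical_dx \<phi> z)"
    by (rule tau_difference_quotient_test[OF L(1) \<phi> t])
  ultimately have "(LINT z|lborel. v z * \<phi> z) = - (LINT z|lborel. u z * classical_dx \<phi> z)"
    by (rule LIMSEQ_unique)
  then show "(LINT z|lborel. u z * classical_dx \<phi> z) = - (LINT z|lborel. v z * \<phi> z)" by simp
qed

section \<open>The energy on the Fourier side\<close>

definition FT :: "plane_fun \<Rightarrow> plane_fun" where
  "FT u = (SOME w. has_fourier u w)"

lemma has_fourier_FT: "u \<in> L2 \<Longrightarrow> has_fourier u (FT u)"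
  unfolding FT_def by (erule has_fourier_ex) (rule someI[of "has_fourier u"])

lemma FT_L2: "u \<in> L2 \<Longrightarrow> FT u \<in> L2"
  using has_fourier_L2(2)[OF has_fourier_FT] .

lemma FT_measurable: "u \<in> L2 \<Longrightarrow> FT u \<in> borel_measurable borel"
  by (intro L2_measurable FT_L2)

lemma X_L2: "u \<in> X \<Longrightarrow> u \<in> L2"
  by (simp add: X_def)

lemma has_fourier_Dx:
  assumes u: "u \<in> X" shows "has_fourier (Dx u) (\<lambda>\<zeta>. \<i> * complex_of_real (fst \<zeta>) * FT u \<zeta>)"
proof -
  note uL = X_L2[OF u]
  have [measurable]: "FT u \<in> borel_measurable borel" by (rule FT_measurable[OF uL])
  have d: "has_weak_dx u (Dx u)"
    unfolding Dx_def using u someI_ex[of "has_weak_dx u"] by (simp add: X_def)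
  have DL: "Dx u \<in> L2" using d by (simp add: has_weak_dx_def)
  show ?thesis
    by (rule has_fourier_cong[OF has_fourier_FT[OF DL]])
      (use has_weak_dx_fourier[OF d has_fourier_FT[OF uL] has_fourier_FT[OF DL]] DL in auto)
qed

lemma has_fourier_Dy_half:
  assumes u: "u \<in> X" shows "has_fourier (Dy_half u) (\<lambda>\<zeta>. complex_of_real (sqrt \<bar>snd \<zeta>\<bar>) * FT u \<zeta>)"
proof -
  note uL = X_L2[OF u]
  have [measurable]: "FT u \<in> borel_measurable borel" by (rule FT_measurable[OF uL])
  have "has_Dy_half u (Dy_half u)"
    unfolding Dy_half_def using u someI_ex[of "has_Dy_half u"] by (simp add: X_def)
  then obtain w where w: "has_fourier u w" "has_fourier (Dy_half u) (\<lambda>\<zeta>. complex_of_real (sqrt \<bar>snd \<zeta>\<bar>) * w \<zeta>)"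
    unfolding has_multiplier_def by (auto simp: case_prod_unfold)
  have ae: "AE \<zeta> in lborel. w \<zeta> = FT u \<zeta>"
    by (rule has_fourier_unique[OF w(1) has_fourier_FT[OF uL]]) simp
  show ?thesis
    by (rule has_fourier_cong[OF w(2)]) (use ae has_fourier_L2[OF w(2)] in auto)
qed

lemma XI_fourier:
  assumes w: "has_fourier u w" and x: "(\<lambda>\<zeta>. complex_of_real (fst \<zeta>) * w \<zeta>) \<in> L2"
    and y: "(\<lambda>\<zeta>. complex_of_real (sqrt \<bar>snd \<zeta>\<bar>) * w \<zeta>) \<in> L2"
  shows "u \<in> X"
proof -
  have "(\<lambda>\<zeta>. \<i> * (complex_of_real (fst \<zeta>) * w \<zeta>)) \<in> L2" by (rule L2_cmult[OF x])
  then have "(\<lambda>\<zeta>. \<i> * complex_of_real (fst \<zeta>) * w \<zeta>) \<in> L2" by (simp only: mult.assoc)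
  then obtain v where "has_fourier v (\<lambda>\<zeta>. \<i> * complex_of_real (fst \<zeta>) * w \<zeta>)" by (rule has_fourier_surj)
  then have "has_weak_dx u v" by (rule has_weak_dx_fourierI[OF w])
  moreover obtain v' where "has_fourier v' (\<lambda>\<zeta>. complex_of_real (sqrt \<bar>snd \<zeta>\<bar>) * w \<zeta>)"
    using has_fourier_surj[OF y] .
  then have "has_Dy_half u v'"
    unfolding has_multiplier_def using w by (auto simp: case_prod_unfold intro!: exI[of _ w])
  ultimately show ?thesis using has_fourier_L2(1)[OF w] by (auto simp: X_def)
qed

text \<open>The square root makes the energy the plain \<open>L\<^sup>2\<close> inner product of transforms, so Hilbert space arguments apply.\<close>
definition energy_symbol :: "real \<Rightarrow> real \<times> real \<Rightarrow> real" where
  "energy_symbol \<omega> \<zeta> = sqrt ((fst \<zeta>)\<^sup>2 + \<bar>snd \<zeta>\<bar> + \<omega>)"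

definition energy_transform :: "real \<Rightarrow> plane_fun \<Rightarrow> plane_fun" where
  "energy_transform \<omega> u \<zeta> = complex_of_real (energy_symbol \<omega> \<zeta>) * FT u \<zeta>"

definition energy_form :: "real \<Rightarrow> plane_fun \<Rightarrow> plane_fun \<Rightarrow> complex" where
  "energy_form \<omega> u v = ip (energy_transform \<omega> u) (energy_transform \<omega> v)"

definition energy :: "real \<Rightarrow> plane_fun \<Rightarrow> real" where
  "energy \<omega> u = (L2_norm (energy_transform \<omega> u))\<^sup>2"

lemma energy_symbol_measurable [measurable]: "energy_symbol \<omega> \<in> borel_measurable borel"
  unfolding energy_symbol_def[abs_def] by measurable

lemma energy_symbol_nonneg: "0 \<le> \<omega> \<Longrightarrow> 0 \<le> energy_symbol \<omega> \<zeta>"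
  by (simp add: energy_symbol_def)

lemma energy_symbol_sq: "0 \<le> \<omega> \<Longrightarrow> (energy_symbol \<omega> \<zeta>)\<^sup>2 = (fst \<zeta>)\<^sup>2 + \<bar>snd \<zeta>\<bar> + \<omega>"
  by (simp add: energy_symbol_def)

lemma energy_symbol_ge:
  assumes "0 \<le> \<omega>"
  shows "\<bar>fst \<zeta>\<bar> \<le> energy_symbol \<omega> \<zeta>" "sqrt \<bar>snd \<zeta>\<bar> \<le> energy_symbol \<omega> \<zeta>" "sqrt \<omega> \<le> energy_symbol \<omega> \<zeta>"
  unfolding energy_symbol_def using assms by (auto intro!: real_le_rsqrt real_sqrt_le_mono)

lemma energy_transform_measurable: "u \<in> L2 \<Longrightarrow> energy_transform \<omega> u \<in> borel_measurable borel"
proof -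
  assume "u \<in> L2"
  then have [measurable]: "FT u \<in> borel_measurable borel" by (rule FT_measurable)
  show ?thesis unfolding energy_transform_def[abs_def] by measurable
qed

lemma energy_nonneg: "0 \<le> energy \<omega> u"
  by (simp add: energy_def)

lemma X_iff_energy_transform:
  assumes \<omega>: "0 < \<omega>"
  shows "u \<in> X \<longleftrightarrow> u \<in> L2 \<and> energy_transform \<omega> u \<in> L2"
proof
  assume u: "u \<in> X"
  note uL = X_L2[OF u]
  have [measurable]: "FT u \<in> borel_measurable borel" by (rule FT_measurable[OF uL])
  have "energy_transform \<omega> u \<in> L2"
  proof (rule L2I_bound[OF energy_transform_measurable[OF uL]])
    show "integrable lborel (\<lambda>\<zeta>. (cmod (\<i> * complex_of_real (fst \<zeta>) * FT u \<zeta>))\<^sup>2 +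
        (cmod (complex_of_real (sqrt \<bar>snd \<zeta>\<bar>) * FT u \<zeta>))\<^sup>2 + \<omega> * (cmod (FT u \<zeta>))\<^sup>2)"
      by (intro Bochner_Integration.integrable_add integrable_mult_right L2_square_integrable FT_L2[OF uL]
          has_fourier_L2(2)[OF has_fourier_Dx[OF u]] has_fourier_L2(2)[OF has_fourier_Dy_half[OF u]])
    show "AE \<zeta> in lborel. (cmod (energy_transform \<omega> u \<zeta>))\<^sup>2 \<le> (cmod (\<i> * complex_of_real (fst \<zeta>) * FT u \<zeta>))\<^sup>2 +
        (cmod (complex_of_real (sqrt \<bar>snd \<zeta>\<bar>) * FT u \<zeta>))\<^sup>2 + \<omega> * (cmod (FT u \<zeta>))\<^sup>2"
      using \<omega> by (intro AE_I2) (simp add: energy_transform_def norm_mult power_mult_distrib energy_symbol_sq algebra_simps)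
  qed
  then show "u \<in> L2 \<and> energy_transform \<omega> u \<in> L2" using uL by simp
next
  assume u: "u \<in> L2 \<and> energy_transform \<omega> u \<in> L2"
  then have [measurable]: "FT u \<in> borel_measurable borel" by (intro FT_measurable) simp
  have 0: "0 \<le> energy_symbol \<omega> \<zeta>" for \<zeta> using \<omega> by (simp add: energy_symbol_nonneg)
  show "u \<in> X"
  proof (rule XI_fourier[OF has_fourier_FT])
    show "(\<lambda>\<zeta>. complex_of_real (fst \<zeta>) * FT u \<zeta>) \<in> L2"
    proof (rule L2_bound[where v="energy_transform \<omega> u" and c=1])
      show "cmod (complex_of_real (fst \<zeta>) * FT u \<zeta>) \<le> 1 * cmod (energy_transform \<omega> u \<zeta>)" for \<zeta>
        using energy_symbol_ge(1)[of \<omega> \<zeta>] \<omega> 0[of \<zeta>] by (simp add: energy_transform_def norm_mult mult_right_mono)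
    qed (use u in simp_all)
    show "(\<lambda>\<zeta>. complex_of_real (sqrt \<bar>snd \<zeta>\<bar>) * FT u \<zeta>) \<in> L2"
    proof (rule L2_bound[where v="energy_transform \<omega> u" and c=1])
      show "cmod (complex_of_real (sqrt \<bar>snd \<zeta>\<bar>) * FT u \<zeta>) \<le> 1 * cmod (energy_transform \<omega> u \<zeta>)" for \<zeta>
        using energy_symbol_ge(2)[of \<omega> \<zeta>] \<omega> 0[of \<zeta>] by (simp add: energy_transform_def norm_mult mult_right_mono)
    qed (use u in simp_all)
  qed (use u in simp)
qed

lemma FT_linear:
  assumes "u \<in> L2" "v \<in> L2"
  shows "AE \<zeta> in lborel. FT (\<lambda>z. a * u z + b * v z) \<zeta> = a * FT u \<zeta> + b * FT v \<zeta>"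
  by (rule has_fourier_unique[OF has_fourier_FT has_fourier_linear[OF has_fourier_FT has_fourier_FT]])
    (use assms in \<open>auto intro!: L2_add L2_cmult\<close>)

lemma energy_transform_linear:
  assumes "u \<in> L2" "v \<in> L2"
  shows "AE \<zeta> in lborel. energy_transform \<omega> (\<lambda>z. a * u z + b * v z) \<zeta> =
    a * energy_transform \<omega> u \<zeta> + b * energy_transform \<omega> v \<zeta>"
  using FT_linear[OF assms, of a b] by eventually_elim (simp add: energy_transform_def algebra_simps)

context
  fixes \<omega> :: real
  assumes \<omega>: "0 < \<omega>"
begin

lemma X_transform_L2: "u \<in> X \<Longrightarrow> energy_transform \<omega> u \<in> L2"
  using X_iff_energy_transform[OF \<omega>] by blast

lemma X_linear: assumes "u \<in> X" "v \<in> X" shows "(\<lambda>z. a * u z + b * v z) \<in> X"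
proof -
  have L: "u \<in> L2" "v \<in> L2" using assms by (auto intro: X_L2)
  have uvL: "(\<lambda>z. a * u z + b * v z) \<in> L2" using L by (intro L2_add L2_cmult)
  have "(\<lambda>\<zeta>. a * energy_transform \<omega> u \<zeta> + b * energy_transform \<omega> v \<zeta>) \<in> L2"
    by (intro L2_add L2_cmult X_transform_L2 assms)
  then have "energy_transform \<omega> (\<lambda>z. a * u z + b * v z) \<in> L2"
    by (rule L2_cong_AE[OF _ energy_transform_measurable[OF uvL]])
      (use energy_transform_linear[OF L, of \<omega> a b] in \<open>auto elim!: eventually_mono\<close>)
  then show ?thesis using uvL X_iff_energy_transform[OF \<omega>] by blast
qed

lemma energy_form_linear_left:
  assumes u: "u \<in> X" and v: "v \<in> X" and w: "w \<in> X"
  shows "energy_form \<omega> (\<lambda>z. a * u z + b * v z) w = a * energy_form \<omega> u w + b * energy_form \<omega> v w"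
proof -
  note T = X_transform_L2[OF u] X_transform_L2[OF v] X_transform_L2[OF w]
  have "energy_form \<omega> (\<lambda>z. a * u z + b * v z) w =
    ip (\<lambda>\<zeta>. a * energy_transform \<omega> u \<zeta> + b * energy_transform \<omega> v \<zeta>) (energy_transform \<omega> w)"
    unfolding energy_form_def
    by (rule ip_cong_AE)
      (use X_transform_L2[OF X_linear[OF u v, of a b]] T L2_add[OF L2_cmult[OF T(1), of a] L2_cmult[OF T(2), of b]]
        energy_transform_linear[OF X_L2[OF u] X_L2[OF v]] in auto)
  then show ?thesis unfolding energy_form_def
    by (simp add: ip_add_left[OF L2_cmult[OF T(1)] L2_cmult[OF T(2)] T(3)] ip_cmult_left)
qed

lemma energy_form_cnj: "cnj (energy_form \<omega> u v) = energy_form \<omega> v u"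
  unfolding energy_form_def by (rule ip_cnj)

lemma energy_form_self: "energy_form \<omega> u u = complex_of_real (energy \<omega> u)"
  unfolding energy_form_def energy_def by (rule ip_self)

lemma energy_form_linear_right:
  assumes u: "u \<in> X" and v: "v \<in> X" and w: "w \<in> X"
  shows "energy_form \<omega> w (\<lambda>z. a * u z + b * v z) = cnj a * energy_form \<omega> w u + cnj b * energy_form \<omega> w v"
proof -
  have "energy_form \<omega> w (\<lambda>z. a * u z + b * v z) = cnj (energy_form \<omega> (\<lambda>z. a * u z + b * v z) w)"
    by (simp add: energy_form_cnj)
  then show ?thesis unfolding energy_form_linear_left[OF u v w] by (simp add: energy_form_cnj)
qed

lemma energy_linear:
  assumes u: "u \<in> X" and v: "v \<in> X"
  shows "energy \<omega> (\<lambda>z. u z + complex_of_real t * v z) = energy \<omega> u + 2 * t * Re (energy_form \<omega> u v) + t\<^sup>2 * energy \<omega> v"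
proof -
  let ?w = "\<lambda>z. 1 * u z + complex_of_real t * v z"
  have w: "?w \<in> X" by (rule X_linear[OF u v])
  have "energy_form \<omega> ?w ?w = energy_form \<omega> u ?w + complex_of_real t * energy_form \<omega> v ?w"
    by (subst energy_form_linear_left[OF u v w]) simp
  also have "energy_form \<omega> u ?w = energy_form \<omega> u u + complex_of_real t * energy_form \<omega> u v"
    by (subst energy_form_linear_right[OF u v u]) simp
  also have "energy_form \<omega> v ?w = cnj (energy_form \<omega> u v) + complex_of_real t * energy_form \<omega> v v"
    by (subst energy_form_linear_right[OF u v v]) (simp add: energy_form_cnj)
  finally have "Re (energy_form \<omega> ?w ?w) = Re (energy_form \<omega> u u + complex_of_real t * energy_form \<omega> u v
     + complex_of_real t * (cnj (energy_form \<omega> u v) + complex_of_real t * energy_form \<omega> v v))"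
    by (rule arg_cong)
  then show ?thesis by (simp add: energy_form_self power2_eq_square algebra_simps)
qed

lemma X_cmult: "u \<in> X \<Longrightarrow> (\<lambda>z. c * u z) \<in> X"
  using X_linear[of u u c 0] by simp

lemma X_add: "u \<in> X \<Longrightarrow> v \<in> X \<Longrightarrow> (\<lambda>z. u z + v z) \<in> X"
  using X_linear[of u v 1 1] by simp

lemma energy_cmult: assumes u: "u \<in> X" shows "energy \<omega> (\<lambda>z. c * u z) = (cmod c)\<^sup>2 * energy \<omega> u"
proof -
  have "energy_form \<omega> (\<lambda>z. c * u z + 0 * u z) (\<lambda>z. c * u z + 0 * u z) = c * cnj c * energy_form \<omega> u u"
    using X_cmult[OF u, of c]
    by (subst energy_form_linear_left[OF u u]) (simp_all, subst energy_form_linear_right[OF u u u, of c 0, simplified], simp)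
  then have "complex_of_real (energy \<omega> (\<lambda>z. c * u z)) = complex_of_real ((cmod c)\<^sup>2 * energy \<omega> u)"
    by (simp only: energy_form_self of_real_mult complex_norm_square mult_zero_left add_0_right)
  then show ?thesis by (simp only: of_real_eq_iff)
qed

text \<open>Parseval for each of the three terms; the three symbols add up to the square of the energy symbol.\<close>
lemma energy_form_derivatives:
  assumes u: "u \<in> X" and v: "v \<in> X"
  shows "energy_form \<omega> u v = ip (Dx u) (Dx v) + ip (Dy_half u) (Dy_half v) + complex_of_real \<omega> * ip u v"
proof -
  note U = has_fourier_Dx[OF u] has_fourier_Dy_half[OF u] has_fourier_FT[OF X_L2[OF u]]
  note V = has_fourier_Dx[OF v] has_fourier_Dy_half[OF v] has_fourier_FT[OF X_L2[OF v]]
  have "ip (Dx u) (Dx v) + ip (Dy_half u) (Dy_half v) + complex_of_real \<omega> * ip u v =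
    ip (\<lambda>\<zeta>. \<i> * complex_of_real (fst \<zeta>) * FT u \<zeta>) (\<lambda>\<zeta>. \<i> * complex_of_real (fst \<zeta>) * FT v \<zeta>) +
    ip (\<lambda>\<zeta>. complex_of_real (sqrt \<bar>snd \<zeta>\<bar>) * FT u \<zeta>) (\<lambda>\<zeta>. complex_of_real (sqrt \<bar>snd \<zeta>\<bar>) * FT v \<zeta>) +
    complex_of_real \<omega> * ip (FT u) (FT v)"
    by (simp only: has_fourier_ip[OF U(1) V(1)] has_fourier_ip[OF U(2) V(2)] has_fourier_ip[OF U(3) V(3)])
  also have "\<dots> = (LINT \<zeta>|lborel.
     (\<i> * complex_of_real (fst \<zeta>) * FT u \<zeta>) * cnj (\<i> * complex_of_real (fst \<zeta>) * FT v \<zeta>) +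
     (complex_of_real (sqrt \<bar>snd \<zeta>\<bar>) * FT u \<zeta>) * cnj (complex_of_real (sqrt \<bar>snd \<zeta>\<bar>) * FT v \<zeta>) +
     complex_of_real \<omega> * (FT u \<zeta> * cnj (FT v \<zeta>)))"
    unfolding ip_def
    using integrable_ip[OF has_fourier_L2(2)[OF U(1)] has_fourier_L2(2)[OF V(1)]]
      integrable_ip[OF has_fourier_L2(2)[OF U(2)] has_fourier_L2(2)[OF V(2)]]
      integrable_ip[OF has_fourier_L2(2)[OF U(3)] has_fourier_L2(2)[OF V(3)]]
    by (subst Bochner_Integration.integral_add; (intro Bochner_Integration.integrable_add)?) auto
  also have "\<dots> = energy_form \<omega> u v"
    unfolding energy_form_def ip_def
  proof (rule Bochner_Integration.integral_cong[OF refl])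
    fix \<zeta> :: "real \<times> real"
    let ?k = "complex_of_real (energy_symbol \<omega> \<zeta>)" and ?x = "complex_of_real (fst \<zeta>)" and ?y = "complex_of_real (sqrt \<bar>snd \<zeta>\<bar>)"
    have "?k * ?k = complex_of_real ((energy_symbol \<omega> \<zeta>)\<^sup>2)" by (simp add: power2_eq_square)
    also have "\<dots> = ?x * ?x + complex_of_real \<bar>snd \<zeta>\<bar> + complex_of_real \<omega>"
      using \<omega> by (subst energy_symbol_sq) (auto simp: power2_eq_square)
    also have "complex_of_real \<bar>snd \<zeta>\<bar> = ?y * ?y"
      by (simp only: of_real_mult[symmetric]) simp
    finally have k: "?k * ?k = ?x * ?x + ?y * ?y + complex_of_real \<omega>" .
    have "energy_transform \<omega> u \<zeta> * cnj (energy_transform \<omega> v \<zeta>) = (?k * ?k) * (FT u \<zeta> * cnj (FT v \<zeta>))"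
      by (simp add: energy_transform_def)
    then show "(\<i> * ?x * FT u \<zeta>) * cnj (\<i> * ?x * FT v \<zeta>) + (?y * FT u \<zeta>) * cnj (?y * FT v \<zeta>) +
        complex_of_real \<omega> * (FT u \<zeta> * cnj (FT v \<zeta>)) = energy_transform \<omega> u \<zeta> * cnj (energy_transform \<omega> v \<zeta>)"
      unfolding k by (simp add: algebra_simps)
  qed
  finally show ?thesis by simp
qed

lemma energy_derivatives:
  assumes u: "u \<in> X"
  shows "energy \<omega> u = (L2_norm (Dx u))\<^sup>2 + (L2_norm (Dy_half u))\<^sup>2 + \<omega> * (L2_norm u)\<^sup>2"
proof -
  have "complex_of_real (energy \<omega> u) = complex_of_real ((L2_norm (Dx u))\<^sup>2 + (L2_norm (Dy_half u))\<^sup>2 + \<omega> * (L2_norm u)\<^sup>2)"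
    using energy_form_derivatives[OF u u] by (simp add: energy_form_self ip_self)
  then show ?thesis by (simp only: of_real_eq_iff)
qed

lemma energy_form_Cauchy_Schwarz:
  assumes "u \<in> X" "v \<in> X" shows "cmod (energy_form \<omega> u v) \<le> sqrt (energy \<omega> u) * sqrt (energy \<omega> v)"
  unfolding energy_form_def energy_def
  using ip_Cauchy_Schwarz[OF X_transform_L2 X_transform_L2, OF assms] by simp

lemma energy_eq_0_iff: assumes u: "u \<in> X" shows "energy \<omega> u = 0 \<longleftrightarrow> \<not> nonzero u"
proof -
  have "energy \<omega> u = 0 \<longleftrightarrow> L2_norm u = 0"
  proof
    assume "energy \<omega> u = 0"
    moreover have "\<omega> * (L2_norm u)\<^sup>2 \<le> energy \<omega> u" unfolding energy_derivatives[OF u] by simp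
    moreover have "0 \<le> \<omega> * (L2_norm u)\<^sup>2" using \<omega> by simp
    ultimately have "\<omega> * (L2_norm u)\<^sup>2 = 0" by linarith
    then show "L2_norm u = 0" using \<omega> by simp
  next
    assume "L2_norm u = 0"
    then have ae: "AE z in lborel. u z = 0" using L2_norm_zero_iff[OF X_L2[OF u]] by simp
    have "AE \<zeta> in lborel. FT u \<zeta> = 0"
      by (rule has_fourier_unique[OF has_fourier_FT[OF X_L2[OF u]] has_fourier_zero ae])
    then have "AE \<zeta> in lborel. energy_transform \<omega> u \<zeta> = 0"
      by eventually_elim (simp add: energy_transform_def)
    then show "energy \<omega> u = 0"
      using L2_norm_zero_iff[OF X_transform_L2[OF u]] by (simp add: energy_def)
  qed
  then show ?thesis using L2_norm_zero_iff[OF X_L2[OF u]] by (simp add: nonzero_def)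
qed

lemma energy_tau:
  assumes u: "u \<in> X" shows "tau h u \<in> X" "energy \<omega> (tau h u) = energy \<omega> u"
proof -
  note uL = X_L2[OF u] and T = X_transform_L2[OF u]
  note tL = tau_L2[OF uL, of h]
  have "AE \<zeta> in lborel. FT (tau h u) \<zeta> = cis (h \<bullet> \<zeta>) * FT u \<zeta>"
    by (rule has_fourier_unique[OF has_fourier_FT[OF tL] has_fourier_tau[OF has_fourier_FT[OF uL]]]) simp
  then have ae: "AE \<zeta> in lborel. cis (h \<bullet> \<zeta>) * energy_transform \<omega> u \<zeta> = energy_transform \<omega> (tau h u) \<zeta>"
    by eventually_elim (simp add: energy_transform_def)
  have cT: "(\<lambda>\<zeta>. cis (h \<bullet> \<zeta>) * energy_transform \<omega> u \<zeta>) \<in> L2" by (rule L2_cis_mult[OF T])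
  have tT: "energy_transform \<omega> (tau h u) \<in> L2"
    by (rule L2_cong_AE[OF cT energy_transform_measurable[OF tL] ae])
  show "tau h u \<in> X" using tT tL X_iff_energy_transform[OF \<omega>] by blast
  have "L2_norm (energy_transform \<omega> (tau h u)) = L2_norm (\<lambda>\<zeta>. cis (h \<bullet> \<zeta>) * energy_transform \<omega> u \<zeta>)"
    by (rule L2_norm_cong_AE[symmetric]) (use cT tT ae in auto)
  also have "\<dots> = L2_norm (energy_transform \<omega> u)" by (simp add: L2_norm_def norm_mult)
  finally show "energy \<omega> (tau h u) = energy \<omega> u" by (simp add: energy_def)
qed

end

section \<open>The unit ball of the energy\<close>

lemma cmod_cis_minus_1_sq: "(cmod (cis y - 1))\<^sup>2 \<le> 2 * \<bar>y\<bar>"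
proof -
  have "cmod (cis y - 1) \<le> 2" using norm_triangle_ineq4[of "cis y" 1] by simp
  then have "cmod (cis y - 1) * cmod (cis y - 1) \<le> 2 * \<bar>y\<bar>"
    using cmod_cis_minus_1 by (intro mult_mono) auto
  then show ?thesis by (simp add: power2_eq_square)
qed

text \<open>The \<open>x\<close> part uses \<open>|cis a - 1| \<le> |a|\<close>, the \<open>y\<close> part the interpolation \<open>|cis b - 1|\<^sup>2 \<le> 2|b|\<close> with the
bound 2. For \<open>h\<close> in the box of scale \<open>k\<close> both squares are at most \<open>2 \<cdot> 4\<^sup>-\<^sup>k\<close> times the squared symbol.\<close>
lemma cis_translation_symbol_bound:
  assumes "\<bar>fst h\<bar> \<le> 1 / 2^k" "\<bar>snd h\<bar> \<le> 1 / 4^k" "0 \<le> \<omega>"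
  shows "cmod (cis (h \<bullet> \<zeta>) - 1) \<le> 2 / 2^k * energy_symbol \<omega> \<zeta>"
proof (rule power2_le_imp_le)
  let ?a = "fst h * fst \<zeta>" and ?b = "snd h * snd \<zeta>"
  have eq: "cis (h \<bullet> \<zeta>) - 1 = cis ?a * (cis ?b - 1) + (cis ?a - 1)"
    by (simp add: inner_prod_def cis_mult[symmetric] algebra_simps)
  have "cmod (cis (h \<bullet> \<zeta>) - 1) \<le> cmod (cis ?b - 1) + cmod (cis ?a - 1)"
    unfolding eq using norm_triangle_ineq[of "cis ?a * (cis ?b - 1)" "cis ?a - 1"]
    by (simp only: norm_mult norm_cis mult_1)
  then have "(cmod (cis (h \<bullet> \<zeta>) - 1))\<^sup>2 \<le> (cmod (cis ?b - 1) + cmod (cis ?a - 1))\<^sup>2"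
    by (rule power_mono) simp
  also have "\<dots> \<le> 2 * (cmod (cis ?b - 1))\<^sup>2 + 2 * (cmod (cis ?a - 1))\<^sup>2"
    by (rule sum_square_le)
  also have "(cmod (cis ?b - 1))\<^sup>2 \<le> 2 * (1 / 4^k * \<bar>snd \<zeta>\<bar>)"
  proof -
    have "\<bar>snd h\<bar> * \<bar>snd \<zeta>\<bar> \<le> 1 / 4^k * \<bar>snd \<zeta>\<bar>" using assms(2) by (rule mult_right_mono) simp
    then show ?thesis using cmod_cis_minus_1_sq[of ?b] unfolding abs_mult by linarith
  qed
  also have "(cmod (cis ?a - 1))\<^sup>2 \<le> 1 / 4^k * (fst \<zeta>)\<^sup>2"
  proof -
    have "cmod (cis ?a - 1) \<le> 1 / 2^k * \<bar>fst \<zeta>\<bar>"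
      using cmod_cis_minus_1[of ?a] mult_right_mono[OF assms(1), of "\<bar>fst \<zeta>\<bar>"] unfolding abs_mult by linarith
    then have "(cmod (cis ?a - 1))\<^sup>2 \<le> (1 / 2^k * \<bar>fst \<zeta>\<bar>)\<^sup>2" by (rule power_mono) simp
    also have "\<dots> = 1 / 4^k * (fst \<zeta>)\<^sup>2"
    proof -
      have "(2^k)\<^sup>2 = (4^k :: real)" by (simp add: power2_eq_square flip: power_mult_distrib)
      then show ?thesis by (simp add: power_mult_distrib power_divide)
    qed
    finally show ?thesis .
  qed
  finally have "(cmod (cis (h \<bullet> \<zeta>) - 1))\<^sup>2 \<le> 2 * (2 * (1 / 4^k * \<bar>snd \<zeta>\<bar>)) + 2 * (1 / 4^k * (fst \<zeta>)\<^sup>2)"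
    by simp
  also have "\<dots> \<le> 4 / 4^k * ((fst \<zeta>)\<^sup>2 + \<bar>snd \<zeta>\<bar> + \<omega>)"
    using assms(3) by (simp add: field_simps)
  also have "\<dots> = (2 / 2^k * energy_symbol \<omega> \<zeta>)\<^sup>2"
  proof -
    have "(2^k)\<^sup>2 = (4^k :: real)" by (simp add: power2_eq_square flip: power_mult_distrib)
    then show ?thesis using assms(3) by (simp add: power_mult_distrib power_divide energy_symbol_sq)
  qed
  finally show "(cmod (cis (h \<bullet> \<zeta>) - 1))\<^sup>2 \<le> (2 / 2^k * energy_symbol \<omega> \<zeta>)\<^sup>2" .
qed (use assms(3) in \<open>simp add: energy_symbol_nonneg\<close>)

lemma L2_norm_mono:
  assumes "u \<in> L2" "v \<in> L2" "0 \<le> c" "\<And>z. cmod (u z) \<le> c * cmod (v z)"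
  shows "L2_norm u \<le> c * L2_norm v"
proof -
  have "(L2_norm u)\<^sup>2 \<le> (LINT z|lborel. c\<^sup>2 * (cmod (v z))\<^sup>2)"
    unfolding L2_norm_sq
  proof (rule integral_mono)
    show "(cmod (u z))\<^sup>2 \<le> c\<^sup>2 * (cmod (v z))\<^sup>2" for z
      using power_mono[OF assms(4), of z 2] by (simp add: power_mult_distrib)
  qed (use assms in \<open>auto intro: L2_square_integrable\<close>)
  also have "\<dots> = (c * L2_norm v)\<^sup>2" by (simp add: power_mult_distrib L2_norm_sq)
  finally show ?thesis by (rule power2_le_imp_le) (use assms in simp)
qed

text \<open>Translations by the box of scale \<open>k\<close> move \<open>u\<close> by at most \<open>2\<^sup>1\<^sup>-\<^sup>k\<close>, and the Poincare
inequality doubles this; the bound \<open>1/\<surd>\<omega>\<close> is that of the \<open>L\<^sup>2\<close> norm.\<close>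
lemma energy_ball_dyadic_class:
  assumes \<omega>: "0 < \<omega>" and u: "u \<in> X" and e: "energy \<omega> u \<le> 1"
  shows "u \<in> dyadic_class (max 4 (1 / sqrt \<omega>))"
proof -
  note uL = X_L2[OF u] and T = X_transform_L2[OF \<omega> u] and F = has_fourier_FT[OF X_L2[OF u]]
  have n: "L2_norm (energy_transform \<omega> u) \<le> 1"
    using e L2_norm_nonneg[of "energy_transform \<omega> u"] by (simp add: energy_def power_le_one_iff)
  have 0: "0 \<le> energy_symbol \<omega> \<zeta>" for \<zeta> using \<omega> by (simp add: energy_symbol_nonneg)
  have 1: "L2_norm u \<le> 1 / sqrt \<omega>"
  proof -
    have "L2_norm (FT u) \<le> 1 / sqrt \<omega> * L2_norm (energy_transform \<omega> u)"
    proof (rule L2_norm_mono[OF FT_L2[OF uL] T])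
      fix \<zeta>
      have "sqrt \<omega> * cmod (FT u \<zeta>) \<le> energy_symbol \<omega> \<zeta> * cmod (FT u \<zeta>)"
        using energy_symbol_ge(3)[of \<omega> \<zeta>] \<omega> by (intro mult_right_mono) auto
      then show "cmod (FT u \<zeta>) \<le> 1 / sqrt \<omega> * cmod (energy_transform \<omega> u \<zeta>)"
        using \<omega> 0[of \<zeta>] by (simp add: energy_transform_def norm_mult field_simps)
    qed (use \<omega> in simp)
    also have "\<dots> \<le> 1 / sqrt \<omega> * 1" using n \<omega> by (intro mult_left_mono) auto
    finally show ?thesis using has_fourier_norm[OF F] by simp
  qed
  have 2: "L2_norm (\<lambda>z. tau h u z - u z) \<le> 2 / 2^k" if h: "\<bar>fst h\<bar> \<le> 1 / 2^k" "\<bar>snd h\<bar> \<le> 1 / 4^k" for k h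
  proof -
    have "has_fourier (\<lambda>z. 1 * tau h u z + (-1) * u z) (\<lambda>\<zeta>. 1 * (cis (h \<bullet> \<zeta>) * FT u \<zeta>) + (-1) * FT u \<zeta>)"
      by (intro has_fourier_linear has_fourier_tau F)
    then have d: "has_fourier (\<lambda>z. tau h u z - u z) (\<lambda>\<zeta>. (cis (h \<bullet> \<zeta>) - 1) * FT u \<zeta>)"
      by (simp add: algebra_simps)
    have "L2_norm (\<lambda>\<zeta>. (cis (h \<bullet> \<zeta>) - 1) * FT u \<zeta>) \<le> 2 / 2^k * L2_norm (energy_transform \<omega> u)"
    proof (rule L2_norm_mono[OF has_fourier_L2(2)[OF d] T])
      fix \<zeta>
      show "cmod ((cis (h \<bullet> \<zeta>) - 1) * FT u \<zeta>) \<le> 2 / 2^k * cmod (energy_transform \<omega> u \<zeta>)"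
        using mult_right_mono[OF cis_translation_symbol_bound[OF h less_imp_le[OF \<omega>], of \<zeta>], of "cmod (FT u \<zeta>)"] 0[of \<zeta>]
        by (simp add: energy_transform_def norm_mult)
    qed simp
    also have "\<dots> \<le> 2 / 2^k * 1" using n by (intro mult_left_mono) auto
    finally show ?thesis using has_fourier_norm[OF d] by simp
  qed
  have 3: "avg k u \<in> L2" "L2_norm (\<lambda>z. u z - avg k u z) \<le> 2 * (2 / 2^k)" for k
    by (rule dyadic_Poincare[OF uL 2]; assumption)+
  have "L2_norm (\<lambda>z. u z - avg k u z) \<le> max 4 (1 / sqrt \<omega>) / 2^k" for k
  proof -
    have "4 / 2^k \<le> max 4 (1 / sqrt \<omega>) / 2^k" by (rule divide_right_mono) auto
    then show ?thesis using 3(2)[of k] by simp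
  qed
  then show ?thesis unfolding dyadic_class_def using uL 1 3(1) by (auto intro: max.coboundedI2)
qed

text \<open>Weak convergence in \<open>L\<^sup>2\<close> passes to the energy transforms after they are cut off to bounded frequencies,
where the symbol is a bounded multiplier. The norm bound is uniform in the cut-off, hence survives
its removal, and cut-offs of a fixed test element converge in norm.\<close>
lemma energy_weak_limit:
  assumes \<omega>: "0 < \<omega>" and u: "\<And>n. u n \<in> X" "\<And>n. energy \<omega> (u n) \<le> 1" and v: "v \<in> L2"
    and weak: "\<And>h. h \<in> L2 \<Longrightarrow> (\<lambda>n. ip (u n) h) \<longlonglongrightarrow> ip v h"
  shows "v \<in> X" "energy \<omega> v \<le> 1" "\<And>g. g \<in> X \<Longrightarrow> (\<lambda>n. energy_form \<omega> (u n) g) \<longlonglongrightarrow> energy_form \<omega> v g"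
proof -
  define P where "P n = energy_transform \<omega> (u n)" for n
  have PL: "P n \<in> L2" for n unfolding P_def by (rule X_transform_L2[OF \<omega> u(1)])
  have Pn: "L2_norm (P n) \<le> 1" for n
    using u(2)[of n] L2_norm_nonneg[of "P n"] by (simp add: energy_def P_def power_le_one_iff)
  define V where "V = energy_transform \<omega> v"
  have Vm [measurable]: "V \<in> borel_measurable borel"
    unfolding V_def by (rule energy_transform_measurable[OF v])
  define cut where "cut R f \<zeta> = (if energy_symbol \<omega> \<zeta> \<le> real R then f \<zeta> else 0)" for R and f :: plane_fun and \<zeta>
  have cutm: "cut R f \<in> borel_measurable borel" if "f \<in> borel_measurable borel" for R f
  proof -
    note [measurable] = that
    show ?thesis unfolding cut_def[abs_def] by measurable
  qed
  have 0: "0 \<le> energy_symbol \<omega> \<zeta>" for \<zeta> using \<omega> by (simp add: energy_symbol_nonneg)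
  have cutL: "cut R f \<in> L2" if "f \<in> L2" for R f
    by (rule L2_bound[OF that cutm[OF L2_measurable[OF that]], where c=1]) (auto simp: cut_def)
  have cutlim: "(\<lambda>R. cut R f \<zeta>) \<longlonglongrightarrow> f \<zeta>" for f \<zeta>
  proof (rule tendsto_eventually)
    obtain n0 :: nat where n0: "energy_symbol \<omega> \<zeta> \<le> real n0" using real_arch_simple by blast
    show "\<forall>\<^sub>F R in sequentially. cut R f \<zeta> = f \<zeta>"
      using eventually_ge_at_top[of n0] by eventually_elim (use n0 in \<open>auto simp: cut_def\<close>)
  qed
  have main: "(\<lambda>n. ip (P n) (cut R f)) \<longlonglongrightarrow> ip V (cut R f)" if f: "f \<in> L2" for R f
  proof -
    define K where "K \<zeta> = complex_of_real (energy_symbol \<omega> \<zeta>) * cut R f \<zeta>" for \<zeta>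
    have Km: "K \<in> borel_measurable borel"
      unfolding K_def using cutm[OF L2_measurable[OF f], of R] by measurable
    have KL: "K \<in> L2"
    proof (rule L2_bound[OF f Km, where c="real R"])
      show "cmod (K \<zeta>) \<le> real R * cmod (f \<zeta>)" for \<zeta>
        using 0[of \<zeta>] by (auto simp: K_def cut_def norm_mult mult_right_mono)
    qed
    obtain h where h: "has_fourier h K" using has_fourier_surj[OF KL] .
    have eq: "ip (energy_transform \<omega> g) (cut R f) = ip g h" if g: "g \<in> L2" for g
    proof -
      have "ip (energy_transform \<omega> g) (cut R f) = ip (FT g) K"
        unfolding ip_def by (simp add: energy_transform_def K_def ac_simps)
      then show ?thesis using has_fourier_ip[OF has_fourier_FT[OF g] h] by simp
    qed
    show ?thesis
      unfolding P_def V_def eq[OF X_L2[OF u(1)]] eq[OF v]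
      by (rule weak) (use has_fourier_L2(1)[OF h] in simp)
  qed
  define W where "W R = cut R V" for R
  have WL: "W R \<in> L2" for R
  proof (rule L2_bound[OF FT_L2[OF v], where c="real R"])
    show "W R \<in> borel_measurable borel" unfolding W_def by (rule cutm[OF Vm])
    show "cmod (W R \<zeta>) \<le> real R * cmod (FT v \<zeta>)" for \<zeta>
      using 0[of \<zeta>] by (auto simp: W_def cut_def V_def energy_transform_def norm_mult mult_right_mono)
  qed
  have W1: "L2_norm (W R) \<le> 1" for R
  proof -
    have cc: "cut R (W R) = W R" by (auto simp: W_def cut_def fun_eq_iff)
    have "(\<lambda>n. ip (P n) (W R)) \<longlonglongrightarrow> ip V (W R)" using main[OF WL, of R R] unfolding cc .
    moreover have "ip V (W R) = ip (W R) (W R)"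
      unfolding ip_def by (rule Bochner_Integration.integral_cong) (auto simp: W_def cut_def)
    ultimately have "(\<lambda>n. cmod (ip (P n) (W R))) \<longlonglongrightarrow> (L2_norm (W R))\<^sup>2"
      using tendsto_norm by (fastforce simp: ip_self norm_power)
    moreover have "cmod (ip (P n) (W R)) \<le> L2_norm (W R)" for n
      using ip_Cauchy_Schwarz[OF PL WL, of n R] mult_right_mono[OF Pn, of "L2_norm (W R)" n] by simp
    ultimately have "(L2_norm (W R))\<^sup>2 \<le> L2_norm (W R)" by (intro LIMSEQ_le_const2) auto
    then have "L2_norm (W R) * L2_norm (W R) \<le> L2_norm (W R) * 1" by (simp add: power2_eq_square)
    then show ?thesis using L2_norm_nonneg[of "W R"] by (cases "L2_norm (W R) = 0") auto
  qed
  have W_ae: "AE \<zeta> in lborel. (\<lambda>R. W R \<zeta>) \<longlonglongrightarrow> V \<zeta>"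
    unfolding W_def by (intro AE_I2 cutlim)
  note VL = L2_Fatou(1)[where f=W, OF WL W1 Vm W_ae] and V1 = L2_Fatou(2)[where f=W, OF WL W1 Vm W_ae]
  show vX: "v \<in> X" using VL v X_iff_energy_transform[OF \<omega>] unfolding V_def by blast
  show "energy \<omega> v \<le> 1" using V1 by (simp add: energy_def V_def power_le_one_iff)
  fix g assume g: "g \<in> X"
  define f where "f = energy_transform \<omega> g"
  have f: "f \<in> L2" unfolding f_def by (rule X_transform_L2[OF \<omega> g])
  have "(\<lambda>n. ip (P n) f) \<longlonglongrightarrow> ip V f"
  proof (rule LIMSEQ_I)
    fix e :: real assume e: "0 < e"
    have cb: "cmod (cut R f \<zeta>) \<le> cmod (f \<zeta>)" for R \<zeta> by (simp add: cut_def)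
    note c = L2_dominated[where f="\<lambda>R. cut R f" and w="\<lambda>z. cmod (f z)", OF cutm[OF L2_measurable[OF f]] L2_measurable[OF f] L2_square_integrable[OF f] cb AE_I2[OF cutlim]]
    have "eventually (\<lambda>R. L2_norm (\<lambda>z. cut R f z - f z) < e/4) sequentially"
      by (rule order_tendstoD(2)[OF c(3)]) (use e in simp)
    then obtain R where R: "L2_norm (\<lambda>z. cut R f z - f z) < e/4" by (auto simp: eventually_sequentially)
    from LIMSEQ_D[OF main[OF f, of R], of "e/2"] e obtain N where
      N: "\<And>n. N \<le> n \<Longrightarrow> cmod (ip (P n) (cut R f) - ip V (cut R f)) < e/2" by auto
    have "cmod (ip (P n) f - ip V f) < e" if n: "N \<le> n" for n
    proof -
      define d where "d z = P n z - V z" for z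
      have dL: "d \<in> L2" unfolding d_def by (rule L2_diff[OF PL VL])
      have dn: "L2_norm d \<le> 2"
        using L2_norm_diff_le[OF PL VL, of n] Pn[of n] V1 unfolding d_def by linarith
      have "ip (P n) f - ip V f = ip d f"
        unfolding d_def by (rule ip_diff_left[OF PL VL f, symmetric])
      also have "\<dots> = ip d (cut R f) - ip d (\<lambda>z. cut R f z - f z)"
        by (simp add: ip_diff_right[OF dL c(1) f])
      also have "cmod \<dots> \<le> cmod (ip d (cut R f)) + cmod (ip d (\<lambda>z. cut R f z - f z))"
        by (rule norm_triangle_ineq4)
      also have "cmod (ip d (cut R f)) < e/2"
        using N[OF n] unfolding d_def ip_diff_left[OF PL VL c(1)] .
      also have "cmod (ip d (\<lambda>z. cut R f z - f z)) \<le> 2 * (e/4)"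
      proof (rule order_trans[OF ip_Cauchy_Schwarz[OF dL L2_diff[OF c(1) f]]])
        show "L2_norm d * L2_norm (\<lambda>z. cut R f z - f z) \<le> 2 * (e/4)"
          using R dn by (intro mult_mono) auto
      qed
      finally show ?thesis by simp
    qed
    then show "\<exists>no. \<forall>n\<ge>no. norm (ip (P n) f - ip V f) < e" by blast
  qed
  then show "(\<lambda>n. energy_form \<omega> (u n) g) \<longlonglongrightarrow> energy_form \<omega> v g"
    unfolding energy_form_def P_def V_def f_def .
qed

text \<open>The inverse transform of the indicator function of a box: its frequencies are bounded.\<close>
lemma X_nontrivial: obtains u where "u \<in> X" "nonzero u"
proof -
  obtain u where u: "has_fourier u (cell_ind 0 0)" using has_fourier_surj[OF cell_ind_L2] .
  note L = has_fourier_L2[OF u]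
  have b: "\<bar>fst \<zeta>\<bar> \<le> 1 \<and> \<bar>snd \<zeta>\<bar> \<le> 1" if "cell_ind 0 0 \<zeta> \<noteq> 0" for \<zeta>
    using that by (auto simp: cell_ind_def dyadic_cell_def floor_eq_iff split: if_splits)
  have "u \<in> X"
  proof (rule XI_fourier[OF u])
    show "(\<lambda>\<zeta>. complex_of_real (fst \<zeta>) * cell_ind 0 0 \<zeta>) \<in> L2"
    proof (rule L2_bound[OF L(2), where c=1])
      show "cmod (complex_of_real (fst \<zeta>) * cell_ind 0 0 \<zeta>) \<le> 1 * cmod (cell_ind 0 0 \<zeta>)" for \<zeta>
        using b[of \<zeta>] by (cases "cell_ind 0 0 \<zeta> = 0") (auto simp: norm_mult mult_left_le_one_le)
    qed measurable
    show "(\<lambda>\<zeta>. complex_of_real (sqrt \<bar>snd \<zeta>\<bar>) * cell_ind 0 0 \<zeta>) \<in> L2"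
    proof (rule L2_bound[OF L(2), where c=1])
      show "cmod (complex_of_real (sqrt \<bar>snd \<zeta>\<bar>) * cell_ind 0 0 \<zeta>) \<le> 1 * cmod (cell_ind 0 0 \<zeta>)" for \<zeta>
        using b[of \<zeta>] by (cases "cell_ind 0 0 \<zeta> = 0") (auto simp: norm_mult mult_left_le_one_le)
    qed measurable
  qed
  moreover have "L2_norm u = 1" using has_fourier_norm[OF u] by (simp add: cell_ind_norm)
  then have "nonzero u" using L2_norm_zero_iff[OF L(1)] by (auto simp: nonzero_def)
  ultimately show ?thesis using that by blast
qed

section \<open>Differentiation of the power functional\<close>

text \<open>One \<open>q\<close>-th of the derivative of \<open>|a|\<^sup>q\<close> in the direction \<open>b\<close>, for the real structure of \<open>\<complex>\<close>.\<close>
definition power_deriv :: "real \<Rightarrow> complex \<Rightarrow> complex \<Rightarrow> real" where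
  "power_deriv q a b = cmod a powr (q - 2) * Re (a * cnj b)"

lemma power_has_derivative:
  assumes q: "2 < q"
  shows "((\<lambda>t. cmod (a + complex_of_real t * b) powr q) has_real_derivative
    q * power_deriv q (a + complex_of_real t * b) b) (at t)"
proof (cases "a + complex_of_real t * b = 0")
  case False
  define N where "N s = (cmod a)\<^sup>2 + 2 * s * Re (a * cnj b) + s\<^sup>2 * (cmod b)\<^sup>2" for s
  have N: "(cmod (a + complex_of_real s * b))\<^sup>2 = N s" for s
    unfolding N_def cmod_power2 by (simp add: power2_eq_square algebra_simps)
  have Nt: "0 < N t" using False unfolding N[symmetric] by simp
  have eq: "cmod (a + complex_of_real s * b) powr q = N s powr (q / 2)" for s
    unfolding N[symmetric] by (simp add: powr_powr flip: powr_numeral)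
  have "(N has_real_derivative 2 * Re (a * cnj b) + 2 * t * (cmod b)\<^sup>2) (at t)"
    unfolding N_def by (auto intro!: derivative_eq_intros)
  from DERIV_fun_powr[OF this Nt, of "q / 2"]
  have "((\<lambda>s. N s powr (q / 2)) has_real_derivative q / 2 * N t powr (q / 2 - 1) * (2 * Re (a * cnj b) + 2 * t * (cmod b)\<^sup>2)) (at t)"
    by simp
  moreover have "N t powr (q / 2 - 1) = cmod (a + complex_of_real t * b) powr (q - 2)"
    unfolding N[symmetric] by (simp add: powr_powr right_diff_distrib flip: powr_numeral)
  moreover have "Re ((a + complex_of_real t * b) * cnj b) = Re (a * cnj b) + t * (cmod b)\<^sup>2"
    unfolding cmod_power2 by (simp add: power2_eq_square algebra_simps)
  ultimately show ?thesis unfolding eq power_deriv_def by (simp add: algebra_simps)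
next
  case True
  have d0: "power_deriv q (a + complex_of_real t * b) b = 0" unfolding True by (simp add: power_deriv_def)
  have eq: "cmod (a + complex_of_real s * b) powr q = \<bar>s - t\<bar> powr q * cmod b powr q" for s
  proof -
    have "a + complex_of_real s * b = complex_of_real (s - t) * b" using True by (simp add: algebra_simps add_eq_0_iff)
    then show ?thesis by (simp add: norm_mult powr_mult del: of_real_diff)
  qed
  have "((\<lambda>h. \<bar>h\<bar> powr (q - 1) * cmod b powr q) \<longlongrightarrow> \<bar>0\<bar> powr (q - 1) * cmod b powr q) (at 0)"
    using q by (intro tendsto_mult tendsto_const tendsto_powr' tendsto_rabs tendsto_ident_at) auto
  then have "((\<lambda>h. \<bar>h\<bar> powr (q - 1) * cmod b powr q) \<longlongrightarrow> 0) (at 0)" using q by simp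
  then have "((\<lambda>h. (cmod (a + complex_of_real (t + h) * b) powr q - cmod (a + complex_of_real t * b) powr q) / h) \<longlongrightarrow> 0) (at 0)"
  proof (rule Lim_null_comparison[rotated])
    show "\<forall>\<^sub>F h in at 0. norm ((cmod (a + complex_of_real (t + h) * b) powr q - cmod (a + complex_of_real t * b) powr q) / h)
       \<le> \<bar>h\<bar> powr (q - 1) * cmod b powr q"
      unfolding eventually_at_filter
    proof (intro always_eventually allI impI)
      fix h :: real assume h: "h \<noteq> 0"
      have "\<bar>h\<bar> powr q = \<bar>h\<bar> powr (q - 1) * \<bar>h\<bar>"
        using h powr_add[of "\<bar>h\<bar>" "q - 1" 1] by simp
      then show "norm ((cmod (a + complex_of_real (t + h) * b) powr q - cmod (a + complex_of_real t * b) powr q) / h)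
       \<le> \<bar>h\<bar> powr (q - 1) * cmod b powr q"
        unfolding eq using h q by (simp add: abs_mult)
    qed
  qed
  then show ?thesis unfolding d0 by (simp add: DERIV_def)
qed

lemma continuous_on_power_deriv:
  assumes "2 < q" "continuous_on S f" "continuous_on S g"
  shows "continuous_on S (\<lambda>x. power_deriv q (f x) (g x))"
  unfolding power_deriv_def using assms
  by (intro continuous_intros continuous_on_powr') auto

lemma power_deriv_scale:
  assumes "0 < m" "2 < q"
  shows "power_deriv q (complex_of_real m * a) (complex_of_real m * b) = m powr q * power_deriv q a b"
proof -
  have "m powr (q - 2) * (m * m) = m powr q"
    using assms powr_split_square[of m q] by (simp add: power2_eq_square)
  moreover have "Re (complex_of_real m * a * cnj (complex_of_real m * b)) = (m * m) * Re (a * cnj b)"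
    by (simp add: algebra_simps)
  ultimately show ?thesis unfolding power_deriv_def
    using assms by (simp add: norm_mult powr_mult ac_simps)
qed

text \<open>Both sides are homogeneous of degree \<open>q\<close> in \<open>(a, b)\<close>, so that it suffices to treat \<open>|a|, |b| \<le> 1\<close>. There the
mean value theorem applies, and the derivative is uniformly continuous by compactness.\<close>
lemma power_expansion:
  assumes q: "2 < q" and \<epsilon>: "0 < \<epsilon>"
  obtains \<delta> where "0 < \<delta>" "\<And>a b t. 0 \<le> t \<Longrightarrow> t \<le> \<delta> \<Longrightarrow>
    \<bar>cmod (a + complex_of_real t * b) powr q - cmod a powr q - q * t * power_deriv q a b\<bar>
     \<le> t * \<epsilon> * (cmod a powr q + cmod b powr q)"
proof -
  define S where "S = cball (0::complex) 1 \<times> cball (0::complex) 1 \<times> {0..1::real}"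
  define F where "F x = power_deriv q (fst x + complex_of_real (snd (snd x)) * fst (snd x)) (fst (snd x))"
    for x :: "complex \<times> complex \<times> real"
  have "compact S" unfolding S_def by (intro compact_Times compact_cball compact_Icc)
  moreover have "continuous_on S F"
    unfolding F_def by (intro continuous_on_power_deriv q continuous_intros)
  ultimately have "uniformly_continuous_on S F" by (rule compact_uniformly_continuous[rotated])
  moreover have "0 < \<epsilon> / q" using \<epsilon> q by simp
  ultimately obtain d where d: "0 < d" "\<And>x y. x \<in> S \<Longrightarrow> y \<in> S \<Longrightarrow> dist y x < d \<Longrightarrow> dist (F y) (F x) < \<epsilon> / q"
    unfolding uniformly_continuous_on_def by metis
  (* the bound 1 keeps the intermediate point of the mean value theorem in the compact set S *)
  define \<delta> where "\<delta> = min 1 (d / 2)"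
  have \<delta>: "0 < \<delta>" using d by (simp add: \<delta>_def)
  have unit: "\<bar>cmod (a + complex_of_real t * b) powr q - cmod a powr q - q * t * power_deriv q a b\<bar> \<le> t * \<epsilon>"
    if a: "cmod a \<le> 1" and b: "cmod b \<le> 1" and t: "0 \<le> t" "t \<le> \<delta>" for a b t
  proof (cases "t = 0")
    case False
    then have "0 < t" using t by simp
    then obtain s where s: "0 < s" "s < t" and mv: "cmod (a + complex_of_real t * b) powr q - cmod (a + complex_of_real 0 * b) powr q
        = (t - 0) * (q * power_deriv q (a + complex_of_real s * b) b)"
      using MVT2[of 0 t "\<lambda>t. cmod (a + complex_of_real t * b) powr q" "\<lambda>s. q * power_deriv q (a + complex_of_real s * b) b"]
        power_has_derivative[OF q] by blast
    have "dist (F (a, b, s)) (F (a, b, 0)) < \<epsilon> / q"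
    proof (rule d(2))
      show "(a, b, 0) \<in> S" "(a, b, s) \<in> S" using a b s t by (auto simp: S_def \<delta>_def)
      show "dist (a, b, s) (a, b, 0) < d" using s t d by (simp add: dist_Pair_Pair dist_real_def \<delta>_def)
    qed
    then have "\<bar>power_deriv q (a + complex_of_real s * b) b - power_deriv q a b\<bar> \<le> \<epsilon> / q"
      by (simp add: F_def dist_real_def)
    then have "q * t * \<bar>power_deriv q (a + complex_of_real s * b) b - power_deriv q a b\<bar> \<le> q * t * (\<epsilon> / q)"
      using q t by (intro mult_left_mono) auto
    then have "\<bar>q * t * (power_deriv q (a + complex_of_real s * b) b - power_deriv q a b)\<bar> \<le> t * \<epsilon>"
      using q t by (simp add: abs_mult)
    moreover have "cmod (a + complex_of_real t * b) powr q - cmod a powr q - q * t * power_deriv q a b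
       = q * t * (power_deriv q (a + complex_of_real s * b) b - power_deriv q a b)"
      using mv by (simp add: algebra_simps)
    ultimately show ?thesis by simp
  qed simp
  have "\<bar>cmod (a + complex_of_real t * b) powr q - cmod a powr q - q * t * power_deriv q a b\<bar>
     \<le> t * \<epsilon> * (cmod a powr q + cmod b powr q)" if t: "0 \<le> t" "t \<le> \<delta>" for a b t
  proof -
    define m where "m = max (cmod a) (cmod b)"
    show ?thesis
    proof (cases "m = 0")
      case True
      then have "a = 0" "b = 0" unfolding m_def by (auto simp: max_def split: if_splits)
      then show ?thesis by (simp add: power_deriv_def)
    next
      case False
      then have m: "0 < m" unfolding m_def by (auto simp: max_def split: if_splits)
      define a' b' where "a' = a / complex_of_real m" and "b' = b / complex_of_real m"
      have ab: "a = complex_of_real m * a'" "b = complex_of_real m * b'" using m by (auto simp: a'_def b'_def)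
      have le: "cmod a' \<le> 1" "cmod b' \<le> 1"
        using m by (auto simp: a'_def b'_def norm_divide m_def)
      have "cmod (a + complex_of_real t * b) powr q = m powr q * cmod (a' + complex_of_real t * b') powr q"
      proof -
        have "a + complex_of_real t * b = complex_of_real m * (a' + complex_of_real t * b')"
          by (simp add: ab algebra_simps)
        then show ?thesis using m by (simp only: norm_mult) (simp add: powr_mult)
      qed
      moreover have "cmod a powr q = m powr q * cmod a' powr q" using m by (simp add: ab norm_mult powr_mult)
      moreover have "power_deriv q a b = m powr q * power_deriv q a' b'"
        unfolding ab by (rule power_deriv_scale[OF m q])
      ultimately have "cmod (a + complex_of_real t * b) powr q - cmod a powr q - q * t * power_deriv q a b
        = m powr q * (cmod (a' + complex_of_real t * b') powr q - cmod a' powr q - q * t * power_deriv q a' b')"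
        by (simp add: algebra_simps)
      then have "\<bar>cmod (a + complex_of_real t * b) powr q - cmod a powr q - q * t * power_deriv q a b\<bar> \<le> m powr q * (t * \<epsilon>)"
        using unit[OF le t] by (simp add: abs_mult mult_left_mono)
      also have "\<dots> \<le> (cmod a powr q + cmod b powr q) * (t * \<epsilon>)"
        using t \<epsilon> by (intro mult_right_mono) (auto simp: m_def max_def)
      finally show ?thesis by (simp add: ac_simps)
    qed
  qed
  then show ?thesis using that[OF \<delta>] by blast
qed

text \<open>The case distinction \<open>|b| \<le> \<epsilon>|a|\<close> yields this form of Young's inequality, with a small factor on the
term that is merely bounded.\<close>
lemma power_deriv_young:
  assumes q: "2 < q" and \<epsilon>: "0 < \<epsilon>"
  shows "\<bar>power_deriv q a b\<bar> \<le> \<epsilon> * cmod a powr q + \<epsilon> powr (1 - q) * cmod b powr q"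
proof -
  let ?x = "cmod a" and ?y = "cmod b"
  have xx: "?x powr (q - 2) * ?x = ?x powr (q - 1)"
    using powr_add[of ?x "q - 2" 1] by (cases "a = 0") auto
  have "\<bar>Re (a * cnj b)\<bar> \<le> ?x * ?y" using abs_Re_le_cmod[of "a * cnj b"] by (simp add: norm_mult)
  then have "\<bar>power_deriv q a b\<bar> \<le> ?x powr (q - 2) * (?x * ?y)"
    unfolding power_deriv_def abs_mult by (simp add: mult_left_mono)
  also have "\<dots> = ?x powr (q - 1) * ?y" by (simp only: mult.assoc[symmetric] xx)
  also have "\<dots> \<le> \<epsilon> * ?x powr q + \<epsilon> powr (1 - q) * ?y powr q"
  proof (cases "?y \<le> \<epsilon> * ?x")
    case True
    have "?x powr (q - 1) * ?y \<le> ?x powr (q - 1) * (\<epsilon> * ?x)" using True by (rule mult_left_mono) simp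
    also have "\<dots> = \<epsilon> * ?x powr q" using powr_add[of ?x "q - 1" 1] by (cases "a = 0") auto
    finally show ?thesis by (rule order_trans) simp
  next
    case False
    then have "?x \<le> ?y / \<epsilon>" using \<epsilon> by (simp add: field_simps)
    then have "?x powr (q - 1) \<le> (?y / \<epsilon>) powr (q - 1)" using q by (intro powr_mono2) auto
    then have "?x powr (q - 1) * ?y \<le> (?y / \<epsilon>) powr (q - 1) * ?y" by (rule mult_right_mono) simp
    also have "\<dots> = \<epsilon> powr (1 - q) * ?y powr q"
    proof -
      have "?y powr (q - 1) * ?y = ?y powr q" using powr_add[of ?y "q - 1" 1] by (cases "b = 0") auto
      moreover have "\<epsilon> powr (1 - q) = 1 / \<epsilon> powr (q - 1)" using powr_minus_divide[of \<epsilon> "q - 1"] by simp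
      moreover have "(?y / \<epsilon>) powr (q - 1) = ?y powr (q - 1) / \<epsilon> powr (q - 1)" using \<epsilon> by (simp add: powr_divide)
      ultimately show ?thesis by simp
    qed
    also have "\<dots> \<le> \<epsilon> * ?x powr q + \<epsilon> powr (1 - q) * ?y powr q" using \<epsilon> by simp
    finally show ?thesis .
  qed
  finally show ?thesis .
qed

definition Lq :: "real \<Rightarrow> plane_fun set" where
  "Lq q = {u. u \<in> borel_measurable borel \<and> integrable lborel (\<lambda>z. cmod (u z) powr q)}"

definition Lq_deriv :: "real \<Rightarrow> plane_fun \<Rightarrow> plane_fun \<Rightarrow> real" where
  "Lq_deriv q u v = (LINT z|lborel. power_deriv q (u z) (v z))"

lemma LqD: "u \<in> Lq q \<Longrightarrow> u \<in> borel_measurable borel" "u \<in> Lq q \<Longrightarrow> integrable lborel (\<lambda>z. cmod (u z) powr q)"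
  by (auto simp: Lq_def)

lemma power_deriv_measurable [measurable]:
  assumes [measurable]: "u \<in> borel_measurable borel" "v \<in> borel_measurable borel"
  shows "(\<lambda>z. power_deriv q (u z) (v z)) \<in> borel_measurable borel"
  unfolding power_deriv_def by measurable

lemma integrable_power_deriv:
  assumes q: "2 < q" and u: "u \<in> Lq q" and v: "v \<in> Lq q"
  shows "integrable lborel (\<lambda>z. power_deriv q (u z) (v z))"
proof (rule Bochner_Integration.integrable_bound)
  note [measurable] = LqD(1)[OF u] LqD(1)[OF v]
  show "integrable lborel (\<lambda>z. cmod (u z) powr q + cmod (v z) powr q)" using LqD(2) u v by auto
  show "AE z in lborel. norm (power_deriv q (u z) (v z)) \<le> norm (cmod (u z) powr q + cmod (v z) powr q)"
    using power_deriv_young[OF q, of 1] by (intro AE_I2) simp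
  show "(\<lambda>z. power_deriv q (u z) (v z)) \<in> borel_measurable lborel" by measurable
qed

lemma Lq_norm_pow_nonneg: "0 \<le> Lq_norm_pow q u"
  by (simp add: Lq_norm_pow_def)

lemma Lq_expansion:
  assumes q: "2 < q" and \<epsilon>: "0 < \<epsilon>"
  obtains \<delta> where "0 < \<delta>" "\<And>u v t. u \<in> Lq q \<Longrightarrow> v \<in> Lq q \<Longrightarrow> (\<lambda>z. u z + complex_of_real t * v z) \<in> Lq q \<Longrightarrow>
    0 \<le> t \<Longrightarrow> t \<le> \<delta> \<Longrightarrow>
    \<bar>Lq_norm_pow q (\<lambda>z. u z + complex_of_real t * v z) - Lq_norm_pow q u - q * t * Lq_deriv q u v\<bar>
     \<le> t * \<epsilon> * (Lq_norm_pow q u + Lq_norm_pow q v)"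
proof -
  obtain \<delta> where \<delta>: "0 < \<delta>" "\<And>a b t. 0 \<le> t \<Longrightarrow> t \<le> \<delta> \<Longrightarrow>
    \<bar>cmod (a + complex_of_real t * b) powr q - cmod a powr q - q * t * power_deriv q a b\<bar>
     \<le> t * \<epsilon> * (cmod a powr q + cmod b powr q)" by (rule power_expansion[OF q \<epsilon>]) (rule that)
  have "\<bar>Lq_norm_pow q (\<lambda>z. u z + complex_of_real t * v z) - Lq_norm_pow q u - q * t * Lq_deriv q u v\<bar>
     \<le> t * \<epsilon> * (Lq_norm_pow q u + Lq_norm_pow q v)"
    if u: "u \<in> Lq q" and v: "v \<in> Lq q" and uv: "(\<lambda>z. u z + complex_of_real t * v z) \<in> Lq q" and t: "0 \<le> t" "t \<le> \<delta>" for u v t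
  proof -
    note I = LqD(2)[OF u] LqD(2)[OF v] LqD(2)[OF uv] integrable_power_deriv[OF q u v]
    have "Lq_norm_pow q (\<lambda>z. u z + complex_of_real t * v z) - Lq_norm_pow q u - q * t * Lq_deriv q u v =
      (LINT z|lborel. cmod (u z + complex_of_real t * v z) powr q - cmod (u z) powr q - q * t * power_deriv q (u z) (v z))"
      unfolding Lq_norm_pow_def Lq_deriv_def using I by simp
    also have "\<bar>\<dots>\<bar> \<le> (LINT z|lborel. t * \<epsilon> * (cmod (u z) powr q + cmod (v z) powr q))"
      using I by (intro integral_abs_bound[THEN order_trans] integral_mono \<delta>(2) t) auto
    also have "\<dots> = t * \<epsilon> * (Lq_norm_pow q u + Lq_norm_pow q v)"
      unfolding Lq_norm_pow_def using I by simp
    finally show ?thesis .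
  qed
  then show ?thesis using that[OF \<delta>(1)] by blast
qed

text \<open>The functions \<open>u n\<close> need not converge in \<open>L\<^sup>q\<close>. By Young's inequality the difference of the
integrands is at most \<open>\<epsilon> |u n|\<^sup>q\<close> plus a fixed integrable function \<open>w\<close>; the first part has small
integral, and the rest converges by domination.\<close>
lemma Lq_deriv_tendsto:
  assumes q: "2 < q" and u: "\<And>n. u n \<in> Lq q" "\<And>n. Lq_norm_pow q (u n) \<le> C"
    and v: "v \<in> Lq q" and g: "g \<in> Lq q" and ae: "AE z in lborel. (\<lambda>n. u n z) \<longlonglongrightarrow> v z"
  shows "(\<lambda>n. Lq_deriv q (u n) g) \<longlonglongrightarrow> Lq_deriv q v g"
proof (rule LIMSEQ_I)
  fix e :: real assume e: "0 < e"
  note [measurable] = LqD(1)[OF u(1)] LqD(1)[OF v] LqD(1)[OF g]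
  have C: "0 \<le> C" using u(2)[of 0] Lq_norm_pow_nonneg[of q "u 0"] by linarith
  define \<epsilon> where "\<epsilon> = e / (2 * (C + 1))"
  have \<epsilon>: "0 < \<epsilon>" using e C by (simp add: \<epsilon>_def)
  have \<epsilon>C: "\<epsilon> * C < e / 2"
  proof -
    have "\<epsilon> * C < \<epsilon> * (C + 1)" using \<epsilon> by simp
    also have "\<dots> = e / 2"
    proof -
      have *: "e / (2 * x) * x = e / 2" if "x \<noteq> 0" for x :: real using that by simp
      show ?thesis unfolding \<epsilon>_def by (rule *) (use C in linarith)
    qed
    finally show ?thesis .
  qed
  (* the two applications of the inequality of Young, to u n and to v, without the term in u n *)
  define w where "w z = \<epsilon> * cmod (v z) powr q + 2 * (\<epsilon> powr (1 - q) * cmod (g z) powr q)" for z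
  have w: "integrable lborel w" unfolding w_def using LqD(2)[OF v] LqD(2)[OF g] by simp
  have w0: "0 \<le> w z" for z unfolding w_def using \<epsilon> by simp
  define d where "d n z = \<bar>power_deriv q (u n z) (g z) - power_deriv q (v z) (g z)\<bar>" for n z
  have [measurable]: "d n \<in> borel_measurable borel" "w \<in> borel_measurable borel" for n
    unfolding d_def w_def by measurable
  have d_le: "d n z \<le> min (d n z) (w z) + \<epsilon> * cmod (u n z) powr q" for n z
  proof -
    have "d n z \<le> \<bar>power_deriv q (u n z) (g z)\<bar> + \<bar>power_deriv q (v z) (g z)\<bar>"
      unfolding d_def by (rule abs_triangle_ineq4)
    then have "d n z \<le> w z + \<epsilon> * cmod (u n z) powr q"
      using power_deriv_young[OF q \<epsilon>, of "u n z" "g z"] power_deriv_young[OF q \<epsilon>, of "v z" "g z"] unfolding w_def by linarith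
    moreover have "0 \<le> \<epsilon> * cmod (u n z) powr q" using \<epsilon> by simp
    ultimately show ?thesis by (simp add: min_def)
  qed
  have d0: "0 \<le> d n z" for n z by (simp add: d_def)
  have d_int: "integrable lborel (d n)" for n
    unfolding d_def by (intro integrable_abs Bochner_Integration.integrable_diff integrable_power_deriv q u v g)
  have m_int: "integrable lborel (\<lambda>z. min (d n z) (w z))" for n
    by (rule Bochner_Integration.integrable_bound[OF w]) (use d0 w0 in \<open>auto simp: min_def\<close>)
  have "(\<lambda>n. LINT z|lborel. min (d n z) (w z)) \<longlonglongrightarrow> (LINT z|(lborel :: (real \<times> real) measure). 0 :: real)"
  proof (rule integral_dominated_convergence[where w=w])
    show "AE z in lborel. (\<lambda>n. min (d n z) (w z)) \<longlonglongrightarrow> 0"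
      using ae
    proof eventually_elim
      case (elim z)
      have "continuous_on UNIV (\<lambda>x. power_deriv q x (g z))"
        by (intro continuous_on_power_deriv q continuous_intros)
      then have "isCont (\<lambda>x. power_deriv q x (g z)) (v z)" by (rule continuous_on_interior) simp
      from isCont_tendsto_compose[OF this elim]
      have "(\<lambda>n. d n z) \<longlonglongrightarrow> \<bar>power_deriv q (v z) (g z) - power_deriv q (v z) (g z)\<bar>"
        unfolding d_def by (intro tendsto_intros)
      then have "(\<lambda>n. d n z) \<longlonglongrightarrow> 0" by simp
      then show ?case
        by (rule Lim_null_comparison[rotated]) (use d0[of _ z] w0[of z] in \<open>auto simp: min_def\<close>)
    qed
    show "AE z in lborel. norm (min (d n z) (w z)) \<le> w z" for n
      using d0 w0 by (auto simp: min_def)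
  qed (use w in auto)
  then have "eventually (\<lambda>n. (LINT z|lborel. min (d n z) (w z)) < e/2) sequentially"
    using e by (intro order_tendstoD(2)) auto
  then obtain N where N: "\<And>n. N \<le> n \<Longrightarrow> (LINT z|lborel. min (d n z) (w z)) < e/2"
    by (auto simp: eventually_sequentially)
  have "norm (Lq_deriv q (u n) g - Lq_deriv q v g) < e" if n: "N \<le> n" for n
  proof -
    have "Lq_deriv q (u n) g - Lq_deriv q v g = (LINT z|lborel. power_deriv q (u n z) (g z) - power_deriv q (v z) (g z))"
      unfolding Lq_deriv_def using integrable_power_deriv[OF q u(1) g] integrable_power_deriv[OF q v g] by simp
    also have "norm \<dots> \<le> (LINT z|lborel. d n z)"
      unfolding d_def real_norm_def by (rule integral_abs_bound)
    also have "\<dots> \<le> (LINT z|lborel. min (d n z) (w z) + \<epsilon> * cmod (u n z) powr q)"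
      by (rule integral_mono[OF d_int _ d_le]) (use m_int LqD(2)[OF u(1)] in auto)
    also have "\<dots> = (LINT z|lborel. min (d n z) (w z)) + \<epsilon> * Lq_norm_pow q (u n)"
      unfolding Lq_norm_pow_def using m_int LqD(2)[OF u(1)] by simp
    also have "\<dots> < e/2 + e/2"
      using N[OF n] \<epsilon>C mult_left_mono[OF u(2)[of n] less_imp_le[OF \<epsilon>]] by linarith
    finally show ?thesis by simp
  qed
  then show "\<exists>no. \<forall>n\<ge>no. norm (Lq_deriv q (u n) g - Lq_deriv q v g) < e" by blast
qed

section \<open>Maximizing sequences for the embedding constant\<close>

text \<open>Translating the corner of the box of \<open>z\<close> to the origin keeps the dyadic grid of that scale.\<close>
lemma avg_tau_corner:
  assumes [measurable]: "u \<in> borel_measurable borel"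
  shows "\<exists>h. avg k (tau h u) 0 = avg k u z"
proof
  define h where "h = (real_of_int \<lfloor>2^k * fst z\<rfloor> / 2^k, real_of_int \<lfloor>4^k * snd z\<rfloor> / 4^k)"
  have c: "cell_ind k 0 w = cell_ind k z (w + h)" for w
    unfolding cell_ind_def dyadic_cell_def by (simp add: h_def distrib_left)
  have "ip (tau h u) (cell_ind k 0) = (LINT w|lborel. u (w + h) * cnj (cell_ind k z (w + h)))"
    unfolding ip_def tau_def c ..
  also have "\<dots> = (LINT w|lborel. u w * cnj (cell_ind k z w))"
    by (rule integral_shift[of "\<lambda>w. u w * cnj (cell_ind k z w)"]) measurable
  finally show "avg k (tau h u) 0 = avg k u z" by (simp add: avg_def ip_def)
qed

lemma Lq_norm_pow_cmult: "Lq_norm_pow q (\<lambda>z. c * u z) = cmod c powr q * Lq_norm_pow q u"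
  by (simp add: Lq_norm_pow_def norm_mult powr_mult)

lemma Lq_cmult: "u \<in> Lq q \<Longrightarrow> (\<lambda>z. c * u z) \<in> Lq q"
  by (auto simp: Lq_def norm_mult powr_mult)

lemma Lq_norm_pow_tau:
  assumes [measurable]: "u \<in> borel_measurable borel" shows "Lq_norm_pow q (tau h u) = Lq_norm_pow q u"
  unfolding Lq_norm_pow_def tau_def by (rule integral_shift[of "\<lambda>z. cmod (u z) powr q"]) measurable

lemma Lq_norm_pow_cong_AE:
  assumes [measurable]: "u \<in> borel_measurable borel" "v \<in> borel_measurable borel" and "AE z in lborel. u z = v z"
  shows "Lq_norm_pow q u = Lq_norm_pow q v"
  unfolding Lq_norm_pow_def using assms(3) by (intro integral_cong_AE) auto

lemma Lq_norm_pow_eq_0_iff: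
  assumes "u \<in> Lq q" shows "Lq_norm_pow q u = 0 \<longleftrightarrow> \<not> nonzero u"
proof -
  have "Lq_norm_pow q u = 0 \<longleftrightarrow> (AE z in lborel. cmod (u z) powr q = 0)"
    unfolding Lq_norm_pow_def by (rule integral_nonneg_eq_0_iff_AE[OF LqD(2)[OF assms]]) simp
  then show ?thesis by (simp add: nonzero_def)
qed

lemma power_deriv_self: "2 < q \<Longrightarrow> power_deriv q a a = cmod a powr q"
  using powr_split_square[of "cmod a" q] by (simp add: power_deriv_def complex_mult_cnj cmod_power2)

lemma Lq_deriv_self: "2 < q \<Longrightarrow> Lq_deriv q u u = Lq_norm_pow q u"
  by (simp add: Lq_deriv_def Lq_norm_pow_def power_deriv_self)

lemma Lq_deriv_real_cmult_right: "Lq_deriv q u (\<lambda>z. complex_of_real c * v z) = c * Lq_deriv q u v"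
proof -
  have "power_deriv q a (complex_of_real c * b) = c * power_deriv q a b" for a b
    by (simp add: power_deriv_def algebra_simps)
  then show ?thesis by (simp add: Lq_deriv_def)
qed

lemma Lq_deriv_pos_cmult_left:
  assumes "0 < c" "2 < q" shows "Lq_deriv q (\<lambda>z. complex_of_real c * u z) v = c powr (q - 1) * Lq_deriv q u v"
proof -
  have "c powr (q - 2) * c = c powr (q - 1)" using assms powr_add[of c "q - 2" 1] by simp
  then have "power_deriv q (complex_of_real c * a) b = c powr (q - 1) * power_deriv q a b" for a b
  proof -
    have "power_deriv q (complex_of_real c * a) b = (c powr (q - 2) * c) * power_deriv q a b"
      using assms(1) by (simp add: power_deriv_def norm_mult powr_mult algebra_simps)
    then show ?thesis using \<open>c powr (q - 2) * c = c powr (q - 1)\<close> by simp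
  qed
  then show ?thesis by (simp add: Lq_deriv_def)
qed

context
  fixes q \<omega> :: real
  assumes q2: "2 < q" and q6: "q < 6" and \<omega>: "0 < \<omega>"
begin

definition class_bound :: real where "class_bound = max 4 (1 / sqrt \<omega>)"

lemma class_bound_pos: "0 < class_bound"
  by (simp add: class_bound_def)

lemma energy_ball_class: "u \<in> X \<Longrightarrow> energy \<omega> u \<le> 1 \<Longrightarrow> u \<in> dyadic_class class_bound"
  unfolding class_bound_def by (rule energy_ball_dyadic_class[OF \<omega>])

lemma energy_ball_Lq_bound:
  obtains C where "0 < C" "\<And>u. u \<in> X \<Longrightarrow> energy \<omega> u \<le> 1 \<Longrightarrow> u \<in> Lq q \<and> Lq_norm_pow q u \<le> C"
proof -
  obtain C where C: "0 < C" "\<And>u. u \<in> dyadic_class class_bound \<Longrightarrow> integrable lborel (\<lambda>z. cmod (u z) powr q)"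
    "\<And>u. u \<in> dyadic_class class_bound \<Longrightarrow> Lq_norm_pow q u \<le> C"
    using dyadic_class_Sobolev[OF class_bound_pos q2 q6] by blast
  have "u \<in> Lq q \<and> Lq_norm_pow q u \<le> C" if "u \<in> X" "energy \<omega> u \<le> 1" for u
    using C(2,3)[OF energy_ball_class[OF that]] X_L2[OF that(1)] by (auto simp: Lq_def)
  then show ?thesis using that[OF C(1)] by blast
qed

text \<open>By homogeneity, from the unit ball. Dividing by \<open>\<surd>(E u + 1)\<close> avoids the case \<open>E u = 0\<close>.\<close>
lemma X_Lq: assumes u: "u \<in> X" shows "u \<in> Lq q"
proof -
  define c where "c = 1 / sqrt (energy \<omega> u + 1)"
  have E: "0 \<le> energy \<omega> u" by (rule energy_nonneg)
  then have c: "0 < c" by (simp add: c_def)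
  have cX: "(\<lambda>z. complex_of_real c * u z) \<in> X" by (rule X_cmult[OF \<omega> u])
  have "energy \<omega> (\<lambda>z. complex_of_real c * u z) = energy \<omega> u / (energy \<omega> u + 1)"
    unfolding energy_cmult[OF \<omega> u] norm_of_real power2_abs using E by (simp add: c_def power_divide)
  then have "energy \<omega> (\<lambda>z. complex_of_real c * u z) \<le> 1" using E by simp
  then have "(\<lambda>z. complex_of_real c * u z) \<in> Lq q" using cX energy_ball_Lq_bound by blast
  from Lq_cmult[OF this, of "complex_of_real (1 / c)"] show ?thesis
    using c by (simp add: mult.assoc[symmetric])
qed

definition best_constant :: real where
  "best_constant = Sup {Lq_norm_pow q u | u. u \<in> X \<and> energy \<omega> u \<le> 1}"

lemma best_constant_bdd: "bdd_above {Lq_norm_pow q u | u. u \<in> X \<and> energy \<omega> u \<le> 1}"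
proof -
  obtain C where "\<And>u. u \<in> X \<Longrightarrow> energy \<omega> u \<le> 1 \<Longrightarrow> u \<in> Lq q \<and> Lq_norm_pow q u \<le> C"
    using energy_ball_Lq_bound by blast
  then show ?thesis by (intro bdd_aboveI[of _ C]) auto
qed

lemma le_best_constant: "u \<in> X \<Longrightarrow> energy \<omega> u \<le> 1 \<Longrightarrow> Lq_norm_pow q u \<le> best_constant"
  unfolding best_constant_def by (rule cSup_upper[OF _ best_constant_bdd]) auto

lemma Sobolev_best_constant:
  assumes u: "u \<in> X" shows "Lq_norm_pow q u \<le> best_constant * energy \<omega> u powr (q / 2)"
proof (cases "energy \<omega> u = 0")
  case True
  then have "Lq_norm_pow q u = 0"
    using energy_eq_0_iff[OF \<omega> u] Lq_norm_pow_eq_0_iff[OF X_Lq[OF u]] by simp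
  then show ?thesis using True by simp
next
  case False
  then have E: "0 < energy \<omega> u" using energy_nonneg[of \<omega> u] by simp
  define c where "c = 1 / sqrt (energy \<omega> u)"
  have c: "0 < c" "c\<^sup>2 * energy \<omega> u = 1" using E by (auto simp: c_def power_divide)
  have "Lq_norm_pow q (\<lambda>z. complex_of_real c * u z) \<le> best_constant"
    by (rule le_best_constant[OF X_cmult[OF \<omega> u]]) (use c in \<open>simp add: energy_cmult[OF \<omega> u]\<close>)
  then have *: "c powr q * Lq_norm_pow q u \<le> best_constant" using c by (simp add: Lq_norm_pow_cmult)
  have "c powr q * energy \<omega> u powr (q / 2) = 1"
  proof -
    have "energy \<omega> u powr (q / 2) = (sqrt (energy \<omega> u)) powr q"
      using E by (simp add: powr_half_sqrt[symmetric] powr_powr)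
    then have "c powr q * energy \<omega> u powr (q / 2) = (c * sqrt (energy \<omega> u)) powr q"
      using c E by (simp add: powr_mult)
    also have "c * sqrt (energy \<omega> u) = 1" using E by (simp add: c_def)
    finally show ?thesis by simp
  qed
  then have "Lq_norm_pow q u = (c powr q * Lq_norm_pow q u) * energy \<omega> u powr (q / 2)"
    by (simp add: ac_simps)
  also have "\<dots> \<le> best_constant * energy \<omega> u powr (q / 2)" by (rule mult_right_mono[OF *]) simp
  finally show ?thesis .
qed

lemma best_constant_pos: "0 < best_constant"
proof -
  obtain u where u: "u \<in> X" "nonzero u" using X_nontrivial .
  have "0 < Lq_norm_pow q u"
    using Lq_norm_pow_eq_0_iff[OF X_Lq[OF u(1)]] u(2) Lq_norm_pow_nonneg[of q u] by (simp add: less_le)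
  also have "\<dots> \<le> best_constant * energy \<omega> u powr (q / 2)" by (rule Sobolev_best_constant[OF u(1)])
  finally show ?thesis by (simp add: zero_less_mult_iff)
qed

lemma maximizing_sequence:
  obtains u where "\<And>n. u n \<in> X" "\<And>n. energy \<omega> (u n) \<le> 1" "(\<lambda>n. Lq_norm_pow q (u n)) \<longlonglongrightarrow> best_constant"
    "\<And>n. best_constant / 2 \<le> Lq_norm_pow q (u n)"
proof -
  note I = best_constant_pos
  have ne: "{Lq_norm_pow q u | u. u \<in> X \<and> energy \<omega> u \<le> 1} \<noteq> {}"
  proof -
    obtain u where u: "u \<in> X" "nonzero u" using X_nontrivial .
    have "(\<lambda>z. 0 * u z) \<in> X" "energy \<omega> (\<lambda>z. 0 * u z) \<le> 1"
      using X_cmult[OF \<omega> u(1), of 0] energy_cmult[OF \<omega> u(1), of 0] by auto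
    then show ?thesis by blast
  qed
  have "\<exists>u. u \<in> X \<and> energy \<omega> u \<le> 1 \<and> best_constant - best_constant / 2 * (1 / real (Suc n)) < Lq_norm_pow q u" for n
  proof -
    have "best_constant - best_constant / 2 * (1 / real (Suc n)) < Sup {Lq_norm_pow q u | u. u \<in> X \<and> energy \<omega> u \<le> 1}"
      unfolding best_constant_def[symmetric] using I by simp
    from less_cSupD[OF ne this] show ?thesis by blast
  qed
  then obtain u where u: "\<And>n. u n \<in> X" "\<And>n. energy \<omega> (u n) \<le> 1"
    "\<And>n. best_constant - best_constant / 2 * (1 / real (Suc n)) < Lq_norm_pow q (u n)" by metis
  have l: "(\<lambda>n. best_constant - best_constant / 2 * (1 / real (Suc n))) \<longlonglongrightarrow> best_constant - best_constant / 2 * 0"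
    by (intro tendsto_intros LIMSEQ_inverse_real_of_nat[unfolded inverse_eq_divide])
  have lim: "(\<lambda>n. Lq_norm_pow q (u n)) \<longlonglongrightarrow> best_constant"
  proof (rule tendsto_sandwich[OF _ _ l[unfolded mult_zero_right diff_zero] tendsto_const])
    show "\<forall>\<^sub>F n in sequentially. best_constant - best_constant / 2 * (1 / real (Suc n)) \<le> Lq_norm_pow q (u n)"
      by (intro always_eventually allI less_imp_le u(3))
    show "\<forall>\<^sub>F n in sequentially. Lq_norm_pow q (u n) \<le> best_constant"
      by (intro always_eventually allI le_best_constant u(1,2))
  qed
  have "best_constant / 2 \<le> Lq_norm_pow q (u n)" for n
  proof -
    have "best_constant / 2 * (1 / real (Suc n)) \<le> best_constant / 2 * 1"
      using I by (intro mult_left_mono) auto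
    then show ?thesis using u(3)[of n] by linarith
  qed
  from that[OF u(1,2) lim this] show ?thesis .
qed

text \<open>Non-vanishing gives boxes of a fixed size that carry large averages; these are translated to the
origin. The average over a fixed box passes to the weak limit, which is therefore not zero.\<close>
lemma concentrated_maximizing_sequence:
  obtains u v where "\<And>n. u n \<in> X" "\<And>n. energy \<omega> (u n) \<le> 1" "(\<lambda>n. Lq_norm_pow q (u n)) \<longlonglongrightarrow> best_constant"
    "v \<in> X" "nonzero v" "energy \<omega> v \<le> 1" "AE z in lborel. (\<lambda>n. u n z) \<longlonglongrightarrow> v z"
    "\<And>g. g \<in> X \<Longrightarrow> (\<lambda>n. energy_form \<omega> (u n) g) \<longlonglongrightarrow> energy_form \<omega> v g"
proof -
  obtain u where u: "\<And>n. u n \<in> X" "\<And>n. energy \<omega> (u n) \<le> 1" "(\<lambda>n. Lq_norm_pow q (u n)) \<longlonglongrightarrow> best_constant"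
    "\<And>n. best_constant / 2 \<le> Lq_norm_pow q (u n)" using maximizing_sequence by blast
  have "0 < best_constant / 2" using best_constant_pos by simp
  then obtain K \<epsilon> where \<epsilon>: "0 < \<epsilon>" and K: "\<And>u. u \<in> dyadic_class class_bound \<Longrightarrow> best_constant / 2 \<le> Lq_norm_pow q u \<Longrightarrow> \<exists>z. \<epsilon> < cmod (avg K u z)"
    by (rule dyadic_class_nonvanishing[OF class_bound_pos q2 q6]) (rule that)
  have um: "u n \<in> borel_measurable borel" for n using X_L2[OF u(1)] by auto
  have "\<exists>h. \<epsilon> < cmod (avg K (tau h (u n)) 0)" for n
    using K[OF energy_ball_class[OF u(1,2)] u(4), of n] avg_tau_corner[OF um[of n], of K] by metis
  then obtain h where h: "\<And>n. \<epsilon> < cmod (avg K (tau (h n) (u n)) 0)" by metis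
  define U where "U n = tau (h n) (u n)" for n
  have U: "U n \<in> X" "energy \<omega> (U n) \<le> 1" "Lq_norm_pow q (U n) = Lq_norm_pow q (u n)" for n
    unfolding U_def using energy_tau[OF \<omega> u(1)] u(2) Lq_norm_pow_tau[OF um] by auto
  obtain r v where r: "strict_mono (r :: nat \<Rightarrow> nat)" and v: "v \<in> L2"
    and ae: "AE z in lborel. (\<lambda>n. U (r n) z) \<longlonglongrightarrow> v z"
    and weak: "\<And>h. h \<in> L2 \<Longrightarrow> (\<lambda>n. ip (U (r n)) h) \<longlonglongrightarrow> ip v h"
    by (rule dyadic_class_compact[of U, OF energy_ball_class[OF U(1,2)]]) (rule that)
  note W = energy_weak_limit[OF \<omega>, of "\<lambda>n. U (r n)", OF U(1,2) v weak]
  have "(\<lambda>n. cmod (avg K (U (r n)) 0)) \<longlonglongrightarrow> cmod (avg K v 0)"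
    unfolding avg_def by (intro tendsto_intros weak cell_ind_L2)
  then have "\<epsilon> \<le> cmod (avg K v 0)"
    by (rule LIMSEQ_le_const) (use h in \<open>auto simp: U_def intro!: less_imp_le\<close>)
  moreover have "avg K v 0 = 0" if "\<not> nonzero v"
  proof -
    have "ip v (cell_ind K 0) = ip (\<lambda>z. 0) (cell_ind K 0)"
      by (rule ip_cong_AE) (use that L2_measurable[OF v] in \<open>auto simp: nonzero_def\<close>)
    then show ?thesis by (simp add: avg_def ip_def)
  qed
  ultimately have nz: "nonzero v" using \<epsilon> by force
  have lim: "(\<lambda>n. Lq_norm_pow q (U (r n))) \<longlonglongrightarrow> best_constant"
    using LIMSEQ_subseq_LIMSEQ[OF u(3) r] by (simp add: U(3) o_def)
  show ?thesis
    by (rule that[of "\<lambda>n. U (r n)" v]) (use U W nz ae lim in auto)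
qed

text \<open>Compare \<open>u\<^sub>n\<close> with its perturbation \<open>u\<^sub>n + t g\<close> by the inequality \<open>B \<le> I E\<^sup>q\<^sup>/\<^sup>2\<close>. Expanding
\<open>B\<close> to first order, with an error uniform in \<open>n\<close>, and letting first \<open>n \<rightarrow> \<infinity>\<close> and then \<open>t \<rightarrow> 0\<close> gives one
inequality for \<open>v\<close>; the other one comes from \<open>-g\<close>. Apart from \<open>B u\<^sub>n \<rightarrow> I\<close>, only the energy form and the
derivative of \<open>B\<close>, both paired with the fixed \<open>g\<close>, have to converge along the sequence.\<close>
lemma Euler_Lagrange_limit:
  assumes u: "\<And>n. u n \<in> X" "\<And>n. energy \<omega> (u n) \<le> 1" "(\<lambda>n. Lq_norm_pow q (u n)) \<longlonglongrightarrow> best_constant"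
    and v: "v \<in> X" and ae: "AE z in lborel. (\<lambda>n. u n z) \<longlonglongrightarrow> v z"
    and weak: "\<And>g. g \<in> X \<Longrightarrow> (\<lambda>n. energy_form \<omega> (u n) g) \<longlonglongrightarrow> energy_form \<omega> v g"
    and g: "g \<in> X"
  shows "Lq_deriv q v g = best_constant * Re (energy_form \<omega> v g)"
proof -
  have le: "Lq_deriv q v g \<le> best_constant * Re (energy_form \<omega> v g)" if g: "g \<in> X" for g
  proof (rule field_le_epsilon)
    fix e :: real assume e: "0 < e"
    define D where "D = best_constant + Lq_norm_pow q g"
    have D: "0 < D" unfolding D_def using best_constant_pos Lq_norm_pow_nonneg[of q g] by linarith
    define \<epsilon> where "\<epsilon> = q * e / D"
    have \<epsilon>: "0 < \<epsilon>" using e D q2 by (simp add: \<epsilon>_def)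
    obtain \<delta> where \<delta>: "0 < \<delta>" "\<And>u v t. u \<in> Lq q \<Longrightarrow> v \<in> Lq q \<Longrightarrow> (\<lambda>z. u z + complex_of_real t * v z) \<in> Lq q \<Longrightarrow>
      0 \<le> t \<Longrightarrow> t \<le> \<delta> \<Longrightarrow>
      \<bar>Lq_norm_pow q (\<lambda>z. u z + complex_of_real t * v z) - Lq_norm_pow q u - q * t * Lq_deriv q u v\<bar>
       \<le> t * \<epsilon> * (Lq_norm_pow q u + Lq_norm_pow q v)" by (rule Lq_expansion[OF q2 \<epsilon>]) (rule that)
    define G where "G = energy \<omega> g"
    define E where "E = Re (energy_form \<omega> v g)"
    define f where "f t = (1 + 2 * t * E + t\<^sup>2 * G) powr (q / 2)" for t
    have step: "q * t * Lq_deriv q v g \<le> best_constant * (f t - 1) + t * \<epsilon> * D" if t: "0 < t" "t \<le> \<delta>" for t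
    proof -
      define a where "a n = 1 + 2 * t * Re (energy_form \<omega> (u n) g) + t\<^sup>2 * G" for n
      have sX: "(\<lambda>z. u n z + complex_of_real t * g z) \<in> X" for n
        using X_linear[OF \<omega> u(1)[of n] g, of 1 "complex_of_real t"] by simp
      have ea: "energy \<omega> (\<lambda>z. u n z + complex_of_real t * g z) \<le> a n" for n
        unfolding energy_linear[OF \<omega> u(1) g] a_def G_def using u(2)[of n] by simp
      have a0: "0 \<le> a n" for n using ea[of n] energy_nonneg order_trans by blast
      have n_ineq: "q * t * Lq_deriv q (u n) g \<le> best_constant * a n powr (q / 2) - Lq_norm_pow q (u n) + t * \<epsilon> * D" for n
      proof -
        have 1: "\<bar>Lq_norm_pow q (\<lambda>z. u n z + complex_of_real t * g z) - Lq_norm_pow q (u n) - q * t * Lq_deriv q (u n) g\<bar>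
          \<le> t * \<epsilon> * (Lq_norm_pow q (u n) + Lq_norm_pow q g)"
          by (rule \<delta>(2)) (use X_Lq u(1) g sX t in auto)
        have 2: "Lq_norm_pow q (\<lambda>z. u n z + complex_of_real t * g z) \<le> best_constant * a n powr (q / 2)"
        proof (rule order_trans[OF Sobolev_best_constant[OF sX]])
          show "best_constant * energy \<omega> (\<lambda>z. u n z + complex_of_real t * g z) powr (q / 2) \<le> best_constant * a n powr (q / 2)"
            using best_constant_pos q2 by (intro mult_left_mono powr_mono2 ea energy_nonneg) auto
        qed
        have 3: "t * \<epsilon> * (Lq_norm_pow q (u n) + Lq_norm_pow q g) \<le> t * \<epsilon> * D"
          unfolding D_def using le_best_constant[OF u(1,2)[of n]] t \<epsilon> by (intro mult_left_mono) auto
        show ?thesis using 1 2 3 by linarith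
      qed
      have l1: "(\<lambda>n. q * t * Lq_deriv q (u n) g) \<longlonglongrightarrow> q * t * Lq_deriv q v g"
        by (intro tendsto_intros Lq_deriv_tendsto[OF q2 _ le_best_constant] X_Lq u v g ae)
      have "a \<longlonglongrightarrow> 1 + 2 * t * E + t\<^sup>2 * G"
        unfolding a_def E_def by (intro tendsto_intros weak g)
      then have "(\<lambda>n. a n powr (q / 2)) \<longlonglongrightarrow> f t"
        unfolding f_def using q2 a0 by (intro tendsto_powr') auto
      then have "(\<lambda>n. best_constant * a n powr (q / 2) - Lq_norm_pow q (u n) + t * \<epsilon> * D)
        \<longlonglongrightarrow> best_constant * f t - best_constant + t * \<epsilon> * D"
        by (intro tendsto_intros u(3))
      then have "q * t * Lq_deriv q v g \<le> best_constant * f t - best_constant + t * \<epsilon> * D"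
        by (rule LIMSEQ_le[OF l1]) (use n_ineq in auto)
      then show ?thesis by (simp add: right_diff_distrib)
    qed
    have "(f has_real_derivative q * E) (at 0)"
    proof -
      have "((\<lambda>t. 1 + 2 * t * E + t\<^sup>2 * G) has_real_derivative 2 * E) (at 0)"
        by (auto intro!: derivative_eq_intros)
      from DERIV_fun_powr[OF this, of "q / 2"] show ?thesis unfolding f_def by simp
    qed
    then have "((\<lambda>h. (f h - 1) / h) \<longlongrightarrow> q * E) (at 0)"
      by (simp add: DERIV_def f_def)
    then have "((\<lambda>h. (f h - 1) / h) \<longlongrightarrow> q * E) (at_right 0)"
      by (rule tendsto_mono[rotated]) (simp add: at_le)
    then have "((\<lambda>h. best_constant * ((f h - 1) / h) + \<epsilon> * D) \<longlongrightarrow> best_constant * (q * E) + \<epsilon> * D) (at_right 0)"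
      by (intro tendsto_intros)
    moreover have "\<forall>\<^sub>F h in at_right 0. q * Lq_deriv q v g \<le> best_constant * ((f h - 1) / h) + \<epsilon> * D"
    proof -
      have "\<forall>\<^sub>F h in at_right 0. h \<in> {0<..<\<delta>}" by (rule eventually_at_right_real[OF \<delta>(1)])
      then show ?thesis
      proof eventually_elim
        case (elim h)
        then have h: "0 < h" "h \<le> \<delta>" by auto
        from divide_right_mono[OF step[OF h], of h] h show ?case
          by (simp add: add_divide_distrib)
      qed
    qed
    ultimately have "q * Lq_deriv q v g \<le> best_constant * (q * E) + \<epsilon> * D"
      by (intro tendsto_lowerbound) (auto simp: trivial_limit_at_right_real)
    also have "\<epsilon> * D = q * e" using D by (simp add: \<epsilon>_def)
    finally have "q * Lq_deriv q v g \<le> q * (best_constant * E + e)" by (simp add: algebra_simps)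
    then show "Lq_deriv q v g \<le> best_constant * Re (energy_form \<omega> v g) + e"
      using q2 by (simp add: E_def)
  qed
  have "(\<lambda>z. complex_of_real (- 1) * g z) \<in> X" by (rule X_cmult[OF \<omega> g])
  from le[OF this] have "- Lq_deriv q v g \<le> best_constant * Re (energy_form \<omega> v (\<lambda>z. complex_of_real (- 1) * g z))"
    unfolding Lq_deriv_real_cmult_right by simp
  also have "energy_form \<omega> v (\<lambda>z. complex_of_real (- 1) * g z) = - energy_form \<omega> v g"
    using energy_form_linear_right[OF \<omega> g g v, of "complex_of_real (- 1)" 0] by simp
  finally show ?thesis using le[OF g] by simp
qed

end

section \<open>The ground state\<close>

lemma powr_diff_1_mult: "0 < x \<Longrightarrow> x powr a = x powr (a - 1) * (x :: real)"
  using powr_add[of x "a - 1" 1] by simp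

context
  fixes p \<omega> :: real
  assumes p1: "1 < p" and p5: "p < 5" and \<omega>: "0 < \<omega>"
begin

abbreviation (input) "q \<equiv> p + 1"

lemma exponent_range: "2 < q" "q < 6"
  using p1 p5 by auto

lemma action_eq: "u \<in> X \<Longrightarrow> action p \<omega> u = energy \<omega> u / 2 - Lq_norm_pow q u / q"
  by (simp add: action_def energy_derivatives[OF \<omega>] field_simps)

lemma nehari_eq: "u \<in> X \<Longrightarrow> nehari p \<omega> u = energy \<omega> u - Lq_norm_pow q u"
  by (simp add: nehari_def energy_derivatives[OF \<omega>])

lemma X_norm_sq: "u \<in> X \<Longrightarrow> (X_norm u)\<^sup>2 = energy 1 u"
  by (simp add: X_norm_def energy_derivatives)

lemma X_norm_nonneg: "0 \<le> X_norm u"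
  by (simp add: X_norm_def)

lemma energy_le_X_norm: assumes u: "u \<in> X" shows "energy \<omega> u \<le> max 1 \<omega> * (X_norm u)\<^sup>2"
proof -
  have "\<omega> * (L2_norm u)\<^sup>2 \<le> max 1 \<omega> * (L2_norm u)\<^sup>2"
    "1 * (L2_norm (Dx u))\<^sup>2 \<le> max 1 \<omega> * (L2_norm (Dx u))\<^sup>2"
    "1 * (L2_norm (Dy_half u))\<^sup>2 \<le> max 1 \<omega> * (L2_norm (Dy_half u))\<^sup>2"
    by (intro mult_right_mono; simp)+
  then show ?thesis unfolding X_norm_sq[OF u] energy_derivatives[OF \<omega> u] energy_derivatives[OF zero_less_one u]
    by (simp add: distrib_left)
qed

text \<open>On the Nehari set \<open>E u = B u \<le> I (E u)\<^sup>q\<^sup>/\<^sup>2\<close>; divide by \<open>E u\<close>.\<close>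
lemma Nehari_energy_lower_bound:
  assumes u: "u \<in> X" "nonzero u" and N: "nehari p \<omega> u = 0"
  shows "1 \<le> best_constant q \<omega> * energy \<omega> u powr (q / 2 - 1)"
proof -
  note E = exponent_range \<omega>
  have e: "0 < energy \<omega> u" using energy_eq_0_iff[OF \<omega> u(1)] u(2) energy_nonneg[of \<omega> u] by simp
  have "energy \<omega> u \<le> best_constant q \<omega> * energy \<omega> u powr (q / 2)"
    using Sobolev_best_constant[OF E u(1)] N nehari_eq[OF u(1)] by simp
  also have "energy \<omega> u powr (q / 2) = energy \<omega> u powr (q / 2 - 1) * energy \<omega> u"
    by (rule powr_diff_1_mult[OF e])
  finally have "1 * energy \<omega> u \<le> (best_constant q \<omega> * energy \<omega> u powr (q / 2 - 1)) * energy \<omega> u"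
    by simp
  then show ?thesis using e by (simp only: mult_le_cancel_right_pos)
qed

text \<open>The limit \<open>v\<close> satisfies \<open>B v = I E v\<close>, so that \<open>I E v \<le> I (E v)\<^sup>q\<^sup>/\<^sup>2\<close> and \<open>E v \<ge> 1\<close>: no
energy is lost. The multiple \<open>l v\<close> with \<open>l\<^sup>q\<^sup>-\<^sup>2 = 1/I\<close> removes the Lagrange multiplier.\<close>
lemma weak_solution_exists:
  obtains Q where "Q \<in> X" "nonzero Q" "\<And>g. g \<in> X \<Longrightarrow> Lq_deriv q Q g = Re (energy_form \<omega> Q g)"
    "best_constant q \<omega> * energy \<omega> Q powr (q / 2 - 1) = 1"
proof -
  note E = exponent_range \<omega>
  define I where "I = best_constant q \<omega>"
  have I: "0 < I" unfolding I_def by (rule best_constant_pos[OF E])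
  obtain u v where u: "\<And>n. u n \<in> X" "\<And>n. energy \<omega> (u n) \<le> 1" "(\<lambda>n. Lq_norm_pow q (u n)) \<longlonglongrightarrow> best_constant q \<omega>"
    and v: "v \<in> X" "nonzero v" "energy \<omega> v \<le> 1" and ae: "AE z in lborel. (\<lambda>n. u n z) \<longlonglongrightarrow> v z"
    and weak: "\<And>g. g \<in> X \<Longrightarrow> (\<lambda>n. energy_form \<omega> (u n) g) \<longlonglongrightarrow> energy_form \<omega> v g"
    by (rule concentrated_maximizing_sequence[OF E]) (rule that)
  have EL: "Lq_deriv q v g = I * Re (energy_form \<omega> v g)" if "g \<in> X" for g
    unfolding I_def by (rule Euler_Lagrange_limit[OF E u v(1) ae weak that])
  have e: "0 < energy \<omega> v" using energy_eq_0_iff[OF \<omega> v(1)] v(2) energy_nonneg[of \<omega> v] by simp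
  have "I * energy \<omega> v = Lq_norm_pow q v"
    using EL[OF v(1)] by (simp add: Lq_deriv_self[OF E(1)] energy_form_self[OF \<omega>])
  also have "\<dots> \<le> I * energy \<omega> v powr (q / 2)" unfolding I_def by (rule Sobolev_best_constant[OF E v(1)])
  also have "energy \<omega> v powr (q / 2) = energy \<omega> v powr (q / 2 - 1) * energy \<omega> v"
    by (rule powr_diff_1_mult[OF e])
  finally have "1 * (I * energy \<omega> v) \<le> energy \<omega> v powr (q / 2 - 1) * (I * energy \<omega> v)" by (simp add: ac_simps)
  then have "1 \<le> energy \<omega> v powr (q / 2 - 1)" using e I by (simp only: mult_le_cancel_right_pos mult_pos_pos)
  moreover have "energy \<omega> v powr (q / 2 - 1) < 1" if "energy \<omega> v < 1"
    using powr_less_mono2[OF _ less_imp_le[OF e] that, of "q / 2 - 1"] E(1) by simp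
  ultimately have e1: "energy \<omega> v = 1" using v(3) by force
  define l where "l = I powr (- 1 / (q - 2))"
  have l: "0 < l" using I by (simp add: l_def)
  have lq: "l powr (q - 2) = 1 / I"
  proof -
    have "- 1 / (q - 2) * (q - 2) = - 1" using p1 by simp
    then have "l powr (q - 2) = I powr (- 1)" unfolding l_def powr_powr by (simp only:)
    also have "\<dots> = 1 / I" using I powr_minus_divide[of I 1] by simp
    finally show ?thesis .
  qed
  define Q where "Q z = complex_of_real l * v z" for z
  have QX: "Q \<in> X" unfolding Q_def by (rule X_cmult[OF \<omega> v(1)])
  have eQ: "energy \<omega> Q = l\<^sup>2"
    unfolding Q_def energy_cmult[OF \<omega> v(1)] e1 by simp
  have nz: "nonzero Q" using energy_eq_0_iff[OF \<omega> QX] eQ l by simp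
  have ELQ: "Lq_deriv q Q g = Re (energy_form \<omega> Q g)" if g: "g \<in> X" for g
  proof -
    have "l powr (q - 1) = l powr (q - 2) * l" using powr_add[of l "q - 2" 1] l by simp
    then have "Lq_deriv q Q g = (1 / I * l) * (I * Re (energy_form \<omega> v g))"
      unfolding Q_def Lq_deriv_pos_cmult_left[OF l E(1)] EL[OF g] lq by simp
    also have "\<dots> = l * Re (energy_form \<omega> v g)" using I by simp
    also have "\<dots> = Re (energy_form \<omega> Q g)"
      using energy_form_linear_left[OF \<omega> v(1) v(1) g, of "complex_of_real l" 0] by (simp add: Q_def[abs_def])
    finally show ?thesis .
  qed
  have "energy \<omega> Q powr (q / 2 - 1) = l powr (q - 2)"
  proof -
    have l2: "l\<^sup>2 = l powr 2" using l by (simp add: powr_numeral)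
    have "2 * (q / 2 - 1) = q - 2" by simp
    then show ?thesis unfolding eQ l2 powr_powr by (simp only:)
  qed
  then have "best_constant q \<omega> * energy \<omega> Q powr (q / 2 - 1) = 1"
    unfolding lq using I by (simp add: I_def)
  then show ?thesis using that[OF QX nz ELQ] by blast
qed

text \<open>The hypothesis controls real parts; testing with \<open>\<i> v\<close> as well gives the imaginary part.\<close>
lemma Lq_deriv_equation:
  assumes Q: "Q \<in> X" and EL: "\<And>g. g \<in> X \<Longrightarrow> Lq_deriv q Q g = Re (energy_form \<omega> Q g)"
  shows "equation_holds p \<omega> Q"
  unfolding equation_holds_def
proof (intro conjI ballI)
  note E = exponent_range \<omega>
  show "Q \<in> X" by (rule Q)
  fix v assume v: "v \<in> X"
  have iv: "(\<lambda>z. \<i> * v z) \<in> X" by (rule X_cmult[OF \<omega> v])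
  note Lq = X_Lq[OF E Q] X_Lq[OF E v] X_Lq[OF E iv]
  have split: "complex_of_real (cmod (Q z) powr (p - 1)) * Q z * cnj (v z) =
    complex_of_real (power_deriv q (Q z) (v z)) + \<i> * complex_of_real (power_deriv q (Q z) (\<i> * v z))" for z
    by (simp add: power_deriv_def complex_eq_iff algebra_simps)
  have i1: "integrable lborel (\<lambda>z. complex_of_real (power_deriv q (Q z) (v z)))"
    "integrable lborel (\<lambda>z. \<i> * complex_of_real (power_deriv q (Q z) (\<i> * v z)))"
    using integrable_power_deriv[OF E(1) Lq(1) Lq(2)] integrable_power_deriv[OF E(1) Lq(1) Lq(3)] by simp_all
  have int_W: "integrable lborel (\<lambda>z. complex_of_real (cmod (Q z) powr (p - 1)) * Q z * cnj (v z))"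
    unfolding split by (rule Bochner_Integration.integrable_add[OF i1])
  have W: "(LINT z|lborel. complex_of_real (cmod (Q z) powr (p - 1)) * Q z * cnj (v z)) = energy_form \<omega> Q v"
  proof -
    have "(LINT z|lborel. complex_of_real (cmod (Q z) powr (p - 1)) * Q z * cnj (v z)) =
      complex_of_real (Lq_deriv q Q v) + \<i> * complex_of_real (Lq_deriv q Q (\<lambda>z. \<i> * v z))"
      unfolding split using i1 by (subst Bochner_Integration.integral_add) (simp_all add: Lq_deriv_def)
    also have "\<dots> = complex_of_real (Re (energy_form \<omega> Q v)) + \<i> * complex_of_real (Re (energy_form \<omega> Q (\<lambda>z. \<i> * v z)))"
      by (simp only: EL[OF v] EL[OF iv])
    also have "energy_form \<omega> Q (\<lambda>z. \<i> * v z) = - \<i> * energy_form \<omega> Q v"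
      using energy_form_linear_right[OF \<omega> v v Q, of "\<i>" 0] by simp
    finally show ?thesis by (simp add: complex_eq_iff)
  qed
  have L: "Dx Q \<in> L2" "Dx v \<in> L2" "Dy_half Q \<in> L2" "Dy_half v \<in> L2" "Q \<in> L2" "v \<in> L2"
    using has_fourier_L2(1)[OF has_fourier_Dx] has_fourier_L2(1)[OF has_fourier_Dy_half] X_L2 Q v by auto
  have i2: "integrable lborel (\<lambda>z. Dx Q z * cnj (Dx v z))" "integrable lborel (\<lambda>z. Dy_half Q z * cnj (Dy_half v z))"
    "integrable lborel (\<lambda>z. complex_of_real \<omega> * Q z * cnj (v z))"
    using integrable_ip[OF L(1,2)] integrable_ip[OF L(3,4)] integrable_ip[OF L(5,6)] by (simp_all add: mult.assoc)
  have "(LINT z|lborel. Dx Q z * cnj (Dx v z) + Dy_half Q z * cnj (Dy_half v z)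
         + complex_of_real \<omega> * Q z * cnj (v z)
         - complex_of_real (cmod (Q z) powr (p - 1)) * Q z * cnj (v z)) =
     ip (Dx Q) (Dx v) + ip (Dy_half Q) (Dy_half v) + (LINT z|lborel. complex_of_real \<omega> * Q z * cnj (v z)) - energy_form \<omega> Q v"
    using i2 int_W W by (simp add: ip_def)
  also have "(LINT z|lborel. complex_of_real \<omega> * Q z * cnj (v z)) = complex_of_real \<omega> * ip Q v"
    by (simp add: ip_def mult.assoc)
  finally show "(LINT z|lborel. Dx Q z * cnj (Dx v z) + Dy_half Q z * cnj (Dy_half v z)
         + complex_of_real \<omega> * Q z * cnj (v z)
         - complex_of_real (cmod (Q z) powr (p - 1)) * Q z * cnj (v z)) = 0"
    using energy_form_derivatives[OF \<omega> Q v] by simp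
qed

text \<open>The linear terms of the energy and of the power functional cancel. Of the remainders, the energy of
\<open>h\<close> is quadratic, and the one of the power functional is small by the uniform expansion applied to
\<open>h = t g\<close>, with \<open>g\<close> in the unit ball of the energy.\<close>
lemma Lq_deriv_critical:
  assumes Q: "Q \<in> X" and EL: "\<And>g. g \<in> X \<Longrightarrow> Lq_deriv q Q g = Re (energy_form \<omega> Q g)"
  shows "solution p \<omega> Q"
  unfolding solution_def critical_point_def
proof (intro conjI allI impI)
  note E = exponent_range \<omega>
  show "Q \<in> X" by (rule Q)
  fix \<epsilon> :: real assume \<epsilon>: "0 < \<epsilon>"
  (* the energy norm is at most c times the norm of X *)
  define c where "c = sqrt (max 1 \<omega>)"
  have c: "1 \<le> c" "c\<^sup>2 = max 1 \<omega>" by (auto simp: c_def)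
  define D where "D = Lq_norm_pow q Q + best_constant q \<omega>"
  have D: "0 < D" unfolding D_def using best_constant_pos[OF E] Lq_norm_pow_nonneg[of q Q] by linarith
  define \<eta> where "\<eta> = \<epsilon> / (2 * c * D)"
  have \<eta>: "0 < \<eta>" using \<epsilon> c D by (simp add: \<eta>_def)
  obtain d where d: "0 < d" "\<And>u v t. u \<in> Lq q \<Longrightarrow> v \<in> Lq q \<Longrightarrow> (\<lambda>z. u z + complex_of_real t * v z) \<in> Lq q \<Longrightarrow>
      0 \<le> t \<Longrightarrow> t \<le> d \<Longrightarrow>
      \<bar>Lq_norm_pow q (\<lambda>z. u z + complex_of_real t * v z) - Lq_norm_pow q u - q * t * Lq_deriv q u v\<bar>
       \<le> t * \<eta> * (Lq_norm_pow q u + Lq_norm_pow q v)" by (rule Lq_expansion[OF E(1) \<eta>]) (rule that)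
  define \<delta> where "\<delta> = min (d / c) (\<epsilon> / c\<^sup>2)"
  have c2: "0 < c\<^sup>2" using c by simp
  have "\<bar>action p \<omega> (\<lambda>z. Q z + h z) - action p \<omega> Q\<bar> \<le> \<epsilon> * X_norm h" if h: "h \<in> X" and hd: "X_norm h < \<delta>" for h
  proof -
    define t where "t = c * X_norm h"
    have t0: "0 \<le> t" using c X_norm_nonneg[of h] by (simp add: t_def)
    have td: "t \<le> d" using hd c by (simp add: t_def \<delta>_def pos_less_divide_eq mult.commute)
    have Eh: "energy \<omega> h \<le> t\<^sup>2" using energy_le_X_norm[OF h] by (simp add: t_def power_mult_distrib c)
    have QhX: "(\<lambda>z. Q z + h z) \<in> X" by (rule X_add[OF \<omega> Q h])
    have eQh: "energy \<omega> (\<lambda>z. Q z + h z) = energy \<omega> Q + 2 * Re (energy_form \<omega> Q h) + energy \<omega> h"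
      using energy_linear[OF \<omega> Q h, of 1] by simp
    have act: "action p \<omega> (\<lambda>z. Q z + h z) - action p \<omega> Q =
      energy \<omega> h / 2 - (Lq_norm_pow q (\<lambda>z. Q z + h z) - Lq_norm_pow q Q - q * Re (energy_form \<omega> Q h)) / q"
    proof -
      have "(x - y - q * e) / q = x / q - y / q - e" for x y e :: real
        using p1 by (simp add: diff_divide_distrib)
      then show ?thesis unfolding action_eq[OF Q] action_eq[OF QhX] eQh by (simp add: add_divide_distrib)
    qed
    have B: "\<bar>Lq_norm_pow q (\<lambda>z. Q z + h z) - Lq_norm_pow q Q - q * Re (energy_form \<omega> Q h)\<bar> \<le> t * \<eta> * D"
    proof (cases "t = 0")
      case True
      then have e0: "energy \<omega> h = 0" using Eh energy_nonneg[of \<omega> h] by simp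
      then have ae: "AE z in lborel. h z = 0" using energy_eq_0_iff[OF \<omega> h] by (simp add: nonzero_def)
      have "Lq_norm_pow q (\<lambda>z. Q z + h z) = Lq_norm_pow q Q"
        by (rule Lq_norm_pow_cong_AE) (use ae X_L2[OF QhX] X_L2[OF Q] in auto)
      moreover have "energy_form \<omega> Q h = 0"
        using energy_form_Cauchy_Schwarz[OF \<omega> Q h] e0 by simp
      ultimately show ?thesis using True by simp
    next
      case False
      then have t: "0 < t" using t0 by simp
      define g where "g z = complex_of_real (1 / t) * h z" for z
      have gX: "g \<in> X" unfolding g_def by (rule X_cmult[OF \<omega> h])
      have eg: "energy \<omega> g \<le> 1"
        unfolding g_def energy_cmult[OF \<omega> h] norm_of_real using Eh t by (simp add: power_divide divide_le_eq)
      have hg: "(\<lambda>z. Q z + h z) = (\<lambda>z. Q z + complex_of_real t * g z)"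
        using t by (simp add: g_def)
      have fg: "Re (energy_form \<omega> Q h) = t * Lq_deriv q Q g"
      proof -
        have "Lq_deriv q Q g = 1 / t * Lq_deriv q Q h"
          unfolding g_def by (rule Lq_deriv_real_cmult_right)
        then show ?thesis using EL[OF h] t by simp
      qed
      have "\<bar>Lq_norm_pow q (\<lambda>z. Q z + complex_of_real t * g z) - Lq_norm_pow q Q - q * t * Lq_deriv q Q g\<bar>
         \<le> t * \<eta> * (Lq_norm_pow q Q + Lq_norm_pow q g)"
        by (rule d(2)) (use X_Lq[OF E] Q gX QhX t td in \<open>auto simp: hg[symmetric]\<close>)
      also have "\<dots> \<le> t * \<eta> * D"
        unfolding D_def using le_best_constant[OF E gX eg] t \<eta> by (intro mult_left_mono) auto
      finally show ?thesis unfolding hg fg by (simp add: mult.assoc)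
    qed
    have "\<bar>action p \<omega> (\<lambda>z. Q z + h z) - action p \<omega> Q\<bar> \<le> \<bar>energy \<omega> h / 2\<bar> +
       \<bar>(Lq_norm_pow q (\<lambda>z. Q z + h z) - Lq_norm_pow q Q - q * Re (energy_form \<omega> Q h)) / q\<bar>"
      unfolding act by (rule abs_triangle_ineq4)
    also have "\<bar>energy \<omega> h / 2\<bar> \<le> \<epsilon> / 2 * X_norm h"
    proof -
      have "c\<^sup>2 * X_norm h \<le> \<epsilon>"
        using hd c2 by (simp add: \<delta>_def pos_less_divide_eq mult.commute)
      then have "c\<^sup>2 * X_norm h * X_norm h \<le> \<epsilon> * X_norm h" by (rule mult_right_mono) (rule X_norm_nonneg)
      moreover have "t\<^sup>2 = c\<^sup>2 * X_norm h * X_norm h" by (simp add: t_def power2_eq_square)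
      ultimately show ?thesis using Eh energy_nonneg[of \<omega> h] by simp
    qed
    also have "\<bar>(Lq_norm_pow q (\<lambda>z. Q z + h z) - Lq_norm_pow q Q - q * Re (energy_form \<omega> Q h)) / q\<bar> \<le> \<epsilon> / 2 * X_norm h"
    proof -
      have "\<bar>(Lq_norm_pow q (\<lambda>z. Q z + h z) - Lq_norm_pow q Q - q * Re (energy_form \<omega> Q h)) / q\<bar> \<le> t * \<eta> * D / q"
        unfolding abs_divide using B p1 by (simp add: divide_right_mono)
      also have "\<dots> \<le> t * \<eta> * D"
      proof -
        have "0 \<le> t * \<eta> * D" using t0 \<eta> D by (intro mult_nonneg_nonneg) auto
        from mult_left_mono[OF _ this, of 1 q] show ?thesis using p1 by (simp add: pos_divide_le_eq)
      qed
      also have "\<dots> = \<epsilon> / 2 * X_norm h"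
      proof -
        have *: "x * y * (\<epsilon> / (2 * x * z)) * z = \<epsilon> / 2 * y" if "x \<noteq> 0" "z \<noteq> 0" for x y z :: real
          using that by simp
        show ?thesis unfolding t_def \<eta>_def by (rule *) (use c D in linarith)+
      qed
      finally show ?thesis .
    qed
    finally show ?thesis by simp
  qed
  moreover have "0 < \<delta>" using d \<epsilon> c by (simp add: \<delta>_def)
  ultimately show "\<exists>\<delta>>0. \<forall>h\<in>X. X_norm h < \<delta> \<longrightarrow> \<bar>action p \<omega> (\<lambda>z. Q z + h z) - action p \<omega> Q\<bar> \<le> \<epsilon> * X_norm h"
    by blast
qed

lemma X_norm_real_cmult: assumes u: "u \<in> X" shows "X_norm (\<lambda>z. complex_of_real t * u z) = \<bar>t\<bar> * X_norm u"
proof (rule power2_eq_imp_eq)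
  show "(X_norm (\<lambda>z. complex_of_real t * u z))\<^sup>2 = (\<bar>t\<bar> * X_norm u)\<^sup>2"
    by (simp add: X_norm_sq[OF X_cmult[OF \<omega> u]] X_norm_sq[OF u] power_mult_distrib energy_cmult[OF zero_less_one u])
qed (simp_all add: X_norm_nonneg)

text \<open>On the ray \<open>(1 + t) u\<close> the action is an explicit function of \<open>t\<close>, whose derivative at \<open>0\<close> is the Nehari
functional and vanishes at a critical point.\<close>
lemma solution_nehari:
  assumes u: "u \<in> X" and sol: "solution p \<omega> u"
  shows "nehari p \<omega> u = 0"
proof -
  define f where "f t = (1 + t)\<^sup>2 * energy \<omega> u / 2 - (1 + t) powr q * Lq_norm_pow q u / q" for t
  have f: "action p \<omega> (\<lambda>z. u z + complex_of_real t * u z) = f t" if "- 1 < t" for t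
  proof -
    have eq: "(\<lambda>z. u z + complex_of_real t * u z) = (\<lambda>z. complex_of_real (1 + t) * u z)"
      by (simp add: algebra_simps)
    have "action p \<omega> (\<lambda>z. complex_of_real (1 + t) * u z) = f t"
      unfolding action_eq[OF X_cmult[OF \<omega> u]] energy_cmult[OF \<omega> u] Lq_norm_pow_cmult norm_of_real f_def
      using that by simp
    then show ?thesis unfolding eq .
  qed
  have f0: "f 0 = action p \<omega> u" by (simp add: f_def action_eq[OF u])
  have "(f has_real_derivative energy \<omega> u - Lq_norm_pow q u) (at 0)"
  proof -
    have "((\<lambda>t. (1 + t) powr q) has_real_derivative q) (at 0)"
      using DERIV_fun_powr[of "\<lambda>t. 1 + t" 1 0 q] by (auto intro!: derivative_eq_intros)
    then have "((\<lambda>t. (1 + t)\<^sup>2 * energy \<omega> u / 2 - (1 + t) powr q * (Lq_norm_pow q u / q)) has_real_derivative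
       energy \<omega> u - q * (Lq_norm_pow q u / q)) (at 0)"
      by (auto intro!: derivative_eq_intros)
    then show ?thesis using p1 by (simp add: f_def[abs_def])
  qed
  then have lim: "((\<lambda>t. \<bar>(f t - f 0) / t\<bar>) \<longlongrightarrow> \<bar>energy \<omega> u - Lq_norm_pow q u\<bar>) (at 0)"
    unfolding DERIV_def by (intro tendsto_rabs) simp
  have "\<bar>energy \<omega> u - Lq_norm_pow q u\<bar> \<le> 0"
  proof (rule field_le_epsilon)
    fix e :: real assume e: "0 < e"
    define \<epsilon> where "\<epsilon> = e / (X_norm u + 1)"
    have X1: "0 < X_norm u + 1" using X_norm_nonneg[of u] by linarith
    have \<epsilon>: "0 < \<epsilon>" using e X1 by (simp add: \<epsilon>_def)
    obtain \<delta> where \<delta>: "0 < \<delta>" "\<And>h. h \<in> X \<Longrightarrow> X_norm h < \<delta> \<Longrightarrow> \<bar>action p \<omega> (\<lambda>z. u z + h z) - action p \<omega> u\<bar> \<le> \<epsilon> * X_norm h"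
      using sol \<epsilon> unfolding solution_def critical_point_def by blast
    define r where "r = min 1 (\<delta> / (X_norm u + 1))"
    have r: "0 < r" using \<delta> X1 by (simp add: r_def)
    have "\<forall>\<^sub>F t in at 0. dist t 0 < r" using r by (auto simp: eventually_at)
    then have "\<forall>\<^sub>F t in at 0. \<bar>(f t - f 0) / t\<bar> \<le> \<epsilon> * X_norm u"
      unfolding eventually_at_filter
    proof eventually_elim
      case (elim t)
      show ?case
      proof (intro impI)
        assume t: "t \<noteq> 0"
        with elim have tr: "\<bar>t\<bar> < r" by simp
        then have "\<bar>t\<bar> * (X_norm u + 1) < \<delta>" using X1 by (simp add: r_def pos_less_divide_eq)
        moreover have "\<bar>t\<bar> * X_norm u \<le> \<bar>t\<bar> * (X_norm u + 1)" by (rule mult_left_mono) auto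
        ultimately have n: "X_norm (\<lambda>z. complex_of_real t * u z) < \<delta>" unfolding X_norm_real_cmult[OF u] by linarith
        have "\<bar>t\<bar> < 1" using tr by (simp add: r_def)
        then have t1: "- 1 < t" by linarith
        have "\<bar>f t - f 0\<bar> \<le> \<epsilon> * (\<bar>t\<bar> * X_norm u)"
          using \<delta>(2)[OF X_cmult[OF \<omega> u] n] unfolding f[OF t1] f0 X_norm_real_cmult[OF u] .
        then show "\<bar>(f t - f 0) / t\<bar> \<le> \<epsilon> * X_norm u"
          using t by (simp add: abs_divide divide_le_eq ac_simps)
      qed
    qed
    then have "\<bar>energy \<omega> u - Lq_norm_pow q u\<bar> \<le> \<epsilon> * X_norm u"
      by (rule tendsto_upperbound[OF lim]) simp
    also have "\<dots> \<le> \<epsilon> * (X_norm u + 1)" using \<epsilon> by simp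
    also have "\<dots> = 0 + e" using X1 by (simp add: \<epsilon>_def)
    finally show "\<bar>energy \<omega> u - Lq_norm_pow q u\<bar> \<le> 0 + e" .
  qed
  then show ?thesis by (simp add: nehari_eq[OF u])
qed

text \<open>On the Nehari set the action is a positive multiple of the energy, and the solution found has the least
energy that \<open>Nehari_energy_lower_bound\<close> permits.\<close>
lemma ground_state_exists:
  "\<exists>Q. Q \<in> X \<and> nonzero Q \<and> ground_state p \<omega> Q \<and> equation_holds p \<omega> Q \<and>
       nehari p \<omega> Q = 0 \<and> action p \<omega> Q = min_level p \<omega>"
proof -
  note E = exponent_range \<omega>
  obtain Q where Q: "Q \<in> X" "nonzero Q" and EL: "\<And>g. g \<in> X \<Longrightarrow> Lq_deriv q Q g = Re (energy_form \<omega> Q g)"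
    and sharp: "best_constant q \<omega> * energy \<omega> Q powr (q / 2 - 1) = 1"
    by (rule weak_solution_exists) (rule that)
  have sol: "solution p \<omega> Q" by (rule Lq_deriv_critical[OF Q(1) EL])
  have N: "nehari p \<omega> Q = 0" by (rule solution_nehari[OF Q(1) sol])
  have on_nehari: "action p \<omega> u = (1 / 2 - 1 / q) * energy \<omega> u" if "u \<in> X" "nehari p \<omega> u = 0" for u
    using that by (simp add: action_eq nehari_eq field_simps)
  have min: "action p \<omega> Q \<le> action p \<omega> u" if u: "u \<in> X" "nonzero u" and Nu: "nehari p \<omega> u = 0" for u
  proof -
    have "energy \<omega> Q \<le> energy \<omega> u"
    proof (rule ccontr)
      assume "\<not> ?thesis"
      then have "energy \<omega> u powr (q / 2 - 1) < energy \<omega> Q powr (q / 2 - 1)"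
        using E(1) energy_nonneg[of \<omega> u] by (intro powr_less_mono2) auto
      from mult_strict_left_mono[OF this best_constant_pos[OF E]]
      have "best_constant q \<omega> * energy \<omega> u powr (q / 2 - 1) < 1" unfolding sharp .
      then show False using Nehari_energy_lower_bound[OF u Nu] by simp
    qed
    then show ?thesis
      unfolding on_nehari[OF Q(1) N] on_nehari[OF u(1) Nu] using E(1) by (intro mult_left_mono) (auto simp: field_simps)
  qed
  have "ground_state p \<omega> Q"
    unfolding ground_state_def using Q sol min solution_nehari by blast
  moreover have "min_level p \<omega> = action p \<omega> Q"
    unfolding min_level_def by (rule cInf_eq_minimum) (use Q N min in blast)+
  moreover have "equation_holds p \<omega> Q" by (rule Lq_deriv_equation[OF Q(1) EL])
  ultimately show ?thesis using Q N by metis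
qed

end

theorem theorem1p1:
  fixes p \<omega> :: real
  assumes "1 < p" and "p < 5" and "\<omega> > 0"
  shows "\<exists>Q. Q \<in> X \<and> nonzero Q \<and> ground_state p \<omega> Q \<and> equation_holds p \<omega> Q \<and>
             nehari p \<omega> Q = 0 \<and> action p \<omega> Q = min_level p \<omega>"
  by (rule ground_state_exists[OF assms])

end
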